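(* The Arnoux-Yoccoz surface $(X,\omega)$ has at least two transverse hyperbolic directions. More precisely, the Teichmüller disc of $(X,\omega)$ is stabilized by the Arnoux-Yoccoz pseudo-Anosov diffeomorphism $\Phi$ and by a pseudo-Anosov diffeomorphism $\tilde\Phi$ not commuting with $\Phi$; that is, there is a pseudo-Anosov affine diffeomorphism $\tilde\Phi$ of $(X,\omega)$ with $\Phi\tilde\Phi\neq\tilde\Phi\Phi$. The expansion factor $\tilde\lambda=\lambda(\tilde\Phi)$ has degree $6$ over $\mathbb{Q}$.
   Context: A translation surface is a compact connected Riemann surface $X$ with a non-zero holomorphic one-form $\omega$; its charts are local primitives of $\omega$. An affine diffeomorphism of $(X,\omega)$ is an orientation-preserving homeomorphism of $X$ that permutes the zeroes of $\omega$ and is affine in the charts of $\omega$; its derivative $Df$ is a constant matrix in $\mathrm{SL}_2(\mathbb{R})$. The Veech group $\mathrm{SL}(X,\omega)$ is the stabilizer of $(X,\omega)$ under the natural action of $\mathrm{SL}_2(\mathbb{R})$ on translation surfaces; it equals the group of derivatives of affine diffeomorphisms. The Teichmüller disc of $(X,\omega)$ is (the image in the moduli space of) its $\mathrm{SL}_2(\mathbb{R})$-orbit, and it is stabilized by $f$ when $f$ is an affine diffeomorphism of $(X,\omega)$, i.e. $Df\in \mathrm{SL}(X,\omega)$. An affine diffeomorphism $f$ is pseudo-Anosov if $|\mathrm{trace}(Df)|>2$. Its expansion factor $\lambda(f)>1$ is the largest absolute value of an eigenvalue of $Df$. A hyperbolic direction is an eigendirection of $Df$ (the direction of the stable or unstable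 foliation) for some pseudo-Anosov affine diffeomorphism $f$. The Arnoux-Yoccoz surface (genus $3$). Let $\alpha\approx 0.5437$ be the real root of $X^3+X^2+X-1$. The surface $(X,\omega)$ is explicitly given by its decomposition into three cylinders in the direction of slope $1-\alpha^2$. Consider the vectors $g_1=g_3=(3+2\alpha+\alpha^2,\,2+2\alpha)$, $g_2=g_5=(\alpha,\,-1+2\alpha+\alpha^2)$, $g_4=g_6=(1+\alpha^2,\,2-2\alpha)$, all parallel to $(1,1-\alpha^2)$. Take three parallelograms in $\mathbb{R}^2$ with vertices $0,w,w+\tau,\tau$, where: - (big) $w=g_2+g_4+g_5+g_1=(4+4\alpha+2\alpha^2,\,2+4\alpha+2\alpha^2)$, $\tau=(1-\alpha^2,\,2-2\alpha)$; the bottom side from $0$ to $w$ is subdivided, starting at $0$, into successive segments labelled $3,2,6,5$; the top side from $\tau$ to $\tau+w$ is subdivided, starting at $\tau$, into successive segments labelled $2,4,5,1$; - (medium) $w=g_4$, $\tau=(1-\alpha,\,2\alpha^2)$; the bottom side is labelled $4$, the top side is labelled $6$; - (small) $w=g_1$, $\tau=(1+\alpha+2\alpha^2,\,4\alpha-2\alpha^2)$; the bottom side is labelled $1$, the top side is labelled $3$. Here the segment labelled $i$ has displacement vector $g_i$. In each parallelogram glue the side $[0,\tau]$ to the side $[w,w+\tau]$ by translation, and for each $i\in\{1,\dots,6\}$ glue the top segment labelled $i$ to the bottom segment labelled $i$ by translation. The form $\omega$ is the one induced by $dz=dx+i\,dy$; it has two zeroes, each of order $2$. The Arnoux-Yoccoz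 pseudo-Anosov diffeomorphism $\Phi=\Phi_3$ is the affine diffeomorphism of $(X,\omega)$ with derivative $\begin{pmatrix}\alpha&0\\0&\alpha^{-1}\end{pmatrix}$. *)

theory Defs
  imports "HOL-Analysis.Analysis" "HOL-Computational_Algebra.Polynomial"
begin

section \<open>Translation surfaces and affine diffeomorphisms\<close>

text \<open>
  A translation surface \<open>(X, \<omega>)\<close> is represented by the topological space \<open>X\<close> together with the
  local primitives of \<open>\<omega>\<close>: \<open>local_primitive S U z\<close> says that \<open>U\<close> is an open subset of \<open>X\<close> and
  \<open>dz = \<omega>\<close> on \<open>U\<close>.  Throughout, the complex plane is identified with \<open>real^2\<close>, so that
  \<open>2 \<times> 2\<close> real matrices act on the values of primitives.
\<close>

record 'a flat_surface =
  space_of :: "'a topology"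
  local_primitive :: "'a set \<Rightarrow> ('a \<Rightarrow> real^2) \<Rightarrow> bool"

definition translation_chart :: "'a flat_surface \<Rightarrow> 'a set \<Rightarrow> ('a \<Rightarrow> real^2) \<Rightarrow> bool" where
  "translation_chart S U z \<longleftrightarrow>
     openin (space_of S) U \<and> local_primitive S U z \<and> open (z ` U) \<and>
     homeomorphic_map (subtopology (space_of S) U) (top_of_set (z ` U)) z"

text \<open>
  At a zero of order \<open>k\<close> a primitive looks like \<open>\<zeta> \<mapsto> \<zeta>^(k+1)\<close> up to a constant, hence it is a
  local homeomorphism exactly at the points where \<open>\<omega>\<close> does not vanish.
\<close>

definition zeroes :: "'a flat_surface \<Rightarrow> 'a set" where
  "zeroes S = {p \<in> topspace (space_of S). \<nexists>U z. translation_chart S U z \<and> p \<in> U}"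

text \<open>
  The condition \<open>det A = 1\<close> contains that \<open>f\<close> preserves the orientation.  A function is only relevant
  on the points of the surface.
\<close>

definition affine_with_derivative :: "'a flat_surface \<Rightarrow> ('a \<Rightarrow> 'a) \<Rightarrow> real^2^2 \<Rightarrow> bool" where
  "affine_with_derivative S f A \<longleftrightarrow>
     det A = 1 \<and>
     homeomorphic_map (space_of S) (space_of S) f \<and>
     f ` zeroes S = zeroes S \<and>
     (\<forall>p \<in> topspace (space_of S) - zeroes S.
        \<exists>U z V w c. translation_chart S U z \<and> p \<in> U \<and> translation_chart S V w \<and> f ` U \<subseteq> V \<and>
          (\<forall>q\<in>U. w (f q) = A *v z q + c))"

definition affine_diffeo :: "'a flat_surface \<Rightarrow> ('a \<Rightarrow> 'a) \<Rightarrow> bool" where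
  "affine_diffeo S f \<longleftrightarrow> (\<exists>A. affine_with_derivative S f A)"

definition affine_derivative :: "'a flat_surface \<Rightarrow> ('a \<Rightarrow> 'a) \<Rightarrow> real^2^2" where
  "affine_derivative S f = (THE A. affine_with_derivative S f A)"

definition pseudo_anosov :: "'a flat_surface \<Rightarrow> ('a \<Rightarrow> 'a) \<Rightarrow> bool" where
  "pseudo_anosov S f \<longleftrightarrow> affine_diffeo S f \<and> \<bar>trace (affine_derivative S f)\<bar> > 2"

definition eigenvector_of :: "real^2^2 \<Rightarrow> real^2 \<Rightarrow> real \<Rightarrow> bool" where
  "eigenvector_of A v c \<longleftrightarrow> v \<noteq> 0 \<and> A *v v = c *\<^sub>R v"

text \<open>
  Only used for pseudo-Anosov diffeomorphisms, whose derivative has determinant 1 and absolute trace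
  greater than 2, so that both complex eigenvalues are real.
\<close>

definition expansion_factor :: "'a flat_surface \<Rightarrow> ('a \<Rightarrow> 'a) \<Rightarrow> real" where
  "expansion_factor S f = Max {\<bar>c\<bar> | c. \<exists>v. eigenvector_of (affine_derivative S f) v c}"

text \<open>Directions are lines through the origin.\<close>

definition hyperbolic_direction :: "'a flat_surface \<Rightarrow> (real^2) set \<Rightarrow> bool" where
  "hyperbolic_direction S L \<longleftrightarrow>
     (\<exists>f v c. pseudo_anosov S f \<and> eigenvector_of (affine_derivative S f) v c \<and> L = span {v})"

section \<open>Degree of an algebraic number\<close>

definition is_minimal_polynomial :: "rat poly \<Rightarrow> real \<Rightarrow> bool" where
  "is_minimal_polynomial p x \<longleftrightarrow>
     lead_coeff p = 1 \<and> poly (map_poly of_rat p) x = 0 \<and>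
     (\<forall>q. q \<noteq> 0 \<and> poly (map_poly of_rat q) x = 0 \<longrightarrow> degree p \<le> degree q)"

definition has_degree_over_rat :: "real \<Rightarrow> nat \<Rightarrow> bool" where
  "has_degree_over_rat x n \<longleftrightarrow> (\<exists>p. is_minimal_polynomial p x \<and> degree p = n)"

section \<open>Quotient spaces\<close>

definition quotient_space :: "'a topology \<Rightarrow> ('a \<times> 'a) set \<Rightarrow> 'a set topology" where
  "quotient_space T R =
     topology (\<lambda>U. U \<subseteq> topspace T // R \<and> openin T {x \<in> topspace T. R `` {x} \<in> U})"

lemma openin_quotient_space:
  "openin (quotient_space T R) U \<longleftrightarrow>
     U \<subseteq> topspace T // R \<and> openin T {x \<in> topspace T. R `` {x} \<in> U}"
proof -
  have "istopology (\<lambda>U. U \<subseteq> topspace T // R \<and> openin T {x \<in> topspace T. R `` {x} \<in> U})"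
    unfolding istopology_def
  proof (intro conjI allI impI; (elim conjE)?)
    fix U V
    assume "openin T {x \<in> topspace T. R `` {x} \<in> U}" "openin T {x \<in> topspace T. R `` {x} \<in> V}"
    then have "openin T ({x \<in> topspace T. R `` {x} \<in> U} \<inter> {x \<in> topspace T. R `` {x} \<in> V})"
      by (rule openin_Int)
    then show "openin T {x \<in> topspace T. R `` {x} \<in> U \<inter> V}"
      by (rule back_subst[of "openin T"]) auto
  next
    fix \<K>
    assume *: "\<forall>K\<in>\<K>. K \<subseteq> topspace T // R \<and> openin T {x \<in> topspace T. R `` {x} \<in> K}"
    then have "openin T (\<Union>K\<in>\<K>. {x \<in> topspace T. R `` {x} \<in> K})"
      by auto
    then show "openin T {x \<in> topspace T. R `` {x} \<in> \<Union>\<K>}"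
      by (rule back_subst[of "openin T"]) auto
  qed auto
  then show ?thesis
    by (simp add: quotient_space_def)
qed

section \<open>The Arnoux-Yoccoz surface of genus 3\<close>

definition ay_alpha :: real where
  "ay_alpha = (THE x. x^3 + x^2 + x - 1 = 0)"

lemma ay_alpha_ex1: "\<exists>!x::real. x^3 + x^2 + x - 1 = 0"
proof -
  have "\<exists>x\<ge>0. x \<le> 1 \<and> x^3 + x^2 + x - 1 = (0::real)"
    by (rule IVT') (auto intro!: continuous_intros)
  moreover have "x = y" if "x^3 + x^2 + x - 1 = 0" "y^3 + y^2 + y - 1 = 0" for x y :: real
  proof -
    have "(x - y) * (x^2 + x * y + y^2 + x + y + 1) = 0"
      using that by algebra
    moreover have "2 * (x^2 + x * y + y^2 + x + y + 1) = (x + y)^2 + (x + 1)^2 + (y + 1)^2"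
      by algebra
    moreover have "(x + y)^2 + (x + 1)^2 + (y + 1)^2 \<noteq> 0"
      by (smt (verit) zero_le_power2 power2_eq_iff_nonneg zero_eq_power2)
    ultimately show ?thesis
      by auto
  qed
  ultimately show ?thesis
    by blast
qed

datatype ay_piece = Big | Medium | Small

definition ay_g :: "nat \<Rightarrow> real^2" where
  "ay_g i = (let a = ay_alpha in
     if i \<in> {1, 3} then vector [3 + 2*a + a^2, 2 + 2*a]
     else if i \<in> {2, 5} then vector [a, -1 + 2*a + a^2]
     else vector [1 + a^2, 2 - 2*a])"

fun ay_w :: "ay_piece \<Rightarrow> real^2" where
  "ay_w Big = ay_g 2 + ay_g 4 + ay_g 5 + ay_g 1"
| "ay_w Medium = ay_g 4"
| "ay_w Small = ay_g 1"

fun ay_tau :: "ay_piece \<Rightarrow> real^2" where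
  "ay_tau Big = (let a = ay_alpha in vector [1 - a^2, 2 - 2*a])"
| "ay_tau Medium = (let a = ay_alpha in vector [1 - a, 2 * a^2])"
| "ay_tau Small = (let a = ay_alpha in vector [1 + a + 2 * a^2, 4*a - 2 * a^2])"

fun ay_bottom :: "ay_piece \<Rightarrow> nat list" where
  "ay_bottom Big = [3, 2, 6, 5]"
| "ay_bottom Medium = [4]"
| "ay_bottom Small = [1]"

fun ay_top :: "ay_piece \<Rightarrow> nat list" where
  "ay_top Big = [2, 4, 5, 1]"
| "ay_top Medium = [6]"
| "ay_top Small = [3]"

text \<open>Displacement from the beginning of a subdivided side to the beginning of its segment \<open>i\<close>.\<close>

definition ay_offset :: "nat \<Rightarrow> nat list \<Rightarrow> real^2" where
  "ay_offset i ls = (\<Sum>j \<leftarrow> takeWhile (\<lambda>j. j \<noteq> i) ls. ay_g j)"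

text \<open>The topological disjoint union of the three closed parallelograms.\<close>

definition ay_pieces :: "(ay_piece \<times> (real^2)) topology" where
  "ay_pieces = sum_topology
     (\<lambda>P. top_of_set (convex hull {0, ay_w P, ay_w P + ay_tau P, ay_tau P})) UNIV"

inductive ay_glue :: "ay_piece \<times> (real^2) \<Rightarrow> ay_piece \<times> (real^2) \<Rightarrow> bool" where
  side: "0 \<le> s \<Longrightarrow> s \<le> 1 \<Longrightarrow> ay_glue (P, s *\<^sub>R ay_tau P) (P, ay_w P + s *\<^sub>R ay_tau P)"
| segment: "i \<in> set (ay_top P) \<Longrightarrow> i \<in> set (ay_bottom Q) \<Longrightarrow> 0 \<le> s \<Longrightarrow> s \<le> 1 \<Longrightarrow>
    ay_glue (P, ay_tau P + ay_offset i (ay_top P) + s *\<^sub>R ay_g i)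
            (Q, ay_offset i (ay_bottom Q) + s *\<^sub>R ay_g i)"

definition ay_rel :: "((ay_piece \<times> (real^2)) \<times> (ay_piece \<times> (real^2))) set" where
  "ay_rel = {(x, y). x \<in> topspace ay_pieces \<and> y \<in> topspace ay_pieces \<and> equivclp ay_glue x y}"

text \<open>
  The form induced by \<open>dx + i dy\<close>: a function is a primitive of it if, in each parallelogram
  (boundary included), it differs from the planar coordinate by a locally constant function.
\<close>

definition ay_surface :: "(ay_piece \<times> (real^2)) set flat_surface" where
  "ay_surface =
     \<lparr> space_of = quotient_space ay_pieces ay_rel,
       local_primitive = (\<lambda>U z.
         openin (quotient_space ay_pieces ay_rel) U \<and>
         (\<forall>x \<in> topspace ay_pieces. ay_rel `` {x} \<in> U \<longrightarrow>
            (\<exists>N. openin ay_pieces N \<and> x \<in> N \<and>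
              (\<forall>y\<in>N. ay_rel `` {y} \<in> U \<and>
                 z (ay_rel `` {y}) - snd y = z (ay_rel `` {x}) - snd x)))) \<rparr>"

definition arnoux_yoccoz_diffeo ::
    "((ay_piece \<times> (real^2)) set \<Rightarrow> (ay_piece \<times> (real^2)) set) \<Rightarrow> bool" where
  "arnoux_yoccoz_diffeo f \<longleftrightarrow>
     affine_diffeo ay_surface f \<and>
     affine_derivative ay_surface f = vector [vector [ay_alpha, 0], vector [0, 1 / ay_alpha]]"

end

theory Submission
  imports Defs
begin

text \<open>
  An affine isomorphism between flat surfaces is a homeomorphism that transports local primitives
  through a fixed matrix \<open>A\<close>; an affine self-isomorphism with \<open>det A = 1\<close> is an affine diffeomorphism
  with derivative \<open>A\<close>.  Cutting a convex polygon along a diagonal, and hence flipping an edge of a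
  triangulation, does not change the flat surface.  The three parallelograms are cut into twelve
  triangles, and for \<open>D = diag(\<alpha>, 1/\<alpha>)\<close> as well as for a matrix \<open>B\<close> of trace
  \<open>t = 11 + 8 \<alpha> + 5 \<alpha>\<^sup>2\<close> an explicit sequence of flips leads from this triangulation to its image
  under the matrix, up to relabelling; so both matrices are derivatives of affine diffeomorphisms.
  Since primitives differ by locally constant functions, derivatives are unique, and a
  diffeomorphism commuting with \<open>\<Phi>\<close> has derivative commuting with \<open>D\<close>, which \<open>B\<close> is not.  The expansion
  factor \<open>\<lambda>\<close> satisfies \<open>\<lambda>\<^sup>2 - t \<lambda> + 1 = 0\<close>, and \<open>t\<^sup>2 - 4\<close> has norm 976 over the rationals, which is
  not a square, so \<open>\<lambda>\<close> has degree 2 over the cubic field \<open>\<rat>(\<alpha>)\<close>.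
\<close>

section \<open>Affine isomorphisms of flat surfaces\<close>

text \<open>The obstacle is the topology of the quotient: a vertex of the surface is surrounded by
  corners of several polygons, and every cut changes the set of classes. No neighbourhood of a
  vertex is ever described. It is enough that the map from finer to coarser pieces is a continuous
  closed surjection, closed because the pieces are finitely many compact sets, and that it matches
  the two gluing relations. Zeroes are carried along, being defined from the topology and the
  primitives. A chart is written down at one place only, inside one parallelogram, since uniqueness
  of the derivative requires a regular point. All vertices and both matrices have coordinates in the
  ring generated by \<alpha>; \<open>D\<close> has them because \<alpha> is a unit with inverse 1 +
  \<alpha> + \<alpha>^2. Equality of edges is therefore exact integer arithmetic, and convexity is a
  finite list of sign checks. The norm decides the degree because it is multiplicative: squares in
  the cubic field have rational squares as norms.\<close>

text \<open>Primitives are compared on arbitrary subsets, also around zeroes, and not only through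
  charts. The equivalence makes the notion invertible. As \<open>w\<close> is free outside the image
  of \<open>U\<close>, it also contains that being a primitive depends only on the values on the
  domain.\<close>

definition affine_iso ::
    "'a flat_surface \<Rightarrow> 'b flat_surface \<Rightarrow> ('a \<Rightarrow> 'b) \<Rightarrow> real^2^2 \<Rightarrow> bool" where
  "affine_iso S S' f A \<longleftrightarrow>
     homeomorphic_map (space_of S) (space_of S') f \<and> invertible A \<and>
     (\<forall>U z w. U \<subseteq> topspace (space_of S) \<longrightarrow> (\<forall>p\<in>U. w (f p) = A *v z p) \<longrightarrow>
        (local_primitive S' (f ` U) w \<longleftrightarrow> local_primitive S U z))"

lemma affine_iso_homeo: "affine_iso S S' f A \<Longrightarrow> homeomorphic_map (space_of S) (space_of S') f"
  by (simp add: affine_iso_def)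

lemma affine_iso_primitive:
  assumes "affine_iso S S' f A" "U \<subseteq> topspace (space_of S)" "\<And>p. p \<in> U \<Longrightarrow> w (f p) = A *v z p"
  shows "local_primitive S' (f ` U) w \<longleftrightarrow> local_primitive S U z"
  using assms unfolding affine_iso_def by blast

lemma affine_iso_compose:
  assumes f: "affine_iso S S' f A" and g: "affine_iso S' S'' g B"
  shows "affine_iso S S'' (g \<circ> f) (B ** A)"
  unfolding affine_iso_def
proof (intro conjI allI impI)
  have hf: "homeomorphic_map (space_of S) (space_of S') f"
    and hg: "homeomorphic_map (space_of S') (space_of S'') g"
    using f g by (auto simp: affine_iso_def)
  show "homeomorphic_map (space_of S) (space_of S'') (g \<circ> f)"
    using hf hg by (rule homeomorphic_map_compose)
  show "invertible (B ** A)"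
    using f g by (auto simp: affine_iso_def intro: invertible_mult)
  fix U z w
  assume U: "U \<subseteq> topspace (space_of S)" and w: "\<forall>p\<in>U. w ((g \<circ> f) p) = (B ** A) *v z p"
  \<comment> \<open>The intermediate primitive on \<open>S'\<close>: the function \<open>z\<close>
    pushed forward along \<open>f\<close>.\<close>
  define v where "v q = A *v z (inv_into (topspace (space_of S)) f q)" for q
  have v: "v (f p) = A *v z p" if "p \<in> U" for p
    using that U homeomorphic_imp_injective_map[OF hf] by (simp add: v_def subset_iff)
  have fU: "f ` U \<subseteq> topspace (space_of S')"
    using U homeomorphic_imp_surjective_map[OF hf] by blast
  have "local_primitive S'' (g ` f ` U) w \<longleftrightarrow> local_primitive S' (f ` U) v"
    by (rule affine_iso_primitive[OF g fU]) (use w v in \<open>auto simp: matrix_vector_mul_assoc\<close>)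
  also have "\<dots> \<longleftrightarrow> local_primitive S U z"
    by (rule affine_iso_primitive[OF f U]) (use v in auto)
  finally show "local_primitive S'' ((g \<circ> f) ` U) w \<longleftrightarrow> local_primitive S U z"
    by (simp add: image_comp)
qed

lemma affine_iso_inverse:
  assumes f: "affine_iso S S' f A" and AB: "A ** B = mat 1"
  obtains g where "affine_iso S' S g B"
    "\<And>p. p \<in> topspace (space_of S) \<Longrightarrow> g (f p) = p"
    "\<And>q. q \<in> topspace (space_of S') \<Longrightarrow> f (g q) = q"
proof -
  obtain g where fg: "homeomorphic_maps (space_of S) (space_of S') f g"
    using affine_iso_homeo[OF f] homeomorphic_map_maps by blast
  then have gf: "\<And>p. p \<in> topspace (space_of S) \<Longrightarrow> g (f p) = p"
    and fg': "\<And>q. q \<in> topspace (space_of S') \<Longrightarrow> f (g q) = q"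
    and hg: "homeomorphic_map (space_of S') (space_of S) g"
    by (auto simp: homeomorphic_maps_map)
  have BA: "B ** A = mat 1"
    using AB matrix_left_right_inverse by blast
  have "affine_iso S' S g B"
    unfolding affine_iso_def
  proof (intro conjI allI impI hg)
    show "invertible B"
      using AB BA unfolding invertible_def by blast
    fix U z w
    assume U: "U \<subseteq> topspace (space_of S')" and w: "\<forall>p\<in>U. w (g p) = B *v z p"
    have gU: "g ` U \<subseteq> topspace (space_of S)"
      using U homeomorphic_imp_surjective_map[OF hg] by blast
    have "local_primitive S' (f ` g ` U) z \<longleftrightarrow> local_primitive S (g ` U) w"
      by (rule affine_iso_primitive[OF f gU])
        (use w U fg' AB in \<open>auto simp: matrix_vector_mul_assoc subset_iff\<close>)
    moreover have "f ` g ` U = U"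
      using U fg' by force
    ultimately show "local_primitive S (g ` U) w \<longleftrightarrow> local_primitive S' U z"
      by simp
  qed
  then show thesis
    using that gf fg' by blast
qed

section \<open>Charts and zeroes under affine isomorphisms\<close>

text \<open>On the image of \<open>U\<close> the function \<open>w\<close> is the composite of the
  inverse of \<open>f\<close>, the chart \<open>z\<close> and the linear homeomorphism given by
  \<open>A\<close>. Its image is open as a preimage under the inverse matrix.\<close>

lemma affine_iso_chart_image:
  assumes f: "affine_iso S S' f A" and U: "translation_chart S U z"
    and w: "\<And>p. p \<in> U \<Longrightarrow> w (f p) = A *v z p"
  shows "translation_chart S' (f ` U) w"
proof -
  have hf: "homeomorphic_map (space_of S) (space_of S') f"
    using f by (rule affine_iso_homeo)
  have oU: "openin (space_of S) U" and lp: "local_primitive S U z" and oz: "open (z ` U)"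
    and hz: "homeomorphic_map (subtopology (space_of S) U) (top_of_set (z ` U)) z"
    using U by (auto simp: translation_chart_def)
  have Us: "U \<subseteq> topspace (space_of S)"
    using oU openin_subset by blast
  have inv: "invertible A"
    using f by (simp add: affine_iso_def)
  then obtain B where B: "A ** B = mat 1" "B ** A = mat 1"
    unfolding invertible_def by blast
  have wf: "w ` f ` U = (*v) A ` z ` U"
    using w by (force simp: image_iff)
  have hA: "homeomorphic_map (top_of_set X) (top_of_set ((*v) A ` X)) ((*v) A)" for X
  proof -
    have "homeomorphic_maps (top_of_set X) (top_of_set ((*v) A ` X)) ((*v) A) ((*v) B)"
      unfolding homeomorphic_maps_def
      by (auto simp: matrix_vector_mul_assoc B intro!: matrix_vector_mult_linear_continuous_on)
    then show ?thesis
      by (rule homeomorphic_maps_imp_map)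
  qed
  obtain g where fg: "homeomorphic_maps (space_of S) (space_of S') f g"
    using hf homeomorphic_map_maps by blast
  have "f ` U \<subseteq> topspace (space_of S')"
    using hf Us homeomorphic_imp_surjective_map by blast
  then have "homeomorphic_maps (subtopology (space_of S) U) (subtopology (space_of S') (f ` U)) f g"
    using fg Us by (intro homeomorphic_maps_subtopologies) (auto simp: Int_absorb1)
  then have hg: "homeomorphic_map (subtopology (space_of S') (f ` U)) (subtopology (space_of S) U) g"
    using homeomorphic_maps_map by blast
  have gf: "g (f p) = p" if "p \<in> U" for p
    using fg that Us by (auto simp: homeomorphic_maps_def)
  have "homeomorphic_map (subtopology (space_of S') (f ` U)) (top_of_set (w ` f ` U)) w"
    unfolding wf
    by (rule homeomorphic_map_eq[OF homeomorphic_map_compose[OF homeomorphic_map_compose[OF hg hz] hA]])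
      (use w gf in auto)
  moreover have "openin (space_of S') (f ` U)"
    using homeomorphic_map_openness[OF hf Us] oU by blast
  moreover have "local_primitive S' (f ` U) w"
    using affine_iso_primitive[OF f Us, of w z] w lp by simp
  moreover have "open (w ` f ` U)"
  proof -
    have "(*v) A ` z ` U = (*v) B -` z ` U"
      using B by (auto simp: matrix_vector_mul_assoc image_iff)
        (metis B(1) matrix_vector_mul_assoc matrix_vector_mul_lid)
    also have "open \<dots>"
      by (intro continuous_open_vimage oz) (simp add: matrix_vector_mult_linear_continuous_at)
    finally show ?thesis
      by (simp add: wf)
  qed
  ultimately show ?thesis
    by (simp add: translation_chart_def)
qed

lemma affine_iso_chart_push:
  assumes f: "affine_iso S S' f A" and U: "translation_chart S U z"
  obtains w where "translation_chart S' (f ` U) w" "\<And>p. p \<in> U \<Longrightarrow> w (f p) = A *v z p"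
proof -
  have "U \<subseteq> topspace (space_of S)"
    using U openin_subset by (auto simp: translation_chart_def)
  then have w: "A *v z (inv_into (topspace (space_of S)) f (f p)) = A *v z p" if "p \<in> U" for p
    using that homeomorphic_imp_injective_map[OF affine_iso_homeo[OF f]] by (simp add: subset_iff)
  show thesis
    by (rule that[of "\<lambda>q. A *v z (inv_into (topspace (space_of S)) f q)", OF affine_iso_chart_image[OF f U] w])
      (simp_all add: w)
qed

text \<open>Regular points are those covered by charts, and charts can be pushed forward along
  \<open>f\<close> and along its inverse.\<close>

lemma affine_iso_zeroes:
  assumes f: "affine_iso S S' f A"
  shows "f ` zeroes S = zeroes S'"
proof -
  have "invertible A"
    using f by (simp add: affine_iso_def)
  then obtain B where B: "A ** B = mat 1" "B ** A = mat 1"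
    unfolding invertible_def by blast
  obtain g where g: "affine_iso S' S g B"
    and gf: "\<And>p. p \<in> topspace (space_of S) \<Longrightarrow> g (f p) = p"
    and fg: "\<And>q. q \<in> topspace (space_of S') \<Longrightarrow> f (g q) = q"
    using affine_iso_inverse[OF f B(1)] by blast
  have sf: "f ` topspace (space_of S) = topspace (space_of S')"
    and sg: "g ` topspace (space_of S') = topspace (space_of S)"
    using homeomorphic_imp_surjective_map[OF affine_iso_homeo[OF f]]
      homeomorphic_imp_surjective_map[OF affine_iso_homeo[OF g]] by simp_all
  have *: "(\<exists>U z. translation_chart S' U z \<and> f p \<in> U) \<longleftrightarrow> (\<exists>U z. translation_chart S U z \<and> p \<in> U)"
    if "p \<in> topspace (space_of S)" for p
    using affine_iso_chart_push[OF f] affine_iso_chart_push[OF g] gf[OF that]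
    by (metis imageI)
  have "p \<in> zeroes S \<longleftrightarrow> f p \<in> zeroes S'" if "p \<in> topspace (space_of S)" for p
  proof -
    have "f p \<in> topspace (space_of S')"
      using sf that by blast
    then show ?thesis
      using *[OF that] that unfolding zeroes_def by blast
  qed
  moreover have "zeroes S \<subseteq> topspace (space_of S)"
    by (auto simp: zeroes_def)
  ultimately have "zeroes S = {p \<in> topspace (space_of S). f p \<in> zeroes S'}"
    by auto
  moreover have "zeroes S' \<subseteq> f ` topspace (space_of S)"
    using sf by (auto simp: zeroes_def)
  ultimately show ?thesis
    by auto
qed

lemma affine_with_derivative_chart:
  assumes "affine_with_derivative S f A" "p \<in> topspace (space_of S) - zeroes S"
  obtains U z V w c where "translation_chart S U z" "p \<in> U" "translation_chart S V w"
      "f ` U \<subseteq> V" "\<And>q. q \<in> U \<Longrightarrow> w (f q) = A *v z q + c"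
proof -
  have "\<exists>U z V w c. translation_chart S U z \<and> p \<in> U \<and> translation_chart S V w \<and> f ` U \<subseteq> V \<and>
          (\<forall>q\<in>U. w (f q) = A *v z q + c)"
    using assms by (simp add: affine_with_derivative_def)
  then show thesis
    using that by auto
qed

section \<open>From affine isomorphisms to affine diffeomorphisms and their composites\<close>

lemma affine_with_derivative_affine_iso:
  assumes f: "affine_iso S S f A" and "det A = 1"
  shows "affine_with_derivative S f A"
  unfolding affine_with_derivative_def
proof (intro conjI ballI)
  fix p assume "p \<in> topspace (space_of S) - zeroes S"
  then obtain U z where U: "translation_chart S U z" "p \<in> U"
    by (auto simp: zeroes_def)
  obtain w where "translation_chart S (f ` U) w" "\<And>p. p \<in> U \<Longrightarrow> w (f p) = A *v z p"
    using affine_iso_chart_push[OF f U(1)] by blast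
  with U show "\<exists>U z V w c. translation_chart S U z \<and> p \<in> U \<and> translation_chart S V w \<and> f ` U \<subseteq> V \<and>
          (\<forall>q\<in>U. w (f q) = A *v z q + c)"
    by (metis add.right_neutral order_refl)
qed (simp_all add: assms affine_iso_zeroes[OF f] affine_iso_homeo[OF f])

text \<open>Two arbitrary affine diffeomorphisms come with unrelated charts at the intermediate
  point, which would have to be matched. An affine isomorphism moves whole charts and avoids this;
  it will be the constructed map, composed with an arbitrary \<Phi>.\<close>

lemma affine_with_derivative_compose_iso:
  assumes f: "affine_with_derivative S f A" and g: "affine_iso S S g B" "det B = 1"
  shows "affine_with_derivative S (f \<circ> g) (A ** B)"
  unfolding affine_with_derivative_def
proof (intro conjI ballI)
  have dg: "homeomorphic_map (space_of S) (space_of S) g" "g ` zeroes S = zeroes S"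
    using affine_iso_homeo[OF g(1)] affine_iso_zeroes[OF g(1)] by simp_all
  have inj: "inj_on g (topspace (space_of S))" and sur: "g ` topspace (space_of S) = topspace (space_of S)"
    using homeomorphic_imp_injective_map[OF dg(1)] homeomorphic_imp_surjective_map[OF dg(1)] by simp_all
  show "det (A ** B) = 1"
    using f g by (simp add: det_mul affine_with_derivative_def)
  show "homeomorphic_map (space_of S) (space_of S) (f \<circ> g)"
    using dg f unfolding affine_with_derivative_def by (blast intro: homeomorphic_map_compose)
  show "(f \<circ> g) ` zeroes S = zeroes S"
    using dg f unfolding affine_with_derivative_def by (metis image_comp)
  have "invertible B"
    using g by (simp add: affine_iso_def)
  then obtain C where C: "B ** C = mat 1" "C ** B = mat 1"
    unfolding invertible_def by blast
  obtain h where h: "affine_iso S S h C"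
    and hg: "\<And>p. p \<in> topspace (space_of S) \<Longrightarrow> h (g p) = p"
    and gh: "\<And>q. q \<in> topspace (space_of S) \<Longrightarrow> g (h q) = q"
    using affine_iso_inverse[OF g(1) C(1)] by blast
  fix p assume p: "p \<in> topspace (space_of S) - zeroes S"
  have "zeroes S \<subseteq> topspace (space_of S)"
    by (auto simp: zeroes_def)
  then have "g p \<notin> g ` zeroes S"
    using p inj by (auto simp: inj_on_image_mem_iff)
  then have "g p \<notin> zeroes S"
    using dg(2) by simp
  then have "g p \<in> topspace (space_of S) - zeroes S"
    using sur p by blast
  then obtain U z V w c where U: "translation_chart S U z" "g p \<in> U" "translation_chart S V w"
      "f ` U \<subseteq> V" "\<And>q. q \<in> U \<Longrightarrow> w (f q) = A *v z q + c"
    using affine_with_derivative_chart[OF f] by blast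
  obtain z' where z': "translation_chart S (h ` U) z'" "\<And>q. q \<in> U \<Longrightarrow> z' (h q) = C *v z q"
    using affine_iso_chart_push[OF h U(1)] by blast
  have Us: "U \<subseteq> topspace (space_of S)"
    using U(1) openin_subset by (auto simp: translation_chart_def)
  have "p \<in> h ` U"
    using U(2) hg p by (metis DiffE imageI)
  moreover have "(f \<circ> g) ` h ` U = f ` U"
    using gh Us by (force simp: image_comp intro!: image_cong)
  then have "(f \<circ> g) ` h ` U \<subseteq> V"
    using U(4) by simp
  moreover have "w ((f \<circ> g) q) = (A ** B) *v z' q + c" if q: "q \<in> h ` U" for q
  proof -
    obtain r where r: "r \<in> U" "q = h r"
      using q by blast
    have "B *v z' (h r) = z r"
      using z'(2)[OF r(1)] C by (simp add: matrix_vector_mul_assoc)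
    then show ?thesis
      using r gh Us U(5) by (auto simp: subset_iff simp flip: matrix_vector_mul_assoc)
  qed
  ultimately show "\<exists>U z V w c. translation_chart S U z \<and> p \<in> U \<and> translation_chart S V w \<and>
      (f \<circ> g) ` U \<subseteq> V \<and> (\<forall>q\<in>U. w ((f \<circ> g) q) = (A ** B) *v z q + c)"
    using z'(1) U(3) by blast
qed

lemma affine_iso_compose_with_derivative:
  assumes f: "affine_with_derivative S f A" and g: "affine_iso S S g B" "det B = 1"
  shows "affine_with_derivative S (g \<circ> f) (B ** A)"
  unfolding affine_with_derivative_def
proof (intro conjI ballI)
  have dg: "homeomorphic_map (space_of S) (space_of S) g" "g ` zeroes S = zeroes S"
    using affine_iso_homeo[OF g(1)] affine_iso_zeroes[OF g(1)] by simp_all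
  show "det (B ** A) = 1"
    using f g by (simp add: det_mul affine_with_derivative_def)
  show "homeomorphic_map (space_of S) (space_of S) (g \<circ> f)"
    using dg f unfolding affine_with_derivative_def by (blast intro: homeomorphic_map_compose)
  show "(g \<circ> f) ` zeroes S = zeroes S"
    using dg f unfolding affine_with_derivative_def by (metis image_comp)
  fix p assume p: "p \<in> topspace (space_of S) - zeroes S"
  then obtain U z V w c where U: "translation_chart S U z" "p \<in> U" "translation_chart S V w"
      "f ` U \<subseteq> V" "\<And>q. q \<in> U \<Longrightarrow> w (f q) = A *v z q + c"
    using affine_with_derivative_chart[OF f p] by blast
  obtain w' where w': "translation_chart S (g ` V) w'" "\<And>q. q \<in> V \<Longrightarrow> w' (g q) = B *v w q"
    using affine_iso_chart_push[OF g(1) U(3)] by blast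
  have "(g \<circ> f) ` U \<subseteq> g ` V"
    using U(4) by auto
  moreover have "w' ((g \<circ> f) q) = (B ** A) *v z q + B *v c" if "q \<in> U" for q
    using that U(4,5) w'(2)[of "f q"]
    by (auto simp: matrix_vector_mul_assoc matrix_vector_right_distrib)
  ultimately show "\<exists>U z V w c. translation_chart S U z \<and> p \<in> U \<and> translation_chart S V w \<and>
      (g \<circ> f) ` U \<subseteq> V \<and> (\<forall>q\<in>U. w ((g \<circ> f) q) = (B ** A) *v z q + c)"
    using U(1,2) w'(1) by blast
qed

text \<open>Commutation of two maps is only known on the points of the surface; elsewhere the
  composites may differ.\<close>

lemma affine_with_derivative_cong:
  assumes f: "affine_with_derivative S f A"
    and fg: "\<And>p. p \<in> topspace (space_of S) \<Longrightarrow> f p = g p"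
  shows "affine_with_derivative S g A"
  unfolding affine_with_derivative_def
proof (intro conjI ballI)
  show "det A = 1"
    using f by (simp add: affine_with_derivative_def)
  show "homeomorphic_map (space_of S) (space_of S) g"
    using f fg unfolding affine_with_derivative_def by (blast intro: homeomorphic_map_eq)
  have "zeroes S \<subseteq> topspace (space_of S)"
    by (auto simp: zeroes_def)
  then have "f ` zeroes S = g ` zeroes S"
    by (intro image_cong) (use fg in auto)
  then show "g ` zeroes S = zeroes S"
    using f by (simp add: affine_with_derivative_def)
  fix p assume p: "p \<in> topspace (space_of S) - zeroes S"
  then obtain U z V w c where U: "translation_chart S U z" "p \<in> U" "translation_chart S V w"
      "f ` U \<subseteq> V" "\<And>q. q \<in> U \<Longrightarrow> w (f q) = A *v z q + c"
    using affine_with_derivative_chart[OF f p] by blast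
  have "U \<subseteq> topspace (space_of S)"
    using U(1) openin_subset by (auto simp: translation_chart_def)
  then have "g ` U \<subseteq> V" "\<And>q. q \<in> U \<Longrightarrow> w (g q) = A *v z q + c"
    using U(4,5) fg by (force simp: subset_iff)+
  with U(1-3) show "\<exists>U z V w c. translation_chart S U z \<and> p \<in> U \<and> translation_chart S V w \<and>
      g ` U \<subseteq> V \<and> (\<forall>q\<in>U. w (g q) = A *v z q + c)"
    by blast
qed

subsection \<open>Uniqueness of the derivative\<close>

lemma affine_maps_agree_on_open:
  fixes A B :: "real^2^2"
  assumes "open X" "x \<in> X" and eq: "\<And>y. y \<in> X \<Longrightarrow> A *v y = B *v y + c"
  shows "A = B"
proof -
  obtain e where e: "e > 0" "ball x e \<subseteq> X"
    using assms openE by blast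
  have "A *v v = B *v v" for v
  proof (cases "v = 0")
    case False
    define d where "d = e / (2 * norm v)"
    have d: "d > 0"
      using e False by (simp add: d_def)
    have "x + d *\<^sub>R v \<in> ball x e"
      using e False by (simp add: d_def dist_norm)
    then have "A *v (x + d *\<^sub>R v) = B *v (x + d *\<^sub>R v) + c"
      using e eq by blast
    moreover have "A *v x = B *v x + c"
      using assms by blast
    ultimately have "d *\<^sub>R (A *v v) = d *\<^sub>R (B *v v)"
      by (simp add: matrix_vector_right_distrib matrix_vector_mult_scaleR)
    then show ?thesis
      using d by simp
  qed simp
  then show ?thesis
    by (simp add: matrix_eq)
qed

text \<open>Two pairs of charts around \<open>p\<close> express \<open>f\<close> with the matrices
  \<open>A\<close> and \<open>B\<close>. Where the charts of each kind differ by a constant, the two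
  linear maps differ by a constant on an open subset of the plane.\<close>

lemma affine_derivative_unique:
  assumes lp: "\<And>U z U' z' c. local_primitive S U z \<Longrightarrow> local_primitive S U' z' \<Longrightarrow>
      openin (space_of S) {q \<in> U \<inter> U'. z q - z' q = c}"
    and p: "p \<in> topspace (space_of S) - zeroes S"
    and A: "affine_with_derivative S f A" and B: "affine_with_derivative S f B"
  shows "A = B"
proof -
  obtain U z V w c where U: "translation_chart S U z" "p \<in> U" "translation_chart S V w"
      "f ` U \<subseteq> V" "\<And>q. q \<in> U \<Longrightarrow> w (f q) = A *v z q + c"
    using affine_with_derivative_chart[OF A p] by blast
  obtain U' z' V' w' c' where U': "translation_chart S U' z'" "p \<in> U'" "translation_chart S V' w'"
      "f ` U' \<subseteq> V'" "\<And>q. q \<in> U' \<Longrightarrow> w' (f q) = B *v z' q + c'"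
    using affine_with_derivative_chart[OF B p] by blast
  define W1 where "W1 = {q \<in> U \<inter> U'. z q - z' q = z p - z' p}"
  define W2 where "W2 = {r \<in> V \<inter> V'. w r - w' r = w (f p) - w' (f p)}"
  \<comment> \<open>The points at which both differences, of the source charts and of the target
    charts after \<open>f\<close>, keep their value at \<open>p\<close>.\<close>
  define W where "W = W1 \<inter> {q \<in> topspace (space_of S). f q \<in> W2}"
  have "openin (space_of S) W1" "openin (space_of S) W2"
    using U U' lp unfolding W1_def W2_def translation_chart_def by blast+
  moreover have "continuous_map (space_of S) (space_of S) f"
    using A homeomorphic_imp_continuous_map unfolding affine_with_derivative_def by blast
  ultimately have oW: "openin (space_of S) W"
    unfolding W_def by (intro openin_Int openin_continuous_map_preimage)
  have pW: "p \<in> W"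
    using p U U' by (auto simp: W_def W1_def W2_def)
  have WU: "W \<subseteq> U"
    by (auto simp: W_def W1_def)
  have "openin (subtopology (space_of S) U) W"
    using oW WU by (metis Int_absorb2 openin_subtopology_Int)
  moreover have "homeomorphic_map (subtopology (space_of S) U) (top_of_set (z ` U)) z"
    using U by (simp add: translation_chart_def)
  ultimately have "openin (top_of_set (z ` U)) (z ` W)"
    using homeomorphic_imp_open_map unfolding open_map_def by blast
  moreover have "open (z ` U)"
    using U by (simp add: translation_chart_def)
  ultimately have "open (z ` W)"
    using openin_open_trans by blast
  moreover have "A *v y = B *v y + (B *v (z' p - z p) + c' - c + (w (f p) - w' (f p)))"
    if "y \<in> z ` W" for y
  proof -
    obtain q where q: "q \<in> W" "y = z q"
      using \<open>y \<in> z ` W\<close> by blast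
    then have "z' q = z q + (z' p - z p)" "w (f q) = w' (f q) + (w (f p) - w' (f p))"
      by (auto simp: W_def W1_def W2_def algebra_simps)
    moreover have "w (f q) = A *v z q + c" "w' (f q) = B *v z' q + c'"
      using q U(5) U'(5) by (auto simp: W_def W1_def)
    ultimately have "A *v z q + c = B *v (z q + (z' p - z p)) + c' + (w (f p) - w' (f p))"
      by metis
    then show ?thesis
      by (simp add: q matrix_vector_right_distrib algebra_simps)
  qed
  ultimately show ?thesis
    using affine_maps_agree_on_open pW by (metis imageI)
qed

section \<open>Surfaces glued from planar pieces\<close>

abbreviation pieces :: "('i \<Rightarrow> (real^2) set) \<Rightarrow> 'i set \<Rightarrow> ('i \<times> (real^2)) topology" where
  "pieces T I \<equiv> sum_topology (\<lambda>i. top_of_set (T i)) I"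

definition glue_rel :: "('i \<Rightarrow> (real^2) set) \<Rightarrow> 'i set \<Rightarrow>
    ('i \<times> (real^2) \<Rightarrow> 'i \<times> (real^2) \<Rightarrow> bool) \<Rightarrow> (('i \<times> (real^2)) \<times> ('i \<times> (real^2))) set" where
  "glue_rel T I G = {(x, y). x \<in> topspace (pieces T I) \<and> y \<in> topspace (pieces T I) \<and> equivclp G x y}"

definition glued :: "('i \<Rightarrow> (real^2) set) \<Rightarrow> 'i set \<Rightarrow>
    ('i \<times> (real^2) \<Rightarrow> 'i \<times> (real^2) \<Rightarrow> bool) \<Rightarrow> ('i \<times> (real^2)) set flat_surface" where
  "glued T I G =
     \<lparr> space_of = quotient_space (pieces T I) (glue_rel T I G),
       local_primitive = (\<lambda>U z.
         openin (quotient_space (pieces T I) (glue_rel T I G)) U \<and>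
         (\<forall>x \<in> topspace (pieces T I). glue_rel T I G `` {x} \<in> U \<longrightarrow>
            (\<exists>N. openin (pieces T I) N \<and> x \<in> N \<and>
              (\<forall>y\<in>N. glue_rel T I G `` {y} \<in> U \<and>
                 z (glue_rel T I G `` {y}) - snd y = z (glue_rel T I G `` {x}) - snd x)))) \<rparr>"

lemma topspace_pieces: "topspace (pieces T I) = Sigma I T"
  by (auto simp: o_def)

lemma equiv_glue_rel: "equiv (Sigma I T) (glue_rel T I G)"
  unfolding equiv_def refl_on_def sym_def trans_def glue_rel_def topspace_pieces
  by (auto intro: equivclp_sym equivclp_trans)

lemma topspace_quotient_space: "topspace (quotient_space T R) = topspace T // R"
proof -
  have "openin (quotient_space T R) (topspace T // R)"
    unfolding openin_quotient_space
    by (auto simp: quotient_def intro: back_subst[of "openin T", OF openin_topspace])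
  then show ?thesis
    by (metis openin_quotient_space openin_subset openin_topspace subset_antisym)
qed

lemma space_of_glued: "space_of (glued T I G) = quotient_space (pieces T I) (glue_rel T I G)"
  by (simp add: glued_def)

lemma topspace_glued: "topspace (space_of (glued T I G)) = Sigma I T // glue_rel T I G"
  by (simp only: space_of_glued topspace_quotient_space topspace_pieces)

lemma openin_glued:
  "openin (space_of (glued T I G)) U \<longleftrightarrow> U \<subseteq> Sigma I T // glue_rel T I G \<and>
     openin (pieces T I) {x \<in> Sigma I T. glue_rel T I G `` {x} \<in> U}"
  by (simp only: space_of_glued openin_quotient_space topspace_pieces)

lemma local_primitive_glued:
  "local_primitive (glued T I G) U z \<longleftrightarrow> openin (space_of (glued T I G)) U \<and>
     (\<forall>x \<in> Sigma I T. glue_rel T I G `` {x} \<in> U \<longrightarrow>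
        (\<exists>N. openin (pieces T I) N \<and> x \<in> N \<and>
          (\<forall>y\<in>N. glue_rel T I G `` {y} \<in> U \<and>
             z (glue_rel T I G `` {y}) - snd y = z (glue_rel T I G `` {x}) - snd x)))"
  unfolding space_of_glued by (simp add: glued_def topspace_pieces o_def)

lemma local_primitive_glued_nbhd:
  assumes "local_primitive (glued T I G) U z" "x \<in> Sigma I T" "glue_rel T I G `` {x} \<in> U"
  obtains N where "openin (pieces T I) N" "x \<in> N"
    "\<And>y. y \<in> N \<Longrightarrow> glue_rel T I G `` {y} \<in> U \<and>
       z (glue_rel T I G `` {y}) - snd y = z (glue_rel T I G `` {x}) - snd x"
proof -
  have "\<exists>N. openin (pieces T I) N \<and> x \<in> N \<and>
          (\<forall>y\<in>N. glue_rel T I G `` {y} \<in> U \<and>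
             z (glue_rel T I G `` {y}) - snd y = z (glue_rel T I G `` {x}) - snd x)"
    using assms by (simp only: local_primitive_glued)
  then show thesis
    using that by auto
qed

text \<open>In each piece both functions differ from the planar coordinate by locally constant
  functions, and the coordinate cancels in the difference.\<close>

lemma primitive_difference_locally_constant:
  assumes z: "local_primitive (glued T I G) U z" and w: "local_primitive (glued T I G) V w"
  shows "openin (space_of (glued T I G)) {q \<in> U \<inter> V. z q - w q = c}"
proof -
  let ?R = "glue_rel T I G" and ?W = "{q \<in> U \<inter> V. z q - w q = c}"
  let ?P = "{x \<in> Sigma I T. ?R `` {x} \<in> ?W}"
  have "U \<subseteq> Sigma I T // ?R"
    using z openin_glued local_primitive_glued by blast
  then have "?W \<subseteq> Sigma I T // ?R"
    by blast
  moreover have "openin (pieces T I) ?P"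
  proof (subst openin_subopen, intro ballI)
    fix x assume x: "x \<in> ?P"
    obtain N where N: "openin (pieces T I) N" "x \<in> N"
      "\<And>y. y \<in> N \<Longrightarrow> ?R `` {y} \<in> U \<and> z (?R `` {y}) - snd y = z (?R `` {x}) - snd x"
      using local_primitive_glued_nbhd[OF z, of x] x by blast
    obtain M where M: "openin (pieces T I) M" "x \<in> M"
      "\<And>y. y \<in> M \<Longrightarrow> ?R `` {y} \<in> V \<and> w (?R `` {y}) - snd y = w (?R `` {x}) - snd x"
      using local_primitive_glued_nbhd[OF w, of x] x by blast
    have "N \<inter> M \<subseteq> ?P"
    proof
      fix y assume y: "y \<in> N \<inter> M"
      then have "y \<in> Sigma I T"
        using openin_subset[OF N(1)] topspace_pieces[of T I] by blast
      moreover have "z (?R `` {y}) - w (?R `` {y}) = z (?R `` {x}) - w (?R `` {x})"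
      proof -
        have "z (?R `` {y}) - w (?R `` {y}) = (z (?R `` {y}) - snd y) - (w (?R `` {y}) - snd y)"
          by simp
        also have "\<dots> = z (?R `` {x}) - w (?R `` {x})"
          using y N(3)[of y] M(3)[of y] by simp
        finally show ?thesis .
      qed
      ultimately show "y \<in> ?P"
        using y x N(3)[of y] M(3)[of y] by auto
    qed
    then show "\<exists>X. openin (pieces T I) X \<and> x \<in> X \<and> X \<subseteq> ?P"
      using N M by (intro exI[of _ "N \<inter> M"]) (auto intro: openin_Int)
  qed
  ultimately show ?thesis
    unfolding openin_glued by blast
qed

text \<open>
  One comparison principle serves for cutting a piece into two, for rotating and relabelling pieces,
  and for applying a matrix: the induced map of the quotients is an affine isomorphism.
\<close>

locale refinement =
  fixes T :: "'i \<Rightarrow> (real^2) set" and I :: "'i set" and G :: "'i \<times> (real^2) \<Rightarrow> 'i \<times> (real^2) \<Rightarrow> bool"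
    and T' :: "'j \<Rightarrow> (real^2) set" and I' :: "'j set" and G' :: "'j \<times> (real^2) \<Rightarrow> 'j \<times> (real^2) \<Rightarrow> bool"
    and A :: "real^2^2" and p :: "'j \<Rightarrow> 'i" and t :: "'j \<Rightarrow> real^2"
  assumes fin: "finite I'" and cpt: "\<And>j. j \<in> I' \<Longrightarrow> compact (T' j)" and inv: "invertible A"
    and index: "p ` I' \<subseteq> I"
    and cover: "\<And>i. i \<in> I \<Longrightarrow> T i = (\<Union>j \<in> {j \<in> I'. p j = i}. (\<lambda>v. A *v v + t j) ` T' j)"
    and glue_down: "\<And>j v k w. G' (j, v) (k, w) \<Longrightarrow>
        equivclp G (p j, A *v v + t j) (p k, A *v w + t k)"
    and glue_up: "\<And>x y. G x y \<Longrightarrow> \<exists>j v k w. j \<in> I' \<and> v \<in> T' j \<and> k \<in> I' \<and> w \<in> T' k \<and>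
        x = (p j, A *v v + t j) \<and> y = (p k, A *v w + t k) \<and> equivclp G' (j, v) (k, w)"
    and overlap: "\<And>j v k w. j \<in> I' \<Longrightarrow> v \<in> T' j \<Longrightarrow> k \<in> I' \<Longrightarrow> w \<in> T' k \<Longrightarrow> p j = p k \<Longrightarrow>
        A *v v + t j = A *v w + t k \<Longrightarrow> equivclp G' (j, v) (k, w)"
begin

definition \<pi> :: "'j \<times> (real^2) \<Rightarrow> 'i \<times> (real^2)" where
  "\<pi> x = (p (fst x), A *v snd x + t (fst x))"

abbreviation "K \<equiv> Sigma I T"
abbreviation "K' \<equiv> Sigma I' T'"
abbreviation "R \<equiv> glue_rel T I G"
abbreviation "R' \<equiv> glue_rel T' I' G'"

text \<open>Saturating the image of a whole class avoids the choice of a representative.\<close>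

definition F :: "('j \<times> (real^2)) set \<Rightarrow> ('i \<times> (real^2)) set" where
  "F c = R `` (\<pi> ` c)"

lemma \<pi>_image: "\<pi> ` K' = K"
proof
  show "\<pi> ` K' \<subseteq> K"
    using index cover by (fastforce simp: \<pi>_def)
  show "K \<subseteq> \<pi> ` K'"
  proof
    fix x assume "x \<in> K"
    then obtain j v where "j \<in> I'" "p j = fst x" "v \<in> T' j" "snd x = A *v v + t j"
      using cover[of "fst x"] by auto
    then show "x \<in> \<pi> ` K'"
      by (intro image_eqI[of _ _ "(j, v)"]) (auto simp: \<pi>_def prod_eq_iff)
  qed
qed

lemma \<pi>_in: "x \<in> K' \<Longrightarrow> \<pi> x \<in> K"
  using \<pi>_image by blast

lemma equivclp_down: "equivclp G' x y \<Longrightarrow> equivclp G (\<pi> x) (\<pi> y)"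
proof (induction rule: equivclp_induct)
  case (step y z)
  have "equivclp G (\<pi> y) (\<pi> z)"
    using step(2) glue_down[of "fst y" "snd y" "fst z" "snd z"] glue_down[of "fst z" "snd z" "fst y" "snd y"]
    by (auto simp: \<pi>_def intro: equivclp_sym)
  then show ?case
    using step equivclp_trans by metis
qed simp

text \<open>Each step of a chain for \<open>G\<close> lifts, but consecutive lifts may meet the
  shared point at different preimages; \<open>overlap\<close> joins these.\<close>

lemma equivclp_up:
  assumes "equivclp G a b" "a \<in> K"
  shows "\<forall>x\<in>K'. \<forall>y\<in>K'. \<pi> x = a \<longrightarrow> \<pi> y = b \<longrightarrow> equivclp G' x y"
  using assms
proof (induction rule: equivclp_induct)
  case base
  then show ?case
    using overlap by (fastforce simp: \<pi>_def)
next
  case (step b c)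
  have "\<exists>x\<in>K'. \<exists>y\<in>K'. b = \<pi> x \<and> c = \<pi> y \<and> equivclp G' x y"
    using step(2)
  proof
    assume "G b c"
    from glue_up[OF this] show ?thesis
      by (fastforce simp: \<pi>_def)
  next
    assume "G c b"
    from glue_up[OF this] show ?thesis
      by (fastforce simp: \<pi>_def intro: equivclp_sym)
  qed
  then obtain x' y' where xy: "x' \<in> K'" "y' \<in> K'" "b = \<pi> x'" "c = \<pi> y'" "equivclp G' x' y'"
    by blast
  show ?case
  proof (intro ballI impI)
    fix x y assume *: "x \<in> K'" "y \<in> K'" "\<pi> x = a" "\<pi> y = c"
    have "equivclp G' x x'"
      using step.IH step.prems * xy by blast
    moreover have "equivclp G' y' y"
      using overlap * xy by (fastforce simp: \<pi>_def)
    ultimately show "equivclp G' x y"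
      using xy(5) equivclp_trans by metis
  qed
qed

lemma R'_iff: "x \<in> K' \<Longrightarrow> y \<in> K' \<Longrightarrow> (x, y) \<in> R' \<longleftrightarrow> (\<pi> x, \<pi> y) \<in> R"
  using equivclp_down equivclp_up \<pi>_in unfolding glue_rel_def topspace_pieces by blast

lemma class_eq_iff: "x \<in> K \<Longrightarrow> y \<in> K \<Longrightarrow> R `` {x} = R `` {y} \<longleftrightarrow> (x, y) \<in> R"
  using equiv_glue_rel by (rule eq_equiv_class_iff)

lemma class'_eq_iff: "x \<in> K' \<Longrightarrow> y \<in> K' \<Longrightarrow> R' `` {x} = R' `` {y} \<longleftrightarrow> (x, y) \<in> R'"
  using equiv_glue_rel by (rule eq_equiv_class_iff)

lemma F_class: assumes x: "x \<in> K'" shows "F (R' `` {x}) = R `` {\<pi> x}"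
proof -
  have "R `` {\<pi> y} = R `` {\<pi> x}" if "y \<in> R' `` {x}" for y
  proof -
    have "(x, y) \<in> R'" "y \<in> K'"
      using that by (auto simp: glue_rel_def)
    then show ?thesis
      using x class_eq_iff R'_iff \<pi>_in by metis
  qed
  moreover have "x \<in> R' `` {x}"
    using x equiv_glue_rel equiv_class_self by metis
  ultimately show ?thesis
    unfolding F_def by blast
qed

lemma F_inj: "inj_on F (K' // R')"
proof (rule inj_onI)
  fix c d assume "c \<in> K' // R'" "d \<in> K' // R'" and eq: "F c = F d"
  then obtain x y where xy: "x \<in> K'" "c = R' `` {x}" "y \<in> K'" "d = R' `` {y}"
    by (auto elim!: quotientE)
  then show "c = d"
    using eq F_class class_eq_iff class'_eq_iff R'_iff \<pi>_in by metis
qed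

lemma F_image: "F ` (K' // R') = K // R"
proof -
  have "F ` (K' // R') = (\<lambda>x. R `` {\<pi> x}) ` K'"
    using F_class by (auto simp: quotient_def image_iff)
  also have "\<dots> = (\<lambda>x. R `` {x}) ` K"
    by (simp flip: \<pi>_image add: image_image)
  finally show ?thesis
    by (auto simp: quotient_def)
qed

lemma mem_F_image:
  assumes "U \<subseteq> K' // R'" "x \<in> K'"
  shows "R `` {\<pi> x} \<in> F ` U \<longleftrightarrow> R' `` {x} \<in> U"
proof -
  have "R' `` {x} \<in> K' // R'"
    using assms quotientI by metis
  then show ?thesis
    using inj_on_image_mem_iff[OF F_inj _ assms(1)] F_class[OF assms(2)] by metis
qed

lemma \<pi>_preimage_open:
  assumes "openin (pieces T I) N"
  shows "openin (pieces T' I') {x \<in> K'. \<pi> x \<in> N}"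
  unfolding openin_sum_topology
proof (intro conjI ballI)
  show "{x \<in> K'. \<pi> x \<in> N} \<subseteq> Sigma I' (topspace \<circ> (\<lambda>i. top_of_set (T' i)))"
    by (auto simp: o_def)
  fix j assume j: "j \<in> I'"
  then have pj: "p j \<in> I" "(\<lambda>v. A *v v + t j) ` T' j \<subseteq> T (p j)"
    using index cover[of "p j"] by auto
  have "openin (top_of_set (T (p j))) {v. (p j, v) \<in> N}"
    using assms pj(1) by (simp add: openin_sum_topology)
  moreover have "continuous_on (T' j) (\<lambda>v. A *v v + t j)"
    by (intro continuous_intros matrix_vector_mult_linear_continuous_on)
  ultimately have "openin (top_of_set (T' j)) (T' j \<inter> (\<lambda>v. A *v v + t j) -` {v. (p j, v) \<in> N})"
    using pj(2) by (intro continuous_openin_preimage) auto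
  then show "openin (top_of_set (T' j)) {v. (j, v) \<in> {x \<in> K'. \<pi> x \<in> N}}"
    by (rule back_subst[of "openin (top_of_set (T' j))"]) (use j in \<open>auto simp: \<pi>_def\<close>)
qed

text \<open>Finitely many compact pieces make \<open>\<pi>\<close> a closed map. It need not be
  open: if a piece is cut, a relatively open half-disc at the cut has an image that is not
  open.\<close>

lemma \<pi>_image_closed:
  assumes "closedin (pieces T' I') C"
  shows "closedin (pieces T I) (\<pi> ` C)"
  unfolding closedin_sum_topology
proof (intro conjI ballI)
  have CK: "C \<subseteq> K'"
    using closedin_subset[OF assms] by (auto simp: o_def)
  then have "\<pi> ` C \<subseteq> K"
    using \<pi>_in by blast
  then show "\<pi> ` C \<subseteq> Sigma I (topspace \<circ> (\<lambda>i. top_of_set (T i)))"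
    by (simp add: o_def)
  fix i assume i: "i \<in> I"
  have eq: "{v. (i, v) \<in> \<pi> ` C} = (\<Union>j \<in> {j \<in> I'. p j = i}. (\<lambda>v. A *v v + t j) ` {v. (j, v) \<in> C})"
    using CK by (force simp: \<pi>_def image_iff)
  have "compact ((\<lambda>v. A *v v + t j) ` {v. (j, v) \<in> C})" if "j \<in> I'" for j
  proof (rule compact_continuous_image)
    show "continuous_on {v. (j, v) \<in> C} (\<lambda>v. A *v v + t j)"
      by (intro continuous_intros matrix_vector_mult_linear_continuous_on)
    have "closedin (top_of_set (T' j)) {v. (j, v) \<in> C}"
      using assms that by (simp add: closedin_sum_topology)
    then show "compact {v. (j, v) \<in> C}"
      using cpt[OF that] closedin_compact by blast
  qed
  then have "compact {v. (i, v) \<in> \<pi> ` C}"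
    unfolding eq using fin by (intro compact_UN) auto
  moreover have "{v. (i, v) \<in> \<pi> ` C} \<subseteq> T i"
    using CK \<pi>_in by fastforce
  ultimately show "closedin (top_of_set (T i)) {v. (i, v) \<in> \<pi> ` C}"
    by (simp add: closed_subset compact_imp_closed)
qed

text \<open>The complement of this set is the image of the closed complement of
  \<open>N\<close>.\<close>

lemma open_of_preimage:
  assumes N: "N \<subseteq> K'" "openin (pieces T' I') N"
  shows "openin (pieces T I) {y \<in> K. \<forall>x\<in>K'. \<pi> x = y \<longrightarrow> x \<in> N}"
proof -
  have "closedin (pieces T' I') (K' - N)"
    using N topspace_pieces[of T' I'] by (metis closedin_diff closedin_topspace)
  from \<pi>_image_closed[OF this] have "openin (pieces T I) (K - \<pi> ` (K' - N))"
    using topspace_pieces[of T I] by (metis openin_diff openin_topspace)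
  then show ?thesis
    by (rule back_subst[of "openin (pieces T I)"]) blast
qed

lemma openin_image_iff:
  assumes U: "U \<subseteq> K' // R'"
  shows "openin (space_of (glued T I G)) (F ` U) \<longleftrightarrow> openin (space_of (glued T' I' G')) U"
proof -
  let ?N = "{x \<in> K. R `` {x} \<in> F ` U}" and ?N' = "{x \<in> K'. R' `` {x} \<in> U}"
  have N': "?N' = {x \<in> K'. \<pi> x \<in> ?N}"
    using mem_F_image[OF U] \<pi>_in by blast
  have N: "?N = {y \<in> K. \<forall>x\<in>K'. \<pi> x = y \<longrightarrow> x \<in> ?N'}"
  proof (intro set_eqI)
    fix y
    show "y \<in> ?N \<longleftrightarrow> y \<in> {y \<in> K. \<forall>x\<in>K'. \<pi> x = y \<longrightarrow> x \<in> ?N'}"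
    proof (cases "y \<in> K")
      case True
      then obtain x where x: "x \<in> K'" "\<pi> x = y"
        using \<pi>_image by (metis (no_types, lifting) imageE)
      have *: "R' `` {x'} \<in> U \<longleftrightarrow> R `` {y} \<in> F ` U" if "x' \<in> K'" "\<pi> x' = y" for x'
        using mem_F_image[OF U that(1)] that(2) by simp
      show ?thesis
        using x * True by blast
    qed simp
  qed
  have "openin (pieces T I) ?N \<longleftrightarrow> openin (pieces T' I') ?N'"
    using \<pi>_preimage_open[of ?N] open_of_preimage[of ?N'] N N' by fastforce
  moreover have "F ` U \<subseteq> K // R"
    using U F_image by blast
  ultimately show ?thesis
    using U by (simp add: openin_glued)
qed

lemma primitive_iff:
  assumes U: "U \<subseteq> K' // R'" and w: "\<And>c. c \<in> U \<Longrightarrow> w (F c) = A *v z c"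
  shows "local_primitive (glued T I G) (F ` U) w \<longleftrightarrow> local_primitive (glued T' I' G') U z"
proof -
  have wz: "w (R `` {\<pi> x}) - snd (\<pi> x) = A *v (z (R' `` {x}) - snd x) - t (fst x)"
    if "x \<in> K'" "R' `` {x} \<in> U" for x
    using w[OF that(2)] F_class[OF that(1)]
    by (simp add: \<pi>_def matrix_vector_mult_diff_distrib algebra_simps)
  have injA: "A *v a = A *v b \<longleftrightarrow> a = b" for a b :: "real^2"
    using inv by (metis inj_matrix_vector_mult injD)
  show ?thesis
  proof
    assume L: "local_primitive (glued T I G) (F ` U) w"
    show "local_primitive (glued T' I' G') U z"
      unfolding local_primitive_glued
    proof (intro conjI ballI impI)
      show "openin (space_of (glued T' I' G')) U"
        using L openin_image_iff[OF U] local_primitive_glued by blast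
      fix x assume x: "x \<in> K'" "R' `` {x} \<in> U"
      then have FU: "R `` {\<pi> x} \<in> F ` U" and xK: "\<pi> x \<in> K"
        using mem_F_image[OF U x(1)] \<pi>_in[OF x(1)] by simp_all
      then obtain N where N: "openin (pieces T I) N" "\<pi> x \<in> N"
        "\<And>y. y \<in> N \<Longrightarrow> R `` {y} \<in> F ` U \<and> w (R `` {y}) - snd y = w (R `` {\<pi> x}) - snd (\<pi> x)"
        using local_primitive_glued_nbhd[OF L xK FU] by metis
      \<comment> \<open>The shift \<open>t\<close> depends on the piece, so the neighbourhood is
        confined to the piece of \<open>x\<close>, where the shifts cancel.\<close>
      define N' where "N' = {y \<in> K'. \<pi> y \<in> N} \<inter> Sigma I' (\<lambda>j. if j = fst x then T' j else {})"
      have "openin (pieces T' I') N'"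
        unfolding N'_def
        by (intro openin_Int \<pi>_preimage_open N) (auto simp: openin_disjoint_union)
      moreover have "x \<in> N'"
        using x N by (auto simp: N'_def)
      moreover have "R' `` {y} \<in> U \<and> z (R' `` {y}) - snd y = z (R' `` {x}) - snd x" if "y \<in> N'" for y
      proof -
        have y: "y \<in> K'" "\<pi> y \<in> N" "fst y = fst x"
          using that by (auto simp: N'_def split: if_splits)
        then have yU: "R' `` {y} \<in> U"
          using N(3) mem_F_image[OF U] by blast
        then show ?thesis
          using N(3)[OF y(2)] wz[OF y(1)] wz[OF x] y(3) injA by auto
      qed
      ultimately show "\<exists>N. openin (pieces T' I') N \<and> x \<in> N \<and>
          (\<forall>y\<in>N. R' `` {y} \<in> U \<and> z (R' `` {y}) - snd y = z (R' `` {x}) - snd x)"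
        by blast
    qed
  next
    assume L: "local_primitive (glued T' I' G') U z"
    show "local_primitive (glued T I G) (F ` U) w"
      unfolding local_primitive_glued
    proof (intro conjI ballI impI)
      show "openin (space_of (glued T I G)) (F ` U)"
        using L openin_image_iff[OF U] local_primitive_glued by blast
      fix x assume x: "x \<in> K" "R `` {x} \<in> F ` U"
      have "\<forall>x'. \<exists>N. x' \<in> K' \<longrightarrow> \<pi> x' = x \<longrightarrow> openin (pieces T' I') N \<and> x' \<in> N \<and>
          (\<forall>y\<in>N. R' `` {y} \<in> U \<and> z (R' `` {y}) - snd y = z (R' `` {x'}) - snd x')"
      proof
        fix x'
        show "\<exists>N. x' \<in> K' \<longrightarrow> \<pi> x' = x \<longrightarrow> openin (pieces T' I') N \<and> x' \<in> N \<and>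
          (\<forall>y\<in>N. R' `` {y} \<in> U \<and> z (R' `` {y}) - snd y = z (R' `` {x'}) - snd x')"
        proof (cases "x' \<in> K' \<and> \<pi> x' = x")
          case True
          then have "R' `` {x'} \<in> U"
            using x mem_F_image[OF U] by blast
          then show ?thesis
            using local_primitive_glued_nbhd[OF L, of x'] True by metis
        qed blast
      qed
      then obtain \<N> where \<N>: "\<And>x'. x' \<in> K' \<Longrightarrow> \<pi> x' = x \<Longrightarrow> openin (pieces T' I') (\<N> x') \<and> x' \<in> \<N> x' \<and>
          (\<forall>y\<in>\<N> x'. R' `` {y} \<in> U \<and> z (R' `` {y}) - snd y = z (R' `` {x'}) - snd x')"
        by metis
      \<comment> \<open>A point on a cut has several preimages. The union of their neighbourhoods,
        each kept within its own piece, contains all preimages of the points near \<open>x\<close>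
        because \<open>\<pi>\<close> is closed.\<close>
      define M where "M = (\<Union>x' \<in> {x' \<in> K'. \<pi> x' = x}.
          \<N> x' \<inter> Sigma I' (\<lambda>j. if j = fst x' then T' j else {}))"
      have oM: "openin (pieces T' I') M"
        unfolding M_def
        by (intro openin_Union ballI) (use \<N> in \<open>auto simp: openin_disjoint_union intro!: openin_Int\<close>)
      have MK: "M \<subseteq> K'"
        by (auto simp: M_def split: if_splits)
      let ?N = "{y \<in> K. \<forall>x\<in>K'. \<pi> x = y \<longrightarrow> x \<in> M}"
      have "openin (pieces T I) ?N"
        by (rule open_of_preimage[OF MK oM])
      moreover have "x \<in> ?N"
        using x(1) \<N> by (auto simp: M_def)
      moreover have "R `` {y} \<in> F ` U \<and> w (R `` {y}) - snd y = w (R `` {x}) - snd x" if y: "y \<in> ?N" for y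
      proof -
        obtain y' where y': "y' \<in> K'" "\<pi> y' = y"
          using y \<pi>_image by (metis (no_types, lifting) imageE mem_Collect_eq)
        then have "y' \<in> M"
          using y by blast
        then obtain x' where x': "x' \<in> K'" "\<pi> x' = x" "y' \<in> \<N> x'" "fst y' = fst x'"
          by (auto simp: M_def split: if_splits)
        then have "R' `` {y'} \<in> U" "z (R' `` {y'}) - snd y' = z (R' `` {x'}) - snd x'"
          "R' `` {x'} \<in> U"
          using \<N>[of x'] by blast+
        then show ?thesis
          using wz[of y'] wz[of x'] y' x' mem_F_image[OF U, of y'] by auto
      qed
      ultimately show "\<exists>N. openin (pieces T I) N \<and> x \<in> N \<and>
          (\<forall>y\<in>N. R `` {y} \<in> F ` U \<and> w (R `` {y}) - snd y = w (R `` {x}) - snd x)"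
        by blast
    qed
  qed
qed

theorem affine_iso_F: "affine_iso (glued T' I' G') (glued T I G) F A"
  unfolding affine_iso_def
proof (intro conjI allI impI inv)
  let ?X' = "space_of (glued T' I' G')" and ?X = "space_of (glued T I G)"
  show "homeomorphic_map ?X' ?X F"
  proof (rule bijective_open_imp_homeomorphic_map)
    show "open_map ?X' ?X F"
      unfolding open_map_def
    proof (intro allI impI)
      fix U assume U: "openin ?X' U"
      then have "U \<subseteq> K' // R'"
        by (simp only: openin_glued)
      then show "openin ?X (F ` U)"
        using openin_image_iff U by blast
    qed
    show "continuous_map ?X' ?X F"
      unfolding continuous_map_def
    proof (intro conjI allI impI)
      show "F \<in> topspace ?X' \<rightarrow> topspace ?X"
        using F_image unfolding topspace_glued by blast
      fix V assume V: "openin ?X V"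
      let ?U = "{x \<in> topspace ?X'. F x \<in> V}"
      have "V \<subseteq> F ` topspace ?X'"
        using openin_subset[OF V] unfolding topspace_glued F_image .
      then have "F ` ?U = V"
        by blast
      moreover have "?U \<subseteq> K' // R'"
        unfolding topspace_glued by blast
      ultimately show "openin ?X' ?U"
        using openin_image_iff[of ?U] V by metis
    qed
    show "F ` topspace ?X' = topspace ?X"
      unfolding topspace_glued by (rule F_image)
    show "inj_on F (topspace ?X')"
      unfolding topspace_glued by (rule F_inj)
  qed
next
  fix U z w
  assume "U \<subseteq> topspace (space_of (glued T' I' G'))" "\<forall>c\<in>U. w (F c) = A *v z c"
  then show "local_primitive (glued T I G) (F ` U) w \<longleftrightarrow> local_primitive (glued T' I' G') U z"
    by (intro primitive_iff) (simp_all only: topspace_glued)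
qed

end

section \<open>A regular point in the interior of a piece\<close>

text \<open>No gluing touches \<open>W\<close>, so the classes of its points are singletons and the
  planar coordinate is a chart there.\<close>

lemma singular_free_point:
  assumes i: "i \<in> I" and W: "open W" "W \<subseteq> T i" "v \<in> W"
    and free: "\<And>w y. w \<in> W \<Longrightarrow> \<not> G (i, w) y \<and> \<not> G y (i, w)"
  shows "glue_rel T I G `` {(i, v)} \<in> topspace (space_of (glued T I G)) - zeroes (glued T I G)"
proof -
  let ?R = "glue_rel T I G" and ?S = "glued T I G"
  have "y = (i, w)" if "equivclp G (i, w) y" "w \<in> W" for w y
    using that by (induction rule: equivclp_induct) (use free in blast)+
  then have cls: "?R `` {(i, w)} = {(i, w)}" if "w \<in> W" for w
    using that i W(2) by (auto simp: glue_rel_def)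
  let ?c = "\<lambda>w. {(i, w)}" and ?z = "\<lambda>c. snd (the_elem c) :: real^2"
  define U where "U = ?c ` W"
  have pre: "{x \<in> Sigma I T. ?R `` {x} \<in> ?c ` V} = Sigma I (\<lambda>j. if j = i then V else {})"
    if "V \<subseteq> W" for V
  proof -
    have "x \<in> Sigma I (\<lambda>j. if j = i then V else {})" if x: "x \<in> Sigma I T" "?R `` {x} \<in> ?c ` V" for x
    proof -
      obtain w where w: "w \<in> V" "?R `` {x} = {(i, w)}"
        using x(2) by blast
      have "x \<in> ?R `` {x}"
        by (rule equiv_class_self[OF equiv_glue_rel x(1)])
      then show ?thesis
        using w i by simp
    qed
    moreover have "(i, w) \<in> Sigma I T \<and> ?R `` {(i, w)} \<in> ?c ` V" if "w \<in> V" for w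
      using that \<open>V \<subseteq> W\<close> cls[of w] i W(2) by auto
    ultimately show ?thesis
      by (auto split: if_splits)
  qed
  have open_img: "openin (space_of ?S) (?c ` V)" if "V \<subseteq> W" "open V" for V
    unfolding openin_glued pre[OF that(1)]
  proof
    show "?c ` V \<subseteq> Sigma I T // ?R"
    proof
      fix c assume "c \<in> ?c ` V"
      then obtain w where "w \<in> V" "c = {(i, w)}"
        by blast
      then have "c = ?R `` {(i, w)}" "(i, w) \<in> Sigma I T"
        using cls that(1) i W(2) by auto
      then show "c \<in> Sigma I T // ?R"
        by (auto intro: quotientI)
    qed
    have "V \<subseteq> T i"
      using that W(2) by blast
    then show "openin (pieces T I) (Sigma I (\<lambda>j. if j = i then V else {}))"
      using that by (auto simp: openin_disjoint_union intro: open_subset)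
  qed
  have oU: "openin (space_of ?S) U"
    unfolding U_def using W(1) by (intro open_img) auto
  have zU: "?z ` U = W"
    by (force simp: U_def image_iff)
  have top: "topspace (subtopology (space_of ?S) U) = U"
    using openin_subset[OF oU] by auto
  have "homeomorphic_map (subtopology (space_of ?S) U) (top_of_set W) ?z"
  proof (rule bijective_open_imp_homeomorphic_map)
    show "?z ` topspace (subtopology (space_of ?S) U) = topspace (top_of_set W)"
      using zU top by simp
    show "inj_on ?z (topspace (subtopology (space_of ?S) U))"
      unfolding top by (auto simp: U_def inj_on_def)
    show "continuous_map (subtopology (space_of ?S) U) (top_of_set W) ?z"
      unfolding continuous_map_def top
    proof (intro conjI allI impI)
      show "?z \<in> U \<rightarrow> topspace (top_of_set W)"
        by (auto simp: U_def)
      fix V assume V: "openin (top_of_set W) V"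
      then have "open V" "V \<subseteq> W"
        using W(1) openin_open_eq by blast+
      then have "openin (space_of ?S) (?c ` V)"
        by (intro open_img)
      moreover have "{x \<in> U. ?z x \<in> V} = U \<inter> ?c ` V"
        by (auto simp: U_def)
      ultimately show "openin (subtopology (space_of ?S) U) {x \<in> U. ?z x \<in> V}"
        by (simp add: openin_subtopology_Int2)
    qed
    show "open_map (subtopology (space_of ?S) U) (top_of_set W) ?z"
      unfolding open_map_def
    proof (intro allI impI)
      fix Q assume "openin (subtopology (space_of ?S) U) Q"
      then have Q: "openin (space_of ?S) Q" "Q \<subseteq> U"
        using oU openin_open_subtopology by blast+
      have Qc: "Q = ?c ` (?z ` Q)" and zQ: "?z ` Q \<subseteq> W"
        using Q(2) by (force simp: U_def image_iff)+
      have "openin (pieces T I) {x \<in> Sigma I T. ?R `` {x} \<in> ?c ` (?z ` Q)}"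
        using Q(1) Qc unfolding openin_glued by metis
      then have "openin (pieces T I) (Sigma I (\<lambda>j. if j = i then ?z ` Q else {}))"
        unfolding pre[OF zQ] .
      then have "openin (top_of_set (T i)) (?z ` Q)"
        using i by (auto simp: openin_disjoint_union dest!: bspec[of I _ i])
      then show "openin (top_of_set W) (?z ` Q)"
        using zQ W(2) openin_subset_trans by blast
    qed
  qed
  moreover have "local_primitive ?S U ?z"
    unfolding local_primitive_glued
  proof (intro conjI ballI impI oU)
    fix x assume x: "x \<in> Sigma I T" "?R `` {x} \<in> U"
    then have "x \<in> Sigma I (\<lambda>j. if j = i then W else {})"
      using pre[of W] unfolding U_def by blast
    moreover have "openin (pieces T I) (Sigma I (\<lambda>j. if j = i then W else {}))"
      using W by (auto simp: openin_disjoint_union intro: open_subset)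
    ultimately show "\<exists>N. openin (pieces T I) N \<and> x \<in> N \<and> (\<forall>y\<in>N. ?R `` {y} \<in> U \<and>
        ?z (?R `` {y}) - snd y = ?z (?R `` {x}) - snd x)"
      using cls by (intro exI[of _ "Sigma I (\<lambda>j. if j = i then W else {})"])
        (auto simp: U_def split: if_splits)
  qed
  ultimately have "translation_chart ?S U ?z"
    using oU zU W(1) by (simp add: translation_chart_def)
  moreover have "?R `` {(i, v)} \<in> U"
    using cls W(3) by (auto simp: U_def)
  ultimately show ?thesis
    using openin_subset[OF oU] by (auto simp: zeroes_def)
qed

section \<open>Convex polygons\<close>

definition cross :: "real^2 \<Rightarrow> real^2 \<Rightarrow> real" where
  "cross u v = u$1 * v$2 - u$2 * v$1"

lemma cross_simps:
  "cross (u + v) w = cross u w + cross v w" "cross u (v + w) = cross u v + cross u w"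
  "cross (u - v) w = cross u w - cross v w" "cross u (v - w) = cross u v - cross u w"
  "cross (c *\<^sub>R u) v = c * cross u v" "cross u (c *\<^sub>R v) = c * cross u v"
  "cross 0 v = 0" "cross u 0 = 0" "cross u u = 0"
  by (simp_all add: cross_def algebra_simps)

lemma cross_swap: "cross u v = - cross v u"
  by (simp add: cross_def)

text \<open>Cramer's rule: the signed areas of the pairs are the coefficients of a linear dependence
  between three plane vectors.\<close>

lemma cross_cyclic: "cross v w *\<^sub>R u + cross w u *\<^sub>R v + cross u v *\<^sub>R w = 0"
  by (simp add: vec_eq_iff forall_2 cross_def algebra_simps)

text \<open>The open half-plane \<open>l > 0\<close> together with the segment is convex and
  contains all generators, hence the hull.\<close>

lemma hull_meets_line_in_segment:
  fixes a b :: "real^2" and l :: "real^2 \<Rightarrow> real"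
  assumes "linear l" "l a = 0" "l b = 0" "\<And>s. s \<in> S \<Longrightarrow> l s > 0"
    and x: "x \<in> convex hull (insert a (insert b S))" "l x = 0"
  shows "x \<in> closed_segment a b"
proof -
  interpret linear l by fact
  define Z where "Z = {x. l x > 0} \<union> closed_segment a b"
  have seg0: "l y = 0" if "y \<in> closed_segment a b" for y
    using that assms(2,3) by (auto simp: in_segment add scale)
  have "convex Z"
  proof (rule convexI)
    fix y z u v assume yz: "y \<in> Z" "z \<in> Z" and uv: "0 \<le> u" "0 \<le> v" "u + v = (1::real)"
    have l: "l (u *\<^sub>R y + v *\<^sub>R z) = u * l y + v * l z"
      by (simp add: add scale)
    have nn: "l y \<ge> 0" "l z \<ge> 0"
      using yz seg0 by (force simp: Z_def)+
    show "u *\<^sub>R y + v *\<^sub>R z \<in> Z"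
    proof (cases "u * l y + v * l z > 0")
      case True
      then show ?thesis
        using l by (simp add: Z_def)
    next
      case False
      then have "u * l y = 0" "v * l z = 0"
        using nn uv by (smt (verit) mult_nonneg_nonneg)+
      then have "u = 0 \<or> y \<in> closed_segment a b" "v = 0 \<or> z \<in> closed_segment a b"
        using yz by (auto simp: Z_def)
      then show ?thesis
        using yz uv convex_closed_segment[of a b] by (auto simp: Z_def convex_def)
    qed
  qed
  moreover have "insert a (insert b S) \<subseteq> Z"
    using assms(4) by (auto simp: Z_def)
  ultimately have "x \<in> Z"
    using x(1) hull_minimal by blast
  then show ?thesis
    using x(2) by (simp add: Z_def)
qed

text \<open>A diagonal from 0 to \<open>X\<close> with the other vertices \<open>S1\<close> and
  \<open>S2\<close> on its two sides. The last two conditions place 0 to the left of the line from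
  \<open>u\<close> to \<open>v\<close> and \<open>X\<close> to its right, or on it, so that the
  segment from \<open>u\<close> to \<open>v\<close> meets the diagonal between its ends.\<close>

locale chord =
  fixes X :: "real^2" and S1 S2 :: "(real^2) set"
  assumes right: "\<And>u. u \<in> S1 \<Longrightarrow> cross X u < 0" and left: "\<And>v. v \<in> S2 \<Longrightarrow> cross X v > 0"
    and start: "\<And>u v. u \<in> S1 \<Longrightarrow> v \<in> S2 \<Longrightarrow> cross u v \<ge> 0"
    and "end": "\<And>u v. u \<in> S1 \<Longrightarrow> v \<in> S2 \<Longrightarrow> cross (v - u) (X - u) \<le> 0"
begin

abbreviation "C1 \<equiv> convex hull (insert 0 (insert X S1))"
abbreviation "C2 \<equiv> convex hull (insert 0 (insert X S2))"

lemma C1_right: "p \<in> C1 \<Longrightarrow> cross X p \<le> 0"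
proof -
  have "convex {p. cross X p \<le> 0}"
    by (auto simp: convex_def cross_simps intro!: add_nonpos_nonpos mult_nonneg_nonpos)
  then have "C1 \<subseteq> {p. cross X p \<le> 0}"
    using right by (intro hull_minimal) (force simp: cross_simps)+
  then show "p \<in> C1 \<Longrightarrow> cross X p \<le> 0"
    by blast
qed

lemma C2_left: "p \<in> C2 \<Longrightarrow> cross X p \<ge> 0"
proof -
  have "convex {p. cross X p \<ge> 0}"
    by (auto simp: convex_def cross_simps)
  then have "C2 \<subseteq> {p. cross X p \<ge> 0}"
    using left by (intro hull_minimal) (force simp: cross_simps)+
  then show "p \<in> C2 \<Longrightarrow> cross X p \<ge> 0"
    by blast
qed

lemma segment_C1: "closed_segment 0 X \<subseteq> C1" and segment_C2: "closed_segment 0 X \<subseteq> C2"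
  by (auto simp: segment_convex_hull intro!: hull_mono)

lemma C1_on_line: "p \<in> C1 \<Longrightarrow> cross X p = 0 \<Longrightarrow> p \<in> closed_segment 0 X"
  by (rule hull_meets_line_in_segment[of "\<lambda>p. - cross X p" 0 X S1])
    (auto simp: cross_simps right intro!: linearI)

lemma C2_on_line: "p \<in> C2 \<Longrightarrow> cross X p = 0 \<Longrightarrow> p \<in> closed_segment 0 X"
  by (rule hull_meets_line_in_segment[of "\<lambda>p. cross X p" 0 X S2])
    (auto simp: cross_simps left intro!: linearI)

lemma C1_Int_C2: "p \<in> C1 \<Longrightarrow> p \<in> C2 \<Longrightarrow> p \<in> closed_segment 0 X"
  using C1_right C2_left C1_on_line by force

text \<open>For fixed \<open>q\<close> the inequalities are affine in \<open>p\<close>, and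
  conversely, so they pass from the vertices to the hulls. They say that the quotient of
  \<open>cross p q\<close> by \<open>cross X q - cross X p\<close>, the parameter at which the line
  through \<open>p\<close> and \<open>q\<close> meets the diagonal, lies between 0 and 1.\<close>

lemma bilinear_bounds:
  assumes p: "p \<in> C1" and q: "q \<in> C2"
  shows "0 \<le> cross p q" "cross p q \<le> cross X q - cross X p"
proof -
  let ?P = "\<lambda>p q. 0 \<le> cross p q \<and> cross p q \<le> cross X q - cross X p"
  have c1: "convex {p. ?P p q}" for q
  proof (rule convexI, clarsimp simp: cross_simps)
    fix x y and u v :: real
    assume uv: "0 \<le> u" "0 \<le> v" "u + v = 1"
      and xy: "0 \<le> cross x q" "cross x q \<le> cross X q - cross X x"
        "0 \<le> cross y q" "cross y q \<le> cross X q - cross X y"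
    have "u * cross x q + v * cross y q \<le> u * (cross X q - cross X x) + v * (cross X q - cross X y)"
      using uv xy by (intro add_mono mult_left_mono) auto
    also have "\<dots> = (u + v) * cross X q - (u * cross X x + v * cross X y)"
      by (simp add: algebra_simps)
    finally show "u * cross x q + v * cross y q \<le> cross X q - (u * cross X x + v * cross X y)"
      using uv by simp
  qed
  have c2: "convex {q. ?P p q}" for p
  proof (rule convexI, clarsimp simp: cross_simps)
    fix x y and u v :: real
    assume uv: "0 \<le> u" "0 \<le> v" "u + v = 1"
      and xy: "0 \<le> cross p x" "cross p x \<le> cross X x - cross X p"
        "0 \<le> cross p y" "cross p y \<le> cross X y - cross X p"
    have "u * cross p x + v * cross p y \<le> u * (cross X x - cross X p) + v * (cross X y - cross X p)"
      using uv xy by (intro add_mono mult_left_mono) auto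
    also have "\<dots> = u * cross X x + v * cross X y - (u + v) * cross X p"
      by (simp add: algebra_simps)
    finally show "u * cross p x + v * cross p y \<le> u * cross X x + v * cross X y - cross X p"
      using uv by simp
  qed
  have gen: "?P u v" if "u \<in> insert 0 (insert X S1)" "v \<in> insert 0 (insert X S2)" for u v
  proof -
    have "cross u X = - cross X u" "cross v X = - cross X v" "cross v u = - cross u v"
      by (simp_all only: cross_swap[of u X] cross_swap[of v X] cross_swap[of v u])
    then have "cross u v \<le> cross X v - cross X u" if "u \<in> S1" "v \<in> S2"
      using "end"[OF that] by (simp add: cross_simps)
    moreover have "cross u X = - cross X u"
      by (rule cross_swap)
    moreover have "u = 0 \<or> u = X \<or> u \<in> S1" "v = 0 \<or> v = X \<or> v \<in> S2"
      using that by auto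
    ultimately show ?thesis
      using right[of u] left[of v] start[of u v] by (elim disjE) (simp_all only: cross_simps, simp_all)
  qed
  have "?P u q" if u: "u \<in> insert 0 (insert X S1)" for u
  proof -
    have "insert 0 (insert X S2) \<subseteq> {q. ?P u q}"
      using gen[OF u] by blast
    then have "C2 \<subseteq> {q. ?P u q}"
      by (rule hull_minimal[where S = convex, OF _ c2])
    then show ?thesis
      using q by blast
  qed
  then have "insert 0 (insert X S1) \<subseteq> {p. ?P p q}"
    by blast
  then have "C1 \<subseteq> {p. ?P p q}"
    by (rule hull_minimal[where S = convex, OF _ c1])
  then show "0 \<le> cross p q" "cross p q \<le> cross X q - cross X p"
    using p by blast+
qed

text \<open>The segment meets the diagonal in a point \<open>m\<close>, and each of its two parts
  stays in one convex half.\<close>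

lemma segment_across:
  assumes p: "p \<in> C1" and q: "q \<in> C2"
  shows "closed_segment p q \<subseteq> C1 \<union> C2"
proof -
  have cv: "convex C1" "convex C2"
    by simp_all
  have "\<exists>m \<in> closed_segment p q. m \<in> closed_segment 0 X"
  proof (cases "cross X p = cross X q")
    case True
    then have "cross X q = 0"
      using C1_right[OF p] C2_left[OF q] by simp
    then show ?thesis
      using C2_on_line[OF q] by (intro bexI[of _ q]) auto
  next
    case False
    define d where "d = cross X q - cross X p"
    have d: "d > 0"
      using False C1_right[OF p] C2_left[OF q] by (simp add: d_def)
    define m where "m = (cross p q / d) *\<^sub>R X"
    have "m \<in> closed_segment 0 X"
      using bilinear_bounds[OF p q] d
      by (auto simp: m_def in_segment d_def intro!: exI[of _ "cross p q / d"])
    moreover have "m = (1 - (- cross X p / d)) *\<^sub>R p + (- cross X p / d) *\<^sub>R q"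
    proof -
      have "cross p q *\<^sub>R X = cross X q *\<^sub>R p - cross X p *\<^sub>R q"
        using cross_cyclic[of q X p] cross_swap[of q X] by (simp add: algebra_simps)
      then have "m = (1 / d) *\<^sub>R (cross X q *\<^sub>R p - cross X p *\<^sub>R q)"
        unfolding m_def by (metis divide_inverse_commute inverse_eq_divide scaleR_scaleR)
      moreover have "1 - (- cross X p / d) = cross X q / d"
        using d by (simp add: d_def field_simps)
      ultimately show ?thesis
        by (simp add: scaleR_diff_right)
    qed
    moreover have "0 \<le> - cross X p / d" "- cross X p / d \<le> 1"
      using C1_right[OF p] C2_left[OF q] d by (simp_all add: d_def divide_simps)
    ultimately show ?thesis
      by (metis in_segment(1))
  qed
  then obtain m where m: "m \<in> closed_segment p q" "m \<in> closed_segment 0 X"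
    by blast
  then have "closed_segment p m \<subseteq> C1" "closed_segment m q \<subseteq> C2"
    using p q cv segment_C1 segment_C2 by (meson closed_segment_subset subsetD)+
  then show ?thesis
    using Un_closed_segment[OF m(1)] by blast
qed

lemma hull_eq: "convex hull (insert 0 (insert X (S1 \<union> S2))) = C1 \<union> C2"
proof
  have "convex (C1 \<union> C2)"
  proof (rule convexI)
    fix x y u v assume xy: "x \<in> C1 \<union> C2" "y \<in> C1 \<union> C2" and uv: "0 \<le> u" "0 \<le> v" "u + v = (1::real)"
    have r: "u *\<^sub>R x + v *\<^sub>R y \<in> closed_segment x y"
      using uv by (auto simp: in_segment intro!: exI[of _ v])
    have "convex C1" "convex C2"
      by simp_all
    then have "closed_segment x y \<subseteq> C1 \<union> C2"
      using xy segment_across[of x y] segment_across[of y x] closed_segment_subset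
      by (metis Un_iff closed_segment_commute le_supI1 le_supI2)
    then show "u *\<^sub>R x + v *\<^sub>R y \<in> C1 \<union> C2"
      using r by blast
  qed
  moreover have "insert 0 (insert X (S1 \<union> S2)) \<subseteq> C1 \<union> C2"
    by (auto intro: hull_inc)
  ultimately show "convex hull (insert 0 (insert X (S1 \<union> S2))) \<subseteq> C1 \<union> C2"
    by (rule hull_minimal[rotated])
  show "C1 \<union> C2 \<subseteq> convex hull (insert 0 (insert X (S1 \<union> S2)))"
    by (intro Un_least hull_mono) auto
qed

end

section \<open>Polygons glued along their sides\<close>

text \<open>A half-edge is a side seen from the polygon it bounds, and \<open>opp\<close> is the
  half-edge it is glued to. Polygons are traversed in the same sense, so glued half-edges have
  opposite displacements.\<close>

locale half_edges =
  fixes vec :: "'e \<Rightarrow> real^2" and opp :: "'e \<Rightarrow> 'e"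
  assumes vec_opp: "vec (opp e) = - vec e" and opp_opp: "opp (opp e) = e"
begin

text \<open>A polygon is the list of its sides in cyclic order; its first vertex is placed at \<open>a\<close>.\<close>

fun sides :: "real^2 \<Rightarrow> 'e list \<Rightarrow> ('e \<times> (real^2)) set" where
  "sides a [] = {}"
| "sides a (e # xs) = insert (e, a) (sides (a + vec e) xs)"

definition total :: "'e list \<Rightarrow> real^2" where
  "total xs = (\<Sum>e\<leftarrow>xs. vec e)"

definition poly :: "'e list \<Rightarrow> (real^2) set" where
  "poly xs = convex hull (snd ` sides 0 xs)"

text \<open>The opposite side is traversed backwards, hence \<open>1 - s\<close>; the identification
  is then a translation.\<close>

inductive glue :: "'e list set \<Rightarrow> 'e list \<times> (real^2) \<Rightarrow> 'e list \<times> (real^2) \<Rightarrow> bool" for C where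
  "xs \<in> C \<Longrightarrow> ys \<in> C \<Longrightarrow> (e, a) \<in> sides 0 xs \<Longrightarrow> (opp e, b) \<in> sides 0 ys \<Longrightarrow> 0 \<le> s \<Longrightarrow> s \<le> 1 \<Longrightarrow>
     glue C (xs, a + s *\<^sub>R vec e) (ys, b + (1 - s) *\<^sub>R vec (opp e))"

abbreviation surf :: "'e list set \<Rightarrow> ('e list \<times> (real^2)) set flat_surface" where
  "surf C \<equiv> glued poly C (glue C)"

text \<open>Convexity is left to the cuts: \<open>poly\<close> is a convex hull for any list, and
  each cut brings its own geometric check.\<close>

definition closed_up :: "'e list set \<Rightarrow> bool" where
  "closed_up C \<longleftrightarrow> finite C \<and> (\<forall>xs\<in>C. total xs = 0)"

definition iso :: "'e list set \<Rightarrow> 'e list set \<Rightarrow> bool" where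
  "iso C C' \<longleftrightarrow> (\<exists>f. affine_iso (surf C) (surf C') f (mat 1))"

lemma iso_sym: assumes "iso C C'" shows "iso C' C"
proof -
  obtain f where f: "affine_iso (surf C) (surf C') f (mat 1)"
    using assms by (auto simp: iso_def)
  show ?thesis
    by (rule affine_iso_inverse[OF f, of "mat 1"]) (auto simp: iso_def)
qed

lemma iso_trans: assumes "iso C C'" "iso C' C''" shows "iso C C''"
proof -
  obtain f where f: "affine_iso (surf C) (surf C') f (mat 1)"
    using assms by (auto simp: iso_def)
  obtain g where g: "affine_iso (surf C') (surf C'') g (mat 1)"
    using assms by (auto simp: iso_def)
  show ?thesis
    using affine_iso_compose[OF f g] by (auto simp: iso_def)
qed

lemma total_simps [simp]: "total [] = 0" "total (e # xs) = vec e + total xs" "total (xs @ ys) = total xs + total ys"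
  by (simp_all add: total_def)

lemma sides_append: "sides a (xs @ ys) = sides a xs \<union> sides (a + total xs) ys"
  by (induction xs arbitrary: a) (auto simp: add.assoc)

lemma sides_shift: "sides (a + t) xs = (\<lambda>(e, b). (e, b + t)) ` sides a xs"
proof (induction xs arbitrary: a)
  case (Cons e xs)
  have "a + t + vec e = (a + vec e) + t"
    by (simp add: ac_simps)
  then have "sides (a + t + vec e) xs = (\<lambda>(e, b). (e, b + t)) ` sides (a + vec e) xs"
    by (simp only: Cons)
  then show ?case
    by simp
qed simp

lemma sides_edge: "(e, a) \<in> sides b xs \<Longrightarrow> e \<in> set xs"
  by (induction xs arbitrary: b) auto

lemma finite_sides: "finite (sides a xs)"
  by (induction xs arbitrary: a) auto

lemma compact_poly: "compact (poly xs)"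
  unfolding poly_def by (intro compact_convex_hull finite_imp_compact finite_imageI finite_sides)

lemma sides_next:
  "(e, a) \<in> sides b xs \<Longrightarrow> a + vec e \<in> snd ` sides b xs \<or> a + vec e = b + total xs"
proof (induction xs arbitrary: b)
  case (Cons x xs)
  show ?case
  proof (cases "(e, a) = (x, b)")
    case True
    then show ?thesis
      by (cases xs) auto
  next
    case False
    then show ?thesis
      using Cons.IH[of "b + vec x"] Cons.prems by (auto simp: add.assoc image_iff)
  qed
qed simp

lemma side_in_poly:
  assumes e: "(e, a) \<in> sides 0 xs" and "total xs = 0" and s: "0 \<le> s" "s \<le> 1"
  shows "a + s *\<^sub>R vec e \<in> poly xs"
proof -
  have "0 \<in> snd ` sides 0 xs"
    using e by (cases xs) auto
  then have "a + vec e \<in> snd ` sides 0 xs"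
    using sides_next[OF e] assms(2) by (metis add.right_neutral)
  moreover have "a \<in> snd ` sides 0 xs"
    using e by force
  ultimately have "a \<in> poly xs" "a + vec e \<in> poly xs"
    unfolding poly_def by (auto intro: hull_inc)
  moreover have "convex (poly xs)"
    by (simp add: poly_def)
  ultimately have "(1 - s) *\<^sub>R a + s *\<^sub>R (a + vec e) \<in> poly xs"
    using s by (intro convexD) auto
  then show ?thesis
    by (simp add: algebra_simps)
qed

lemma opposite_side_in_poly:
  assumes "(opp e, b) \<in> sides 0 xs" "total xs = 0" "0 \<le> s" "s \<le> 1"
  shows "b + (1 - s) *\<^sub>R vec (opp e) \<in> poly xs"
  using assms by (intro side_in_poly) auto

lemma affine_image_poly:
  assumes "sides 0 ys = (\<lambda>(e, a). (\<sigma> e, A *v a + t)) ` sides 0 xs"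
  shows "poly ys = (\<lambda>v. A *v v + t) ` poly xs"
proof -
  have "snd ` sides 0 ys = (\<lambda>v. t + v) ` ((*v) A) ` snd ` sides 0 xs"
    unfolding assms by (force simp: image_iff)
  then have "poly ys = (\<lambda>v. t + v) ` ((*v) A) ` poly xs"
    unfolding poly_def by (simp add: convex_hull_translation convex_hull_linear_image)
  then show ?thesis
    by (simp add: image_image add.commute)
qed

text \<open>Serves for rotating polygons, with the identity matrix and a shift \<open>t\<close>, and
  for applying a matrix, with new edge names and no shift. The condition on \<open>opp\<close> is an
  equivalence because every gluing of the image has to come from a gluing of
  \<open>C\<close>.\<close>

lemma affine_iso_relabel:
  fixes A :: "real^2^2"
  assumes C: "closed_up C" and inv: "invertible A" and m: "inj_on m C"
    and sides: "\<And>xs. xs \<in> C \<Longrightarrow> sides 0 (m xs) = (\<lambda>(e, a). (\<sigma> e, A *v a + t xs)) ` sides 0 xs"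
    and vec: "\<And>e. e \<in> \<Union> (set ` C) \<Longrightarrow> vec (\<sigma> e) = A *v vec e"
    and opp: "\<And>e e'. e \<in> \<Union> (set ` C) \<Longrightarrow> e' \<in> \<Union> (set ` C) \<Longrightarrow> \<sigma> e' = opp (\<sigma> e) \<longleftrightarrow> e' = opp e"
  shows "\<exists>f. affine_iso (surf C) (surf (m ` C)) f A"
proof -
  interpret refinement poly "m ` C" "glue (m ` C)" poly C "glue C" A m t
  proof
    show "finite C"
      using C by (simp add: closed_up_def)
    show "compact (poly xs)" for xs
      by (rule compact_poly)
    show "invertible A" "m ` C \<subseteq> m ` C"
      using inv by auto
    show "poly i = (\<Union>j \<in> {j \<in> C. m j = i}. (\<lambda>v. A *v v + t j) ` poly j)" if i: "i \<in> m ` C" for i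
    proof -
      obtain xs where "xs \<in> C" "i = m xs"
        using i by blast
      moreover from this have "{j \<in> C. m j = i} = {xs}"
        using m by (auto simp: inj_on_def)
      ultimately show ?thesis
        using affine_image_poly[OF sides] by simp
    qed
    show "equivclp (glue (m ` C)) (m j, A *v v + t j) (m k, A *v w + t k)"
      if "glue C (j, v) (k, w)" for j v k w
      using that
    proof cases
      case (1 e a b s)
      have ee: "e \<in> \<Union> (set ` C)" "opp e \<in> \<Union> (set ` C)"
        using 1 sides_edge by blast+
      have "glue (m ` C) (m j, (A *v a + t j) + s *\<^sub>R vec (\<sigma> e))
              (m k, (A *v b + t k) + (1 - s) *\<^sub>R vec (opp (\<sigma> e)))"
      proof (rule glue.intros)
        have "(\<sigma> (opp e), A *v b + t k) \<in> sides 0 (m k)"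
          using sides[of k] 1 by force
        moreover have "\<sigma> (opp e) = opp (\<sigma> e)"
          using opp ee by blast
        ultimately show "(opp (\<sigma> e), A *v b + t k) \<in> sides 0 (m k)"
          by simp
        show "(\<sigma> e, A *v a + t j) \<in> sides 0 (m j)"
          using sides[of j] 1 by force
      qed (use 1 in auto)
      moreover have "vec (\<sigma> e) = A *v vec e"
        using vec ee by blast
      ultimately have "glue (m ` C) (m j, A *v v + t j) (m k, A *v w + t k)"
        using 1 by (simp add: vec_opp matrix_vector_right_distrib matrix_vector_mult_scaleR
            matrix_vector_mult_diff_distrib ac_simps add_diff_eq)
      then show ?thesis
        by (rule r_into_equivclp)
    qed
    show "\<exists>j v k w. j \<in> C \<and> v \<in> poly j \<and> k \<in> C \<and> w \<in> poly k \<and>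
        x = (m j, A *v v + t j) \<and> y = (m k, A *v w + t k) \<and> equivclp (glue C) (j, v) (k, w)"
      if "glue (m ` C) x y" for x y
      using that
    proof cases
      case (1 xs' ys' e' a' b' s)
      then obtain xs ys where xy: "xs \<in> C" "xs' = m xs" "ys \<in> C" "ys' = m ys"
        by blast
      then obtain e a where e: "(e, a) \<in> sides 0 xs" "e' = \<sigma> e" "a' = A *v a + t xs"
        using 1 sides[of xs] by auto
      obtain d b where d: "(d, b) \<in> sides 0 ys" "opp e' = \<sigma> d" "b' = A *v b + t ys"
        using 1 xy sides[of ys] by auto
      have ee: "e \<in> \<Union> (set ` C)" "d \<in> \<Union> (set ` C)"
        using xy e d sides_edge by blast+
      then have de: "d = opp e"
        using opp[of e d] d e by simp
      have v: "vec e' = A *v vec e" "vec (opp e') = - (A *v vec e)"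
        using vec ee e by (simp_all add: vec_opp)
      have tot: "total xs = 0" "total ys = 0"
        using C xy by (auto simp: closed_up_def)
      have "glue C (xs, a + s *\<^sub>R vec e) (ys, b + (1 - s) *\<^sub>R vec (opp e))"
        using xy e d de 1 by (intro glue.intros) auto
      moreover have "x = (m xs, A *v (a + s *\<^sub>R vec e) + t xs)"
        using 1 xy e v by (simp add: matrix_vector_right_distrib matrix_vector_mult_scaleR ac_simps)
      moreover have "y = (m ys, A *v (b + (1 - s) *\<^sub>R vec (opp e)) + t ys)"
        unfolding \<open>y = _\<close> v using 1 xy d
        by (simp add: vec_opp matrix_vector_right_distrib matrix_vector_mult_scaleR
            matrix_vector_mult_diff_distrib ac_simps)
      moreover have "a + s *\<^sub>R vec e \<in> poly xs" "b + (1 - s) *\<^sub>R vec (opp e) \<in> poly ys"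
        using e(1) d(1) de tot 1 by (auto intro!: side_in_poly opposite_side_in_poly)
      ultimately show ?thesis
        using xy r_into_equivclp by metis
    qed
    show "equivclp (glue C) (j, v) (k, w)" if "j \<in> C" "v \<in> poly j" "k \<in> C" "w \<in> poly k" "m j = m k"
        "A *v v + t j = A *v w + t k" for j v k w
    proof -
      have "j = k"
        using that m by (auto simp: inj_on_def)
      then have "v = w"
        using that inv inj_matrix_vector_mult by (metis add_right_cancel injD)
      then show ?thesis
        using \<open>j = k\<close> by simp
    qed
  qed
  show ?thesis
    using affine_iso_F by blast
qed

text \<open>The first vertex is always placed at 0, so beginning the list at another vertex
  translates the polygon.\<close>

lemma sides_rotate:
  assumes "total (xs @ ys) = 0"
  shows "sides 0 (ys @ xs) = (\<lambda>(e, a). (e, a - total xs)) ` sides 0 (xs @ ys)"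
proof -
  have "sides 0 (ys @ xs) = sides (0 + total xs + - total xs) ys \<union> sides (0 + - total xs) xs"
    using assms by (simp add: sides_append add_eq_0_iff)
  also have "\<dots> = (\<lambda>(e, a). (e, a + - total xs)) ` sides 0 (xs @ ys)"
    by (simp only: sides_shift[of _ "- total xs"] sides_append image_Un Un_commute)
  finally show ?thesis
    by simp
qed

definition rotation_of :: "'e list \<Rightarrow> 'e list \<Rightarrow> bool" where
  "rotation_of xs ys \<longleftrightarrow> (\<exists>us vs. xs = us @ vs \<and> ys = vs @ us)"

lemma iso_rotations:
  assumes C: "closed_up C" and m: "inj_on m C" and rot: "\<And>xs. xs \<in> C \<Longrightarrow> rotation_of xs (m xs)"
  shows "iso C (m ` C)" "closed_up (m ` C)"
proof -
  have "\<exists>t. sides 0 (m xs) = (\<lambda>(e, a). (id e, mat 1 *v a + t)) ` sides 0 xs \<and> total (m xs) = 0"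
    if xs: "xs \<in> C" for xs
  proof -
    obtain us vs where uv: "xs = us @ vs" "m xs = vs @ us"
      using rot[OF xs] by (auto simp: rotation_of_def)
    have 0: "total (us @ vs) = 0"
      using C that uv by (auto simp: closed_up_def)
    then have "total (m xs) = 0"
      using uv by (simp add: add.commute)
    then show ?thesis
      using sides_rotate[OF 0] uv by (auto intro!: exI[of _ "- total us"])
  qed
  then obtain t where t: "\<And>xs. xs \<in> C \<Longrightarrow>
      sides 0 (m xs) = (\<lambda>(e, a). (id e, mat 1 *v a + t xs)) ` sides 0 xs \<and> total (m xs) = 0"
    by metis
  then show "closed_up (m ` C)"
    using C by (auto simp: closed_up_def)
  show "iso C (m ` C)"
    unfolding iso_def
    by (rule affine_iso_relabel[OF C _ m, where \<sigma> = id and t = t]) (use t in \<open>auto simp: invertible_def\<close>)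
qed

lemma rotation_of_refl: "rotation_of xs xs"
  unfolding rotation_of_def by (rule exI[of _ "[]"]) simp

lemma rotation_of_trans: "rotation_of xs ys \<Longrightarrow> rotation_of ys zs \<Longrightarrow> rotation_of xs zs"
  unfolding rotation_of_def
proof (elim exE conjE)
  fix us vs us' vs' assume *: "xs = us @ vs" "ys = vs @ us" "ys = us' @ vs'" "zs = vs' @ us'"
  then consider w where "vs = us' @ w" "w @ us = vs'" | w where "vs @ w = us'" "us = w @ vs'"
    by (auto simp: append_eq_append_conv2)
  then show "\<exists>us vs. xs = us @ vs \<and> zs = vs @ us"
  proof cases
    case 1
    then show ?thesis
      using * by (intro exI[of _ "us @ us'"] exI[of _ w]) simp
  next
    case 2
    then show ?thesis
      using * by (intro exI[of _ w] exI[of _ "vs' @ vs"]) simp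
  qed
qed

lemma rotation_of_set: "rotation_of xs ys \<Longrightarrow> set ys = set xs"
  by (auto simp: rotation_of_def)

lemma iso_refl: "closed_up C \<Longrightarrow> iso C C"
  using iso_rotations(1)[of C "\<lambda>xs. xs"] rotation_of_refl by simp

section \<open>Cutting a polygon along a diagonal\<close>

text \<open>The halves receive the new half-edges \<open>opp e\<close> and \<open>e\<close>. Both
  are fresh, so they are glued only to each other, and this by the identity of the diagonal. Hence
  the cut pieces refine the old ones, and the isomorphism obtained from the refinement is inverted
  at the end.\<close>

lemma iso_cut:
  assumes C: "closed_up (insert (xs @ ys) D)" and vec_e: "vec e = total xs" and e: "opp e \<noteq> e"
    and fresh: "\<And>zs d. zs \<in> insert (xs @ ys) D \<Longrightarrow> d \<in> set zs \<Longrightarrow> d \<noteq> e \<and> d \<noteq> opp e"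
    and xs: "xs \<noteq> []" "ys \<noteq> []" "xs @ ys \<notin> D"
    and ch: "chord (total xs) (snd ` sides 0 xs - {0}) (snd ` sides (total xs) ys - {total xs})"
  shows "iso (insert (xs @ ys) D) (insert (xs @ [opp e]) (insert (e # ys) D))"
    "closed_up (insert (xs @ [opp e]) (insert (e # ys) D))"
proof -
  let ?P = "xs @ ys" and ?P1 = "xs @ [opp e]" and ?P2 = "e # ys" and ?X = "total xs"
  let ?C = "insert ?P D" and ?C' = "insert ?P1 (insert ?P2 D)"
  have tot: "total ys = - ?X"
    using C by (simp add: closed_up_def add_eq_0_iff)
  show closed': "closed_up ?C'"
    using C tot vec_e by (auto simp: closed_up_def vec_opp)
  have new: "?P1 \<notin> D" "?P2 \<notin> D"
    using fresh[of ?P1 "opp e"] fresh[of ?P2 e] by auto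
  have P12: "?P1 \<noteq> ?P2"
    using fresh[of ?P] xs(1) by (cases xs) auto
  have sides_P: "sides 0 ?P = sides 0 xs \<union> sides ?X ys"
    and sides_P1: "sides 0 ?P1 = insert (opp e, ?X) (sides 0 xs)"
    and sides_P2: "sides 0 ?P2 = insert (e, 0) (sides ?X ys)"
    using vec_e by (auto simp: sides_append)
  interpret ch: chord ?X "snd ` sides 0 xs - {0}" "snd ` sides ?X ys - {?X}"
    by (rule ch)
  have 0: "0 \<in> snd ` sides 0 xs" and X: "?X \<in> snd ` sides ?X ys"
    using xs by (cases xs; cases ys; force)+
  have poly1: "poly ?P1 = ch.C1" and poly2: "poly ?P2 = ch.C2"
    unfolding poly_def sides_P1 sides_P2
    using 0 X by (auto intro!: arg_cong[where f = "\<lambda>S. convex hull S"])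
  have "poly ?P = convex hull (insert 0 (insert ?X ((snd ` sides 0 xs - {0}) \<union> (snd ` sides ?X ys - {?X}))))"
    unfolding poly_def sides_P
    using 0 X by (auto intro!: arg_cong[where f = "\<lambda>S. convex hull S"])
  then have poly: "poly ?P = poly ?P1 \<union> poly ?P2"
    using ch.hull_eq poly1 poly2 by simp
  define p where "p zs = (if zs = ?P1 \<or> zs = ?P2 then ?P else zs)" for zs
  have pD: "p zs = zs" if "zs \<in> D" for zs
    using that new by (auto simp: p_def)
  have side_down: "(d, a) \<in> sides 0 (p zs)" if "zs \<in> ?C'" "(d, a) \<in> sides 0 zs" "d \<noteq> e" "d \<noteq> opp e" for zs d a
    using that pD sides_P sides_P1 sides_P2 by (auto simp: p_def)
  have side_up: "\<exists>zs' \<in> ?C'. p zs' = zs \<and> (d, a) \<in> sides 0 zs'" if "zs \<in> ?C" "(d, a) \<in> sides 0 zs" for zs d a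
  proof (cases "zs = ?P")
    case True
    then show ?thesis
      using that sides_P sides_P1 sides_P2 by (auto simp: p_def)
  next
    case False
    then show ?thesis
      using that pD by auto
  qed
  have p_in: "p zs \<in> ?C" if "zs \<in> ?C'" for zs
    using that pD by (auto simp: p_def)
  have old: "e \<notin> set xs" "e \<notin> set ys" "opp e \<notin> set xs" "opp e \<notin> set ys"
      "\<And>zs. zs \<in> D \<Longrightarrow> e \<notin> set zs" "\<And>zs. zs \<in> D \<Longrightarrow> opp e \<notin> set zs"
    using fresh[of ?P] fresh by auto
  have only_e: "zs = ?P2 \<and> a = 0" if "zs \<in> ?C'" "(e, a) \<in> sides 0 zs" for zs a
    using that old e P12 sides_edge[OF that(2)] sides_edge[of e a 0 xs] sides_edge[of e a ?X ys]
    by (auto simp: sides_P1 vec_e)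
  have only_opp: "zs = ?P1 \<and> a = ?X" if "zs \<in> ?C'" "(opp e, a) \<in> sides 0 zs" for zs a
    using that old e P12 sides_edge[OF that(2)] sides_edge[of "opp e" a 0 xs] sides_edge[of "opp e" a ?X ys]
    by (auto simp: sides_P1 vec_e)
  interpret refinement poly ?C "glue ?C" poly ?C' "glue ?C'" "mat 1" p "\<lambda>_. 0"
  proof
    show "finite ?C'"
      using closed' by (simp add: closed_up_def)
    show "compact (poly zs)" for zs
      by (rule compact_poly)
    show "invertible (mat 1 :: real^2^2)"
      by (auto simp: invertible_def)
    show "p ` ?C' \<subseteq> ?C"
      using p_in by blast
    show "poly i = (\<Union>j \<in> {j \<in> ?C'. p j = i}. (\<lambda>v. mat 1 *v v + 0) ` poly j)" if "i \<in> ?C" for i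
    proof (cases "i = ?P")
      case True
      then have "{j \<in> ?C'. p j = i} = {?P1, ?P2}"
        using xs(3) pD by (auto simp: p_def)
      then show ?thesis
        using True poly by simp
    next
      case False
      then have "{j \<in> ?C'. p j = i} = {i}"
        using that pD new by (auto simp: p_def)
      then show ?thesis
        by simp
    qed
    show "equivclp (glue ?C) (p j, mat 1 *v v + 0) (p k, mat 1 *v w + 0)"
      if "glue ?C' (j, v) (k, w)" for j v k w
      using that
    proof cases
      case (1 d a b s)
      consider "d = e" | "d = opp e" | "d \<noteq> e" "d \<noteq> opp e"
        by blast
      then show ?thesis
      proof cases
        case a: 1
        then have "j = ?P2 \<and> a = 0" "k = ?P1 \<and> b = ?X"
          using 1 only_e only_opp by blast+
        then have "p j = p k" "v = w"
          using 1 a by (simp_all add: p_def vec_opp vec_e algebra_simps)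
        then show ?thesis
          by simp
      next
        case a: 2
        then have "j = ?P1 \<and> a = ?X" "k = ?P2 \<and> b = 0"
          using 1 only_e only_opp opp_opp by metis+
        then have "p j = p k" "v + s *\<^sub>R ?X = ?X" "w + s *\<^sub>R ?X = ?X"
          using 1 a by (simp_all add: p_def vec_opp vec_e opp_opp algebra_simps)
        then have "p j = p k" "v = w"
          by (metis add_right_cancel)+
        then show ?thesis
          by simp
      next
        case a: 3
        then have "opp d \<noteq> e" "opp d \<noteq> opp e"
          using opp_opp by metis+
        then have "glue ?C (p j, v) (p k, w)"
          unfolding \<open>v = _\<close> \<open>w = _\<close> using 1 a p_in side_down by (intro glue.intros) auto
        then show ?thesis
          by (simp add: r_into_equivclp)
      qed
    qed
    show "\<exists>j v k w. j \<in> ?C' \<and> v \<in> poly j \<and> k \<in> ?C' \<and> w \<in> poly k \<and>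
        x = (p j, mat 1 *v v + 0) \<and> y = (p k, mat 1 *v w + 0) \<and> equivclp (glue ?C') (j, v) (k, w)"
      if "glue ?C x y" for x y
      using that
    proof cases
      case (1 xs' ys' d a b s)
      obtain j where j: "j \<in> ?C'" "p j = xs'" "(d, a) \<in> sides 0 j"
        using side_up 1 by blast
      obtain k where k: "k \<in> ?C'" "p k = ys'" "(opp d, b) \<in> sides 0 k"
        using side_up 1 by blast
      have "total j = 0" "total k = 0"
        using closed' j k by (auto simp: closed_up_def)
      then have "a + s *\<^sub>R vec d \<in> poly j" "b + (1 - s) *\<^sub>R vec (opp d) \<in> poly k"
        using j k 1 by (auto intro!: side_in_poly opposite_side_in_poly)
      moreover have "glue ?C' (j, a + s *\<^sub>R vec d) (k, b + (1 - s) *\<^sub>R vec (opp d))"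
        using j k 1 by (intro glue.intros) auto
      ultimately show ?thesis
        using j(1,2) k(1,2) 1(1,2) r_into_equivclp by (metis add.right_neutral matrix_vector_mul_lid)
    qed
    show "equivclp (glue ?C') (j, v) (k, w)" if "j \<in> ?C'" "v \<in> poly j" "k \<in> ?C'" "w \<in> poly k"
        "p j = p k" "mat 1 *v v + 0 = mat 1 *v w + 0" for j v k w
    proof -
      have vw: "w = v"
        using that by simp
      \<comment> \<open>The halves share only points of the diagonal, where the gluing along
        \<open>e\<close> identifies the two copies of a point.\<close>
      have on_chord: "glue ?C' (?P2, v) (?P1, v)" if "v \<in> poly ?P1" "v \<in> poly ?P2"
      proof -
        have "v \<in> closed_segment 0 ?X"
          using ch.C1_Int_C2 that poly1 poly2 by simp
        then obtain s where s: "0 \<le> s" "s \<le> 1" "v = s *\<^sub>R ?X"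
          by (auto simp: in_segment)
        have "glue ?C' (?P2, 0 + s *\<^sub>R vec e) (?P1, ?X + (1 - s) *\<^sub>R vec (opp e))"
          using s by (intro glue.intros) (auto simp: sides_P1 sides_P2)
        then show ?thesis
          by (simp add: s vec_e vec_opp algebra_simps)
      qed
      have "j = k \<or> j = ?P1 \<and> k = ?P2 \<or> j = ?P2 \<and> k = ?P1"
        using that xs(3) pD by (auto simp: p_def split: if_splits)
      then show ?thesis
        using on_chord that(2,4) vw by (auto intro: r_into_equivclp equivclp_sym)
    qed
  qed
  show "iso ?C ?C'"
    using affine_iso_F by (metis iso_def iso_sym)
qed

end

section \<open>Arithmetic in the ring generated by the Arnoux-Yoccoz number\<close>

lemma ay_alpha_root: "ay_alpha^3 + ay_alpha^2 + ay_alpha - 1 = 0"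
  unfolding ay_alpha_def by (rule theI'[OF ay_alpha_ex1])

text \<open>Coordinates in the basis 1, \<alpha>, \<alpha>^2, so that geometric conditions are
  decided by integer evaluation.\<close>

type_synonym coord = "int \<times> int \<times> int"

fun val :: "coord \<Rightarrow> real" where
  "val (a, b, c) = of_int a + of_int b * ay_alpha + of_int c * ay_alpha^2"

fun cadd :: "coord \<Rightarrow> coord \<Rightarrow> coord" where
  "cadd (a, b, c) (d, e, f) = (a + d, b + e, c + f)"

fun cneg :: "coord \<Rightarrow> coord" where
  "cneg (a, b, c) = (- a, - b, - c)"

text \<open>The coefficients \<open>p\<close> and \<open>q\<close> of the third and fourth powers
  are reduced by \<alpha>^3 = 1 - \<alpha> - \<alpha>^2 and \<alpha>^4 = 2 \<alpha> - 1.\<close>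

fun cmul :: "coord \<Rightarrow> coord \<Rightarrow> coord" where
  "cmul (a, b, c) (d, e, f) =
     (let p = b * f + c * e; q = c * f
      in (a * d + p - q, a * e + b * d - p + 2 * q, a * f + b * e + c * d - p))"

text \<open>Rational enclosures of \<open>\<alpha>\<close> and \<open>\<alpha>\<^sup>2\<close>, scaled by \<open>10\<^sup>1\<^sup>2\<close>.\<close>

fun cpos :: "coord \<Rightarrow> bool" where
  "cpos (a, b, c) \<longleftrightarrow>
     a * 1000000000000 + b * (if b \<ge> 0 then 543689012692 else 543689012693) +
       c * (if c \<ge> 0 then 295597742522 else 295597742524) > 0"

text \<open>Collinear vertices produce an exact zero, which an enclosure of positive width cannot
  certify as nonnegative; it is read off from the coordinates.\<close>

definition cnonneg :: "coord \<Rightarrow> bool" where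
  "cnonneg x \<longleftrightarrow> x = (0, 0, 0) \<or> cpos x"

lemma val_cadd [simp]: "val (cadd x y) = val x + val y"
  by (cases x; cases y) (simp add: algebra_simps)

lemma val_cneg [simp]: "val (cneg x) = - val x"
  by (cases x) simp

lemma val_cmul [simp]: "val (cmul x y) = val x * val y"
proof (cases x; cases y)
  fix a b c d e f assume xy: "x = (a, b, c)" "y = (d, e, f)"
  have 3: "ay_alpha^3 = 1 - ay_alpha - ay_alpha^2"
    using ay_alpha_root by simp
  have 4: "ay_alpha^4 = 2 * ay_alpha - 1"
    using ay_alpha_root by algebra
  have "(A + B * ay_alpha + C * ay_alpha^2) * (D + E * ay_alpha + F * ay_alpha^2) =
      A * D + (A * E + B * D) * ay_alpha + (A * F + B * E + C * D) * ay_alpha^2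
      + (B * F + C * E) * ay_alpha^3 + C * F * ay_alpha^4" for A B C D E F
    by algebra
  then show "val (cmul x y) = val x * val y"
    unfolding xy by (simp add: Let_def 3 4) (simp add: algebra_simps)
qed

text \<open>The cubic increases on the nonnegative reals and changes sign between the bounds. A
  negative root is excluded because \<alpha> times a positive quadratic is 1.\<close>

lemma ay_alpha_bounds:
  "543689012692 / 10^12 \<le> ay_alpha" "ay_alpha \<le> 543689012693 / 10^12"
proof -
  define f where "f x = x^3 + x^2 + x - 1" for x :: real
  have mono: "f x < f y" if "x < y" "0 \<le> x" for x y
    using that power_strict_mono[of x y 3] power_strict_mono[of x y 2] by (simp add: f_def)
  have 0: "f ay_alpha = 0"
    using ay_alpha_root by (simp add: f_def)
  have "f (543689012692 / 10^12) < 0" "f (543689012693 / 10^12) > 0"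
    by (simp_all add: f_def field_simps)
  moreover have "ay_alpha \<ge> 0"
  proof (rule ccontr)
    assume "\<not> ay_alpha \<ge> 0"
    then have "ay_alpha < 0"
      by simp
    moreover have "ay_alpha * (ay_alpha^2 + ay_alpha + 1) = 1"
      using ay_alpha_root by algebra
    moreover have "ay_alpha^2 + ay_alpha + 1 > 0"
      using zero_le_power2[of "2 * ay_alpha + 1"] by (simp add: power2_eq_square algebra_simps)
    ultimately show False
      by (smt (verit) mult_neg_pos)
  qed
  ultimately show "543689012692 / 10^12 \<le> ay_alpha" "ay_alpha \<le> 543689012693 / 10^12"
    using mono 0 by (smt (verit) divide_nonneg_nonneg zero_le_power)+
qed

lemma ay_alpha_square_bounds:
  "295597742522 / 10^12 \<le> ay_alpha^2" "ay_alpha^2 \<le> 295597742524 / 10^12"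
proof -
  have "(543689012692 / 10^12)^2 \<le> ay_alpha^2" "ay_alpha^2 \<le> (543689012693 / 10^12)^2"
    using ay_alpha_bounds by (intro power_mono; simp)+
  then show "295597742522 / 10^12 \<le> ay_alpha^2" "ay_alpha^2 \<le> 295597742524 / 10^12"
    by (simp_all add: power2_eq_square)
qed

lemma scaled_lower_bound:
  fixes x :: real
  assumes "real_of_int l \<le> N * x" "N * x \<le> real_of_int u"
  shows "real_of_int (b * (if b \<ge> 0 then l else u)) \<le> real_of_int b * (N * x)"
proof (cases "b \<ge> 0")
  case True
  then have "real_of_int b * real_of_int l \<le> real_of_int b * (N * x)"
    by (intro mult_left_mono assms(1)) simp
  with True show ?thesis
    by simp
next
  case False
  then have "real_of_int b * real_of_int u \<le> real_of_int b * (N * x)"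
    by (intro mult_left_mono_neg assms(2)) simp
  with False show ?thesis
    by simp
qed

text \<open>Each coefficient meets the end of the enclosure that makes the product smallest, so the
  integer in \<open>cpos\<close> bounds \<open>val x\<close> times 10^12 from below.\<close>

lemma cpos_sound: assumes "cpos x" shows "val x > 0"
proof (cases x)
  case (fields a b c)
  let ?b = "b * (if b \<ge> 0 then 543689012692 else 543689012693)"
    and ?c = "c * (if c \<ge> 0 then 295597742522 else 295597742524)"
  have "0 < a * 1000000000000 + ?b + ?c"
    using assms fields by simp
  then have "0 < real_of_int (a * 1000000000000 + ?b + ?c)"
    by (simp only: of_int_0_less_iff)
  also have "\<dots> = real_of_int a * 1000000000000 + real_of_int ?b + real_of_int ?c"
    by simp
  also have "\<dots> \<le> real_of_int a * 1000000000000 + real_of_int b * (1000000000000 * ay_alpha)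
      + real_of_int c * (1000000000000 * ay_alpha^2)"
    using ay_alpha_bounds ay_alpha_square_bounds
    by (intro add_mono scaled_lower_bound order_refl) simp_all
  also have "\<dots> = 1000000000000 * val x"
    using fields by (simp add: algebra_simps)
  finally show ?thesis
    by simp
qed

lemma cnonneg_sound: "cnonneg x \<Longrightarrow> val x \<ge> 0"
  using cpos_sound[of x] by (auto simp: cnonneg_def)

section \<open>Irrationality of \<alpha> and linear independence of its powers\<close>

text \<open>The rational root argument: the denominator divides a power of the coprime numerator and
  is 1, then the numerator divides 1, and neither 1 nor -1 is a root.\<close>

lemma no_rational_root:
  fixes r :: rat
  shows "r^3 + r^2 + r - 1 \<noteq> 0"
proof
  assume r: "r^3 + r^2 + r - 1 = 0"
  obtain p q where pq: "quotient_of r = (p, q)"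
    by (rule prod.exhaust)
  have q: "q > 0" and cop: "coprime p q" and rpq: "r = of_int p / of_int q"
    using pq quotient_of_denom_pos quotient_of_coprime quotient_of_div by blast+
  have "of_int (p^3 + p^2 * q + p * q^2 - q^3) = (0 :: rat)"
    using r q unfolding rpq by (simp add: field_simps power2_eq_square power3_eq_cube)
  then have eq: "p^3 + p^2 * q + p * q^2 - q^3 = 0"
    by (simp only: of_int_eq_0_iff)
  then have "p^3 = q * (q^2 - p * q - p^2)"
    by algebra
  then have "q dvd p^3"
    by simp
  moreover have "coprime q (p^3)"
    using cop by (simp add: coprime_commute)
  ultimately have q1: "q = 1"
    using q by (metis abs_of_pos coprime_absorb_left zdvd1_eq)
  then have "p * (p^2 + p + 1) = 1"
    using eq by algebra
  then have "p dvd 1"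
    by (metis dvd_triv_left)
  then have "p = 1 \<or> p = -1"
    by (simp add: abs_if split: if_splits)
  then show False
    using eq q1 by auto
qed

lemma ay_alpha_irrational: "ay_alpha \<noteq> of_rat r"
proof
  assume "ay_alpha = of_rat r"
  then have "of_rat (r^3 + r^2 + r - 1) = (0 :: real)"
    using ay_alpha_root by (simp add: of_rat_add of_rat_diff of_rat_power)
  then show False
    using no_rational_root[of r] by (metis of_rat_eq_0_iff)
qed

text \<open>If \<open>c\<close> were nonzero, the remainder of the cubic modulo the quadratic would
  be linear and vanish at \<alpha>, hence be zero by irrationality. The quadratic would then divide
  the cubic and leave a rational root.\<close>

lemma ay_alpha_independent:
  fixes a b c :: rat
  assumes eq: "of_rat a + of_rat b * ay_alpha + of_rat c * ay_alpha^2 = 0"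
  shows "a = 0 \<and> b = 0 \<and> c = 0"
proof -
  have lin: "m = 0 \<and> n = 0" if "of_rat m + of_rat n * ay_alpha = 0" for m n :: rat
  proof -
    have n: "n = 0"
    proof (rule ccontr)
      assume "n \<noteq> 0"
      then have "ay_alpha = of_rat (- m / n)"
        using that by (simp add: of_rat_divide of_rat_minus field_simps)
      then show False
        using ay_alpha_irrational by blast
    qed
    then show ?thesis
      using that by simp
  qed
  have "c = 0"
  proof (rule ccontr)
    assume c: "c \<noteq> 0"
    have "of_rat (c^2 - (b - c) * a) + of_rat (c * (a - c) - (b - c) * b) * ay_alpha = 0"
      using eq ay_alpha_root
      by (simp only: of_rat_add of_rat_diff of_rat_mult of_rat_power) algebra
    then have 1: "c^2 = (b - c) * a" "c * (a - c) = (b - c) * b"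
      using lin by fastforce+
    \<comment> \<open>The root of the remaining linear factor, read off from the coefficient of the
      square in the cubic.\<close>
    define r where "r = (b - c) / c"
    have b: "b = c * (r + 1)"
      using c by (simp add: r_def field_simps)
    have "c^2 = c * (r * a)" "c * (a - c) = c * (r * b)"
      using 1 c by (simp_all add: r_def)
    then have ra: "c = r * a" "a - c = r * b"
      using c by (simp_all add: power2_eq_square)
    then have "c * (r^3 + r^2 + r - 1) = 0"
      using b by algebra
    then show False
      using c no_rational_root[of r] by simp
  qed
  then show ?thesis
    using eq lin by simp
qed


text \<open>Lets an edge be recovered from its label and its displacement vector, so that edges
  remain distinct after a matrix is applied.\<close>

lemma val_inject: "val x = val y \<longleftrightarrow> x = y"
proof (cases x; cases y)
  fix a b c d e f assume xy: "x = (a, b, c)" "y = (d, e, f)"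
  have "val x = val y \<Longrightarrow> of_rat (of_int (a - d)) + of_rat (of_int (b - e)) * ay_alpha
      + of_rat (of_int (c - f)) * ay_alpha^2 = 0"
    using xy by (simp add: of_rat_diff algebra_simps)
  then have "val x = val y \<Longrightarrow> x = y"
    using ay_alpha_independent[of "of_int (a - d)" "of_int (b - e)" "of_int (c - f)"] xy by simp
  then show ?thesis
    by blast
qed

declare val.simps [simp del]

section \<open>Flipping diagonals of triangulations\<close>

text \<open>
  An edge carries a label, which is negated by reversing the edge, and its displacement; the label
  distinguishes parallel edges of equal length.
\<close>

type_synonym point = "coord \<times> coord"
type_synonym edge = "int \<times> point"

fun padd :: "point \<Rightarrow> point \<Rightarrow> point" where
  "padd (a, b) (c, d) = (cadd a c, cadd b d)"

fun pneg :: "point \<Rightarrow> point" where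
  "pneg (a, b) = (cneg a, cneg b)"

fun ccross :: "point \<Rightarrow> point \<Rightarrow> coord" where
  "ccross (a, b) (c, d) = cadd (cmul a d) (cneg (cmul b c))"

fun pt :: "point \<Rightarrow> real^2" where
  "pt (a, b) = vector [val a, val b]"

definition edge_vec :: "edge \<Rightarrow> real^2" where
  "edge_vec e = pt (snd e)"

definition edge_opp :: "edge \<Rightarrow> edge" where
  "edge_opp e = (- fst e, pneg (snd e))"

lemma pt_padd [simp]: "pt (padd p q) = pt p + pt q"
  by (induction p q rule: padd.induct) (simp add: vec_eq_iff forall_2)

lemma pt_pneg [simp]: "pt (pneg p) = - pt p"
  by (induction p rule: pneg.induct) (simp add: vec_eq_iff forall_2)

lemma val_ccross: "val (ccross p q) = cross (pt p) (pt q)"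
  by (induction p q rule: ccross.induct) (simp add: cross_def)

lemma pt_inject: "pt p = pt q \<longleftrightarrow> p = q"
  by (cases p rule: pt.cases; cases q rule: pt.cases) (simp add: vec_eq_iff forall_2 val_inject)

lemma pneg_pneg [simp]: "pneg (pneg p) = p"
  by (cases p; cases "fst p"; cases "snd p") auto

interpretation half_edges edge_vec edge_opp
  by standard (simp_all add: edge_vec_def edge_opp_def)

definition rot_to :: "int \<Rightarrow> edge list \<Rightarrow> edge list" where
  "rot_to n xs = dropWhile (\<lambda>e. fst e \<noteq> n) xs @ takeWhile (\<lambda>e. fst e \<noteq> n) xs"

definition has :: "int \<Rightarrow> edge list \<Rightarrow> bool" where
  "has n xs \<longleftrightarrow> list_ex (\<lambda>e. fst e = n) xs"

text \<open>The label 0 is its own negative, so it could not tell an edge from its reverse.\<close>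

definition fresh :: "int \<Rightarrow> edge list list \<Rightarrow> bool" where
  "fresh n ts \<longleftrightarrow> n \<noteq> 0 \<and> list_all (list_all (\<lambda>e. fst e \<noteq> n \<and> fst e \<noteq> - n)) ts"

fun starts :: "point \<Rightarrow> edge list \<Rightarrow> point list" where
  "starts p [] = []"
| "starts p (e # es) = p # starts (padd p (snd e)) es"

text \<open>The conditions of the locale \<open>chord\<close> for the diagonal that cuts the sides \<open>x, y\<close> off \<open>x # y # ys\<close>.\<close>

definition ear_ok :: "edge \<Rightarrow> edge \<Rightarrow> edge list \<Rightarrow> bool" where
  "ear_ok x y ys \<longleftrightarrow> (let X = padd (snd x) (snd y) in
     ys \<noteq> [] \<and> cpos (ccross (snd x) (snd y)) \<and>
     list_all (\<lambda>p. cpos (ccross X p) \<and> cnonneg (ccross (snd x) p) \<and>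
       cnonneg (ccross (snd y) (padd p (pneg (snd x))))) (tl (starts X ys)))"

text \<open>In the pair, \<open>n\<close> labels the side at which the cut-off triangle starts and
  \<open>m\<close> the new diagonal. A failed check yields \<open>None\<close>, so a successful run
  certifies every cut.\<close>

definition ear :: "int \<times> int \<Rightarrow> edge list list \<Rightarrow> edge list list option" where
  "ear nm ts = (case nm of (n, m) \<Rightarrow>
     (case filter (has n) ts of
        [t] \<Rightarrow> (case rot_to n t of
          x # y # ys \<Rightarrow>
            (let D = filter (\<lambda>t. \<not> has n t) ts; e = (m, padd (snd x) (snd y))
             in if fresh m (t # D) \<and> ear_ok x y ys
                then Some ([x, y, edge_opp e] # (e # ys) # D) else None)
        | _ \<Rightarrow> None)
      | _ \<Rightarrow> None))"

text \<open>Without their common edge the triangles form the quadrilateral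
  \<open>c, d, a, b\<close>. The first \<open>ear_ok\<close> concerns its old diagonal
  \<open>e\<close>, the second the new diagonal \<open>g\<close>, which inherits the label
  \<open>n\<close>. The other faces have three sides, so the quadrilateral is not among
  them.\<close>

definition flip :: "int \<Rightarrow> edge list list \<Rightarrow> edge list list option" where
  "flip n ts = (case (filter (has n) ts, filter (has (- n)) ts) of
     ([t1], [t2]) \<Rightarrow> (case (rot_to n t1, rot_to (- n) t2) of
       ([e, a, b], [f, c, d]) \<Rightarrow>
         (let D = filter (\<lambda>t. \<not> has n t \<and> \<not> has (- n) t) ts; g = (n, padd (snd d) (snd a))
          in if f = edge_opp e \<and> fst e = n \<and> fresh n ([a, b, c, d] # D) \<and> list_all (\<lambda>t. length t = 3) D \<and>
               ear_ok c d [a, b] \<and> ear_ok d a [b, c]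
             then Some ([d, a, edge_opp g] # [g, b, c] # D) else None)
     | _ \<Rightarrow> None)
   | _ \<Rightarrow> None)"

fun steps :: "('a \<Rightarrow> 's \<Rightarrow> 's option) \<Rightarrow> 'a list \<Rightarrow> 's \<Rightarrow> 's option" where
  "steps f [] s = Some s"
| "steps f (x # xs) s = (case f x s of None \<Rightarrow> None | Some t \<Rightarrow> steps f xs t)"

text \<open>A face is a list up to rotation; beginning at the smallest label gives a normal form,
  and faces can be compared as lists.\<close>

definition norm_tri :: "edge list \<Rightarrow> edge list" where
  "norm_tri t = (case t of [x, y, z] \<Rightarrow> rot_to (min (fst x) (min (fst y) (fst z))) t | _ \<Rightarrow> t)"

definition same :: "edge list list \<Rightarrow> edge list list \<Rightarrow> bool" where
  "same ts us \<longleftrightarrow> distinct (map norm_tri ts) \<and> distinct (map norm_tri us) \<and>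
     set (map norm_tri ts) = set (map norm_tri us)"

text \<open>Position \<open>l - 1\<close> of the table holds the image of the positive label
  \<open>l\<close>; the sign makes reversed edges go to reversed edges.\<close>

definition lab :: "int list \<Rightarrow> int \<Rightarrow> int" where
  "lab tab l = sgn l * tab ! nat (\<bar>l\<bar> - 1)"

fun mapply :: "point \<times> point \<Rightarrow> point \<Rightarrow> point" where
  "mapply ((a, b), (c, d)) (x, y) = (cadd (cmul a x) (cmul b y), cadd (cmul c x) (cmul d y))"

fun mat_of :: "point \<times> point \<Rightarrow> real^2^2" where
  "mat_of ((a, b), (c, d)) = vector [vector [val a, val b], vector [val c, val d]]"

definition relabel :: "int list \<Rightarrow> point \<times> point \<Rightarrow> edge \<Rightarrow> edge" where
  "relabel tab M e = (lab tab (fst e), mapply M (snd e))"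

text \<open>
  The triangulation obtained from \<open>ts\<close> by flipping the edges \<open>ns\<close> is the image of \<open>ts\<close> under the
  matrix \<open>M\<close> with edges renamed by \<open>tab\<close>; the inverse table \<open>tab'\<close> witnesses that \<open>tab\<close> is injective.
\<close>

definition self_map_ok :: "edge list list \<Rightarrow> int list \<Rightarrow> int list \<Rightarrow> int list \<Rightarrow> point \<times> point \<Rightarrow> bool" where
  "self_map_ok ts ns tab tab' M \<longleftrightarrow>
     ccross (fst M) (snd M) = (1, 0, 0) \<and>
     list_all (list_all (\<lambda>e. lab tab' (lab tab (fst e)) = fst e)) ts \<and>
     (case steps flip ns ts of None \<Rightarrow> False
      | Some us \<Rightarrow> same us (map (map (relabel tab M)) ts))"

text \<open>Counterclockwise from the corner 0: bottom segments, right side, top segments backwards,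
  left side. The unlabelled sides of the three parallelograms get the labels 7, 8 and 9, and
  subdivision points count as vertices.\<close>

definition big_poly :: "edge list" where
  "big_poly =
    [(3, (3,2,1), (2,2,0)), (2, (0,1,0), (-1,2,1)), (6, (1,0,1), (2,-2,0)), (5, (0,1,0), (-1,2,1)),
     (7, (1,0,-1), (2,-2,0)),
     (-1, (-3,-2,-1), (-2,-2,0)), (-5, (0,-1,0), (1,-2,-1)), (-4, (-1,0,-1), (-2,2,0)), (-2, (0,-1,0), (1,-2,-1)),
     (-7, (-1,0,1), (-2,2,0))]"

definition medium_poly :: "edge list" where
  "medium_poly =
    [(4, (1,0,1), (2,-2,0)), (8, (1,-1,0), (0,0,2)), (-6, (-1,0,-1), (-2,2,0)), (-8, (-1,1,0), (0,0,-2))]"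

definition small_poly :: "edge list" where
  "small_poly =
    [(1, (3,2,1), (2,2,0)), (9, (1,1,2), (0,4,-2)), (-3, (-3,-2,-1), (-2,-2,0)), (-9, (-1,-1,-2), (0,-4,2))]"

text \<open>Nine ears cut polygons with 10, 4 and 4 sides into 8 + 2 + 2 triangles, with edges
  labelled 1 to 18. Each ear joins two transverse sides, as collinear segments would fail the strict
  test in \<open>ear_ok\<close>. The six flips lead to the triangulation on which both matrices are
  certified.\<close>

definition triangulation :: "edge list list option" where
  "triangulation =
     Option.bind (steps ear [(8, 10), (-2, 11), (9, 12), (-4, 13), (-5, 14), (-1, 15), (15, 16), (5, 17), (6, 18)]
        [big_poly, medium_poly, small_poly])
     (steps flip [15, 1, 3, 15, 10, 7])"

text \<open>
  The flips were found by following the Delaunay triangulations along the Teichmueller geodesics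
  from the surface to its images under the two matrices.
\<close>

lemma certificate:
  "case triangulation of None \<Rightarrow> False | Some ts \<Rightarrow>
     self_map_ok ts [16, 18, 15, 9, 15, 9, 1, 14, 13, 12, 13, 18, 3, 15, 10, 6, 18, 4, 13, 10, 8, 7, 17, 5, 13, 10, 17, 11, 2, 18, 10, 11, 7]
      [-10, -14, -13, 4, -16, 6, -15, -12, 18, -8, -3, 9, -5, 17, -7, -11, 1, 2]
      [17, 18, -11, 4, -13, 6, -15, -10, 12, -1, -16, -8, -3, -2, -7, -5, 14, 9]
      (((0, 1, 0), (0, 0, 0)), ((0, 0, 0), (1, 1, 1))) \<and>
     self_map_ok ts [12, 16, 14, 6, 4, 9, 10, 18, 13, 3, 1, 5, 2, 12, 15, 6, 4, 18, 13, 8, 17, 11, 7, 9, 3, 1, 15, 5, 2, 17, 11, 7, 18, 13, 10, 5, 2]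
      [13, 14, -18, -6, 16, -4, 7, -10, 12, 9, -5, -8, 17, 1, -15, 3, 2, 11]
      [14, 17, 16, -6, -11, -4, 7, -12, 10, -8, 18, 9, 1, 2, -15, 5, 13, -3]
      (((-41, -35, -23), (53, 45, 29)), ((-40, -34, -22), (52, 43, 28)))"
  by code_simp

section \<open>Soundness of the executable checks\<close>

lemma rot_to_rotation: "rotation_of xs (rot_to n xs)"
  unfolding rotation_of_def rot_to_def
  by (metis takeWhile_dropWhile_id)

lemma has_iff: "has n xs \<longleftrightarrow> n \<in> fst ` set xs"
  by (force simp: has_def list_ex_iff)

lemma fresh_iff: "fresh n ts \<longleftrightarrow> n \<noteq> 0 \<and> (\<forall>t\<in>set ts. \<forall>e\<in>set t. fst e \<noteq> n \<and> fst e \<noteq> - n)"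
  by (simp add: fresh_def list_all_iff)

lemma snd_sides_starts: "snd ` sides (pt p) es = pt ` set (starts p es)"
proof (induction p es rule: starts.induct)
  case (2 p e es)
  have "pt p + edge_vec e = pt (padd p (snd e))"
    by (simp add: edge_vec_def)
  then show ?case
    using 2 by simp
qed simp

text \<open>Beyond the diagonal there is a single vertex, the end of \<open>x\<close>. So
  \<open>u\<close> is this vertex, \<open>X - u\<close> is the vector of \<open>y\<close>, and the
  condition at the far end of the diagonal becomes a sign condition on \<open>snd y\<close>.\<close>

lemma chord_of_ear_ok:
  assumes "ear_ok x y ys"
  shows "chord (total [x, y]) (snd ` sides 0 [x, y] - {0}) (snd ` sides (total [x, y]) ys - {total [x, y]})"
proof -
  define X where "X = padd (snd x) (snd y)"
  have X: "total [x, y] = pt X"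
    by (simp add: X_def edge_vec_def)
  have ys: "ys \<noteq> []" and xy: "cross (edge_vec x) (edge_vec y) > 0"
    using assms cpos_sound by (auto simp: ear_ok_def Let_def edge_vec_def simp flip: val_ccross)
  have p: "cross (pt X) (pt p) > 0 \<and> cross (edge_vec x) (pt p) \<ge> 0 \<and>
      cross (edge_vec y) (pt p - edge_vec x) \<ge> 0" if "p \<in> set (tl (starts X ys))" for p
  proof -
    have "cpos (ccross X p)" "cnonneg (ccross (snd x) p)" "cnonneg (ccross (snd y) (padd p (pneg (snd x))))"
      using assms that unfolding ear_ok_def Let_def X_def list_all_iff by blast+
    from cpos_sound[OF this(1)] cnonneg_sound[OF this(2)] cnonneg_sound[OF this(3)] show ?thesis
      by (simp add: val_ccross edge_vec_def)
  qed
  have "starts X ys = X # tl (starts X ys)"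
    using ys by (cases ys) auto
  then have "set (starts X ys) = insert X (set (tl (starts X ys)))"
    by (metis list.simps(15))
  then have S2: "snd ` sides (total [x, y]) ys - {total [x, y]} \<subseteq> pt ` set (tl (starts X ys))"
    unfolding X snd_sides_starts by auto
  have S1: "snd ` sides 0 [x, y] - {0} \<subseteq> {edge_vec x}"
    by auto
  have tot: "pt X = edge_vec x + edge_vec y"
    using X by simp
  show ?thesis
  proof
    fix u assume "u \<in> snd ` sides 0 [x, y] - {0}"
    then have u: "u = edge_vec x"
      using S1 by blast
    show "cross (total [x, y]) u < 0"
      using xy cross_swap[of "edge_vec y" "edge_vec x"] by (simp add: u cross_simps)
    fix v assume "v \<in> snd ` sides (total [x, y]) ys - {total [x, y]}"
    then obtain p where v: "v = pt p" "p \<in> set (tl (starts X ys))"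
      using S2 by blast
    show "cross u v \<ge> 0" "cross (v - u) (total [x, y] - u) \<le> 0"
      using p[OF v(2)] cross_swap[of "v - u" "edge_vec y"] by (simp_all add: u v)
  next
    fix v assume "v \<in> snd ` sides (total [x, y]) ys - {total [x, y]}"
    then obtain p where v: "v = pt p" "p \<in> set (tl (starts X ys))"
      using S2 by blast
    show "cross (total [x, y]) v > 0"
      using p[OF v(2)] unfolding X v by blast
  qed
qed

lemma iso_ear:
  assumes C: "closed_up (insert (x # y # ys) D)" and ok: "ear_ok x y ys"
    and e: "edge_vec e = edge_vec x + edge_vec y" "fst e = m" "m \<noteq> 0"
    and fresh: "\<And>zs d. zs \<in> insert (x # y # ys) D \<Longrightarrow> d \<in> set zs \<Longrightarrow> fst d \<noteq> m \<and> fst d \<noteq> - m"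
    and D: "x # y # ys \<notin> D"
  shows "iso (insert (x # y # ys) D) (insert [x, y, edge_opp e] (insert (e # ys) D))"
    "closed_up (insert [x, y, edge_opp e] (insert (e # ys) D))"
proof -
  have 1: "edge_opp e \<noteq> e"
    using e(2,3) by (auto simp: edge_opp_def prod_eq_iff)
  have 2: "d \<noteq> e \<and> d \<noteq> edge_opp e" if "zs \<in> insert (x # y # ys) D" "d \<in> set zs" for zs d
    using fresh[OF that] e(2) by (auto simp: edge_opp_def)
  have 3: "ys \<noteq> []"
    using ok by (auto simp: ear_ok_def Let_def)
  show "iso (insert (x # y # ys) D) (insert [x, y, edge_opp e] (insert (e # ys) D))"
    "closed_up (insert [x, y, edge_opp e] (insert (e # ys) D))"
    using iso_cut[of "[x, y]" ys D e] chord_of_ear_ok[OF ok] C e(1) 1 2 3 D by auto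
qed

lemma ear_sound:
  assumes "ear nm ts = Some us" and C: "closed_up (set ts)"
  shows "iso (set ts) (set us)" "closed_up (set us)"
proof -
  obtain n m where nm: "nm = (n, m)"
    by (rule prod.exhaust)
  obtain t where t: "filter (has n) ts = [t]"
    using assms(1) unfolding ear_def nm by (auto split: list.splits)
  obtain x y ys where xy: "rot_to n t = x # y # ys"
    using assms(1) t unfolding ear_def nm by (auto split: list.splits)
  define D where "D = filter (\<lambda>t. \<not> has n t) ts"
  define e where "e = (m, padd (snd x) (snd y))"
  have ok: "fresh m (t # D)" "ear_ok x y ys" and us: "us = [x, y, edge_opp e] # (e # ys) # D"
    using assms(1) t xy unfolding ear_def nm D_def e_def by (auto simp: Let_def split: if_splits)
  have "set (filter (has n) ts) = {t}"
    using t by simp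
  then have ts: "set ts = insert t (set D)" and ht: "has n t"
    unfolding D_def by auto
  \<comment> \<open>Rotates the chosen polygon so that the ear comes first and fixes the others;
    this does not change the surface.\<close>
  define r where "r s = (if s = t then x # y # ys else s)" for s
  have rot: "rotation_of t (x # y # ys)"
    using rot_to_rotation[of t n] xy by simp
  have new: "x # y # ys \<notin> set D"
    using ht rotation_of_set[OF rot] unfolding D_def has_iff by auto
  have old: "t \<notin> set D"
    using ht by (simp add: D_def)
  have r: "r ` set ts = insert (x # y # ys) (set D)"
    unfolding ts using old by (auto simp: r_def)
  have inj: "inj_on r (set ts)"
    unfolding ts using new old by (auto simp: r_def inj_on_def)
  have rr: "rotation_of s (r s)" for s
    using rot rotation_of_refl by (auto simp: r_def)
  note 1 = iso_rotations[OF C inj rr, unfolded r]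
  have "set (x # y # ys) = set t"
    using rotation_of_set[OF rot] .
  then have fr: "fst d \<noteq> m \<and> fst d \<noteq> - m" if "zs \<in> insert (x # y # ys) (set D)" "d \<in> set zs" for zs d
    using ok(1) that unfolding fresh_iff by auto
  have 2: "iso (insert (x # y # ys) (set D)) (insert [x, y, edge_opp e] (insert (e # ys) (set D)))"
    "closed_up (insert [x, y, edge_opp e] (insert (e # ys) (set D)))"
  proof -
    have e: "edge_vec e = edge_vec x + edge_vec y" "fst e = m" and m: "m \<noteq> 0"
      using ok(1) by (simp_all add: e_def edge_vec_def fresh_iff)
    show "iso (insert (x # y # ys) (set D)) (insert [x, y, edge_opp e] (insert (e # ys) (set D)))"
      "closed_up (insert [x, y, edge_opp e] (insert (e # ys) (set D)))"
      by (rule iso_ear(1)[OF 1(2) ok(2) e m fr new], assumption+)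
        (rule iso_ear(2)[OF 1(2) ok(2) e m fr new], assumption+)
  qed
  show "iso (set ts) (set us)"
    using iso_trans[OF 1(1) 2(1)] by (simp add: us)
  show "closed_up (set us)"
    using 2(2) by (simp add: us)
qed

text \<open>The cut of the quadrilateral along \<open>e\<close> is undone, then it is cut along
  \<open>g\<close>. As a cut takes off the first two sides of the list, the quadrilateral is rotated
  by one side in between.\<close>

lemma flip_sound:
  assumes "flip n ts = Some us" and C: "closed_up (set ts)"
  shows "iso (set ts) (set us)" "closed_up (set us)"
proof -
  obtain t1 where t1: "filter (has n) ts = [t1]"
    using assms(1) unfolding flip_def by (auto split: list.splits)
  obtain t2 where t2: "filter (has (- n)) ts = [t2]"
    using assms(1) t1 unfolding flip_def by (auto split: list.splits)
  obtain e a b where eab: "rot_to n t1 = [e, a, b]"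
    using assms(1) t1 t2 unfolding flip_def by (auto split: list.splits)
  obtain f c d where fcd: "rot_to (- n) t2 = [f, c, d]"
    using assms(1) t1 t2 eab unfolding flip_def by (auto split: list.splits)
  define D where "D = filter (\<lambda>t. \<not> has n t \<and> \<not> has (- n) t) ts"
  define g where "g = (n, padd (snd d) (snd a))"
  have f: "f = edge_opp e" "fst e = n" and fresh: "fresh n ([a, b, c, d] # D)"
    and len: "list_all (\<lambda>t. length t = 3) D" and ok: "ear_ok c d [a, b]" "ear_ok d a [b, c]"
    and us: "us = [d, a, edge_opp g] # [g, b, c] # D"
    using assms(1) t1 t2 eab fcd unfolding flip_def D_def g_def by (auto simp: Let_def split: if_splits)
  have n0: "n \<noteq> 0"
    using fresh by (simp add: fresh_iff)
  have fr: "fst z \<noteq> n \<and> fst z \<noteq> - n" if "z \<in> {a, b, c, d} \<or> (\<exists>t\<in>set D. z \<in> set t)" for z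
    using fresh that unfolding fresh_iff by auto
  have "set (filter (has n) ts) = {t1}" "set (filter (has (- n)) ts) = {t2}"
    using t1 t2 by simp_all
  then have ts: "set ts = insert t1 (insert t2 (set D))" and ht: "has n t1" "has (- n) t2"
    unfolding D_def by auto
  have rot1: "rotation_of t1 [e, a, b]" and rot2': "rotation_of t2 [f, c, d]"
    using rot_to_rotation[of t1 n] rot_to_rotation[of t2 "- n"] eab fcd by simp_all
  have "rotation_of [f, c, d] [c, d, f]"
    unfolding rotation_of_def by (rule exI[of _ "[f]"]) simp
  then have rot2: "rotation_of t2 [c, d, f]"
    using rot2' rotation_of_trans by blast
  \<comment> \<open>A triangle glued to itself along the edge would have a further side labelled
    \<open>- n\<close>, against freshness.\<close>
  have t12: "t1 \<noteq> t2"
  proof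
    assume "t1 = t2"
    then have "f \<in> set [e, a, b]"
      using rotation_of_set[OF rot1] rotation_of_set[OF rot2'] by auto
    then show False
      using fr[of a] fr[of b] f n0 by (auto simp: edge_opp_def prod_eq_iff)
  qed
  have old: "t1 \<notin> set D" "t2 \<notin> set D"
    using ht by (auto simp: D_def)
  have "e \<notin> set t" "f \<notin> set t" if "t \<in> set D" for t
    using fr[of e] fr[of f] f that by (auto simp: edge_opp_def)
  then have "[e, a, b] \<notin> set D" "[c, d, f] \<notin> set D"
    by (meson list.set_intros)+
  moreover have "[e, a, b] \<noteq> [c, d, f]"
    using fr[of c] f by auto
  ultimately have new: "[e, a, b] \<notin> set D" "[c, d, f] \<notin> set D" "[e, a, b] \<noteq> [c, d, f]"
    by auto
  define r where "r s = (if s = t1 then [e, a, b] else if s = t2 then [c, d, f] else s)" for s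
  have r: "r ` set ts = insert [c, d, f] (insert [e, a, b] (set D))"
    unfolding ts using old t12 by (auto simp: r_def)
  have inj: "inj_on r (set ts)"
    unfolding ts using new old t12 by (auto simp: r_def inj_on_def)
  have rr: "rotation_of s (r s)" for s
    using rot1 rot2 rotation_of_refl by (auto simp: r_def)
  note 1 = iso_rotations[OF C inj rr, unfolded r]
  have tot: "edge_vec a + edge_vec b = - edge_vec e" "edge_vec c + edge_vec d = edge_vec e"
  proof -
    have "edge_vec e + (edge_vec a + edge_vec b) = 0" "(edge_vec c + edge_vec d) - edge_vec e = 0"
      using 1(2) f by (auto simp: closed_up_def vec_opp add.assoc add_diff_eq)
    then show "edge_vec a + edge_vec b = - edge_vec e" "edge_vec c + edge_vec d = edge_vec e"
      by (simp_all add: add_eq_0_iff)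
  qed
  have "(edge_vec c + edge_vec d) + (edge_vec a + edge_vec b) = 0"
    unfolding tot by simp
  then have "total [c, d, a, b] = 0" "total [d, a, b, c] = 0"
    by (simp_all add: ac_simps)
  then have Q: "closed_up (insert [c, d, a, b] (set D))" "closed_up (insert [d, a, b, c] (set D))"
    using 1(2) by (auto simp: closed_up_def)
  have lenD: "[c, d, a, b] \<notin> set D" "[d, a, b, c] \<notin> set D"
    using len by (auto simp: list_all_iff)
  have fr1: "fst z \<noteq> n \<and> fst z \<noteq> - n" if "zs \<in> insert [c, d, a, b] (set D)" "z \<in> set zs" for zs z
    using fr[of z] that by auto
  have fr2: "fst z \<noteq> n \<and> fst z \<noteq> - n" if "zs \<in> insert [d, a, b, c] (set D)" "z \<in> set zs" for zs z
    using fr[of z] that by auto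
  have g: "edge_vec g = edge_vec d + edge_vec a" "fst g = n"
    by (simp_all add: g_def edge_vec_def)
  have 2: "iso (insert [c, d, a, b] (set D)) (insert [c, d, edge_opp e] (insert [e, a, b] (set D)))"
    by (rule iso_ear(1)[OF Q(1) ok(1) tot(2)[symmetric] f(2) n0 fr1 lenD(1)])
  define q where "q s = (if s = [c, d, a, b] then [d, a, b, c] else s)" for s
  have q: "q ` insert [c, d, a, b] (set D) = insert [d, a, b, c] (set D)"
    using lenD by (auto simp: q_def)
  have "rotation_of [c, d, a, b] [d, a, b, c]"
    unfolding rotation_of_def by (rule exI[of _ "[c]"]) simp
  then have "rotation_of s (q s)" for s
    using rotation_of_refl by (auto simp: q_def)
  moreover have "inj_on q (insert [c, d, a, b] (set D))"
    using lenD by (auto simp: q_def inj_on_def)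
  ultimately have 3: "iso (insert [c, d, a, b] (set D)) (insert [d, a, b, c] (set D))"
    using iso_rotations(1)[OF Q(1)] q by metis
  have 4: "iso (insert [d, a, b, c] (set D)) (insert [d, a, edge_opp g] (insert [g, b, c] (set D)))"
    "closed_up (insert [d, a, edge_opp g] (insert [g, b, c] (set D)))"
    by (rule iso_ear(1)[OF Q(2) ok(2) g n0 fr2 lenD(2)], assumption+)
      (rule iso_ear(2)[OF Q(2) ok(2) g n0 fr2 lenD(2)], assumption+)
  have "iso (set ts) (insert [d, a, b, c] (set D))"
    using iso_trans[OF 1(1)] iso_trans[OF iso_sym[OF 2] 3] f(1) by simp
  then show "iso (set ts) (set us)"
    using iso_trans 4(1) by (simp add: us)
  show "closed_up (set us)"
    using 4(2) by (simp add: us)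
qed

lemma steps_sound:
  assumes "steps f xs ts = Some us" "closed_up (set ts)"
    and "\<And>x ts us. f x ts = Some us \<Longrightarrow> closed_up (set ts) \<Longrightarrow> iso (set ts) (set us) \<and> closed_up (set us)"
  shows "iso (set ts) (set us) \<and> closed_up (set us)"
  using assms(1,2)
proof (induction xs arbitrary: ts)
  case Nil
  then show ?case
    using iso_refl by (metis option.inject steps.simps(1))
next
  case (Cons x xs)
  then obtain vs where "f x ts = Some vs" "steps f xs vs = Some us"
    by (auto split: option.splits)
  then show ?case
    using Cons assms(3) iso_trans by metis
qed

lemma norm_tri_rotation: "rotation_of t (norm_tri t)"
  using rot_to_rotation rotation_of_refl by (auto simp: norm_tri_def split: list.splits)

lemma same_sound:
  assumes "same ts us" "closed_up (set ts)" "closed_up (set us)"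
  shows "iso (set ts) (set us)"
proof -
  have "inj_on norm_tri (set ts)" "inj_on norm_tri (set us)" "norm_tri ` set ts = norm_tri ` set us"
    using assms(1) by (auto simp: same_def distinct_map)
  then show ?thesis
    using iso_rotations(1)[OF assms(2)] iso_rotations(1)[OF assms(3)] norm_tri_rotation iso_sym iso_trans
    by metis
qed

lemma pt_mapply: "pt (mapply M p) = mat_of M *v pt p"
  by (induction M p rule: mapply.induct)
    (simp add: vec_eq_iff forall_2 matrix_vector_mult_def sum_2)

lemma lab_uminus: "lab tab (- l) = - lab tab l"
  by (simp add: lab_def sgn_minus)

text \<open>The matrix leads from the triangulation to its relabelled image, which up to rotations
  is the flipped triangulation. Undoing the flips by translation equivalences returns to the start
  with derivative \<open>mat_of M\<close>. Opposite edges are recognised from their labels and the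
  invertibility of the matrix.\<close>

lemma self_map_sound:
  assumes ok: "self_map_ok ts ns tab tab' M" and C: "closed_up (set ts)"
  shows "\<exists>f. affine_iso (surf (set ts)) (surf (set ts)) f (mat_of M)" "det (mat_of M) = 1"
proof -
  obtain us where us: "steps flip ns ts = Some us" and same: "same us (map (map (relabel tab M)) ts)"
    using ok by (auto simp: self_map_ok_def split: option.splits)
  have u: "iso (set ts) (set us)" "closed_up (set us)"
    using steps_sound[OF us C] flip_sound by blast+
  obtain p q where M: "M = (p, q)"
    by (rule prod.exhaust)
  show det: "det (mat_of M) = 1"
  proof -
    have "det (mat_of M) = val (ccross p q)"
      unfolding M by (induction p q rule: ccross.induct) (simp add: det_2)
    also have "ccross p q = (1, 0, 0)"
      using ok by (simp add: self_map_ok_def M)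
    finally show ?thesis
      by (simp add: val.simps)
  qed
  then have inv: "invertible (mat_of M)"
    by (simp add: invertible_det_nz)
  have vec: "edge_vec (relabel tab M e) = mat_of M *v edge_vec e" for e
    by (simp add: edge_vec_def relabel_def pt_mapply)
  have labinj: "l' = l" if "lab tab' (lab tab l) = l" "lab tab' (lab tab l') = l'" "lab tab l' = lab tab l" for l l'
    using that by metis
  have lab: "lab tab' (lab tab (fst e)) = fst e" if "e \<in> \<Union> (set ` set ts)" for e
    using ok that by (auto simp: self_map_ok_def list_all_iff)
  have inj: "e' = e" if "edge_vec (relabel tab M e') = edge_vec (relabel tab M e)" "fst e' = fst e" for e e'
  proof -
    have "edge_vec e' = edge_vec e"
      using that(1) inv unfolding vec by (metis inj_matrix_vector_mult injD)
    then show ?thesis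
      using that(2) by (simp add: edge_vec_def pt_inject prod_eq_iff)
  qed
  have opp: "relabel tab M (edge_opp e) = edge_opp (relabel tab M e)" for e
  proof -
    have "pt (mapply M (pneg (snd e))) = pt (pneg (mapply M (snd e)))"
      by (simp add: pt_mapply linear_neg[OF matrix_vector_mul_linear])
    then have "mapply M (pneg (snd e)) = pneg (mapply M (snd e))"
      by (simp only: pt_inject)
    then show ?thesis
      by (simp add: relabel_def edge_opp_def lab_uminus)
  qed
  have opp_iff: "relabel tab M e' = edge_opp (relabel tab M e) \<longleftrightarrow> e' = edge_opp e"
    if e: "e \<in> \<Union> (set ` set ts)" "e' \<in> \<Union> (set ` set ts)" for e e'
  proof
    assume eq: "relabel tab M e' = edge_opp (relabel tab M e)"
    then have "lab tab (fst e') = lab tab (- fst e)"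
      by (simp add: relabel_def edge_opp_def lab_uminus)
    moreover have "lab tab' (lab tab (- fst e)) = - fst e"
      using lab[OF e(1)] by (simp add: lab_uminus)
    ultimately have "fst e' = fst (edge_opp e)"
      using lab[OF e(2)] by (simp add: edge_opp_def)
    then show "e' = edge_opp e"
      using eq opp inj by metis
  qed (simp add: opp)
  have map_inj: "inj_on (map (relabel tab M)) (set ts)"
  proof -
    have "inj_on (relabel tab M) (\<Union> (set ` set ts))"
    proof (rule inj_onI)
      fix e e' assume e: "e \<in> \<Union> (set ` set ts)" "e' \<in> \<Union> (set ` set ts)" and eq: "relabel tab M e = relabel tab M e'"
      then have "fst e = fst e'"
        using lab by (metis fst_conv relabel_def)
      then show "e = e'"
        using inj eq by metis
    qed
    then have "inj_on (relabel tab M) (set xs \<union> set ys)" if "xs \<in> set ts" "ys \<in> set ts" for xs ys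
      using that by (elim inj_on_subset) auto
    then show ?thesis
      by (intro inj_onI) (rule map_inj_on)
  qed
  have sides: "sides p (map (relabel tab M) xs) = (\<lambda>(e, a). (relabel tab M e, mat_of M *v a + 0)) ` sides q xs"
    if "p = mat_of M *v q" for xs p q
    using that
  proof (induction xs arbitrary: p q)
    case (Cons x xs)
    then have "p + mat_of M *v edge_vec x = mat_of M *v (q + edge_vec x)"
      by (simp add: matrix_vector_right_distrib)
    from Cons.IH[OF this] show ?case
      using Cons.prems by (simp add: vec)
  qed simp
  have total: "total (map (relabel tab M) xs) = mat_of M *v total xs" for xs
    by (induction xs) (simp_all add: vec matrix_vector_right_distrib)
  have img: "set (map (map (relabel tab M)) ts) = map (relabel tab M) ` set ts"
    by simp
  have "\<exists>f. affine_iso (surf (set ts)) (surf (map (relabel tab M) ` set ts)) f (mat_of M)"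
    by (rule affine_iso_relabel[OF C inv map_inj, where \<sigma> = "relabel tab M" and t = "\<lambda>_. 0"])
      (intro sides vec opp_iff; simp)+
  then obtain f where f: "affine_iso (surf (set ts)) (surf (map (relabel tab M) ` set ts)) f (mat_of M)"
    by blast
  have "closed_up (map (relabel tab M) ` set ts)"
    using C total by (auto simp: closed_up_def)
  then have "iso (set us) (map (relabel tab M) ` set ts)"
    using same_sound[OF same u(2)] unfolding img by blast
  then have "iso (map (relabel tab M) ` set ts) (set ts)"
    using u(1) iso_trans iso_sym by blast
  then obtain g where g: "affine_iso (surf (map (relabel tab M) ` set ts)) (surf (set ts)) g (mat 1)"
    by (auto simp: iso_def)
  show "\<exists>f. affine_iso (surf (set ts)) (surf (set ts)) f (mat_of M)"
    using affine_iso_compose[OF f g] by auto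
qed

section \<open>The degree of the expansion factor\<close>

text \<open>The norm form of \<open>\<rat>(\<alpha>)\<close>: the determinant of multiplication by \<open>a + b \<alpha> + c \<alpha>\<^sup>2\<close>.\<close>

definition rnorm :: "rat \<Rightarrow> rat \<Rightarrow> rat \<Rightarrow> rat" where
  "rnorm a b c = a * ((a - c) * (a - b) - (b - c) * (2 * c - b)) - b * (c * (a - b) - (b - c) * (b - c))
     + c * (c * (2 * c - b) - (a - c) * (b - c))"

definition rval :: "rat \<Rightarrow> rat \<Rightarrow> rat \<Rightarrow> real" where
  "rval a b c = of_rat a + of_rat b * ay_alpha + of_rat c * ay_alpha^2"

lemma rval_inject: "rval a b c = rval d e f \<longleftrightarrow> a = d \<and> b = e \<and> c = f"
proof -
  have "rval a b c = rval d e f \<longleftrightarrow> rval (a - d) (b - e) (c - f) = 0"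
    by (simp add: rval_def of_rat_diff algebra_simps)
  then show ?thesis
    using ay_alpha_independent[of "a - d" "b - e" "c - f"] by (auto simp: rval_def)
qed

lemma rval_mult: "rval a b c * rval d e f =
    rval (a * d + (b * f + c * e) - c * f) (a * e + b * d - (b * f + c * e) + 2 * (c * f))
      (a * f + b * e + c * d - (b * f + c * e))"
  unfolding rval_def using ay_alpha_root
  by (simp only: of_rat_add of_rat_diff of_rat_mult of_rat_numeral_eq) algebra

text \<open>Multiplicativity of the determinant, as a polynomial identity in six variables.\<close>

lemma rnorm_mult:
  "rnorm (a * d + (b * f + c * e) - c * f) (a * e + b * d - (b * f + c * e) + 2 * (c * f))
      (a * f + b * e + c * d - (b * f + c * e)) = rnorm a b c * rnorm d e f"
  unfolding rnorm_def by algebra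

text \<open>The norm is the element times the product of its other conjugates, which has again
  rational coordinates. If the norm is zero, one of the two factors is zero.\<close>

lemma rnorm_eq_0:
  assumes "rnorm a b c = 0"
  shows "a = 0 \<and> b = 0 \<and> c = 0"
proof -
  \<comment> \<open>\<open>A + B \<alpha> + C \<alpha>\<^sup>2\<close> is the product of the two other conjugates of \<open>a + b \<alpha> + c \<alpha>\<^sup>2\<close>\<close>
  define A where "A = (a - c) * (a - b) - (b - c) * (2 * c - b)"
  define B where "B = c * (2 * c - b) - b * (a - b)"
  define C where "C = b * (b - c) - c * (a - c)"
  have "rval a b c * rval A B C = rval (rnorm a b c) 0 0"
    unfolding rval_mult rval_inject A_def B_def C_def rnorm_def by (intro conjI) algebra+
  then have "rval a b c = 0 \<or> rval A B C = 0"
    using assms by (simp add: rval_def)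
  moreover have "a = 0 \<and> b = 0 \<and> c = 0" if "rval A B C = 0"
  proof -
    have ABC: "A = 0" "B = 0" "C = 0"
      using that ay_alpha_independent unfolding rval_def by blast+
    have "c = 0"
    proof (rule ccontr)
      assume c: "c \<noteq> 0"
      \<comment> \<open>The same quotient as in the independence proof: \<open>C = 0\<close> and
        \<open>B = 0\<close> make it a rational root of the cubic.\<close>
      define r where "r = (b - c) / c"
      have b: "b = c * (r + 1)"
        using c by (simp add: r_def field_simps)
      have "c * (a - c) = c * (r * b)"
        using ABC(3) c by (simp add: C_def r_def mult.commute)
      then have "a - c = r * b"
        using c by simp
      then have a: "a = c * (r^2 + r + 1)"
        using b by algebra
      have "c^2 * (r^3 + r^2 + r - 1) = 0"
        using ABC(2) unfolding B_def a b by algebra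
      then show False
        using c no_rational_root[of r] by simp
    qed
    then show ?thesis
      using ABC by (auto simp: A_def C_def)
  qed
  ultimately show ?thesis
    using ay_alpha_independent unfolding rval_def by blast
qed

text \<open>A rational square root of an integer is an integer, and 976 lies strictly between 31^2
  and 32^2.\<close>

lemma not_rational_square_976: "(r :: rat)^2 \<noteq> 976"
proof
  assume r: "r^2 = 976"
  obtain p q where pq: "quotient_of r = (p, q)"
    by (rule prod.exhaust)
  have q: "q > 0" and cop: "coprime p q" and rpq: "r = of_int p / of_int q"
    using pq quotient_of_denom_pos quotient_of_coprime quotient_of_div by blast+
  have "of_int (p^2) = (of_int (976 * q^2) :: rat)"
    using r q unfolding rpq by (simp add: field_simps)
  then have eq: "p^2 = 976 * q^2"
    by (simp only: of_int_eq_iff)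
  then have "q dvd p^2"
    by (simp add: power2_eq_square)
  moreover have "coprime q (p^2)"
    using cop by (simp add: coprime_commute)
  ultimately have "q = 1"
    using q by (metis abs_of_pos coprime_absorb_left zdvd1_eq)
  then have p: "\<bar>p\<bar>^2 = 976"
    using eq by simp
  have "\<bar>p\<bar> \<le> 31 \<or> \<bar>p\<bar> \<ge> 32"
    by linarith
  then show False
    using p power_mono[of "\<bar>p\<bar>" 31 2] power_mono[of 32 "\<bar>p\<bar>" 2] by auto
qed

text \<open>
  The discriminant \<open>t\<^sup>2 - 4\<close> of \<open>X\<^sup>2 - t X + 1\<close> has norm \<open>976\<close>, so it is not a square in \<open>\<rat>(\<alpha>)\<close>
  and \<open>\<lambda>\<close> is quadratic over the cubic field.
\<close>

lemma quadratic_over_cubic: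
  fixes l :: real
  assumes l: "l^2 - rval 11 8 5 * l + 1 = 0"
    and eq: "rval a b c + rval d e f * l = 0"
  shows "a = 0 \<and> b = 0 \<and> c = 0 \<and> d = 0 \<and> e = 0 \<and> f = 0"
proof -
  define t where "t = rval 11 8 5"
  have t2: "t * t - 4 = rval 172 146 94"
    unfolding t_def rval_mult by (simp add: rval_def)
  \<comment> \<open>With \<open>x = rval a b c\<close> and \<open>y = rval d e f\<close>, completing
    the square in \<open>x + y l = 0\<close> gives \<open>2 x + y t = - y (2 l - t)\<close>, where
    \<open>2 l - t\<close> is a square root of the discriminant.\<close>
  obtain u v w where uvw: "2 * rval a b c + rval d e f * t = rval u v w"
  proof -
    have "2 * rval a b c = rval (2 * a) (2 * b) (2 * c)"
      by (simp add: rval_def of_rat_mult algebra_simps)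
    moreover have "rval x y z + rval x' y' z' = rval (x + x') (y + y') (z + z')" for x y z x' y' z'
      by (simp add: rval_def of_rat_add algebra_simps)
    ultimately show thesis
      using that unfolding t_def rval_mult by metis
  qed
  have "rval u v w = - rval d e f * (2 * l - t)"
    unfolding uvw[symmetric] using eq by algebra
  then have "rval u v w * rval u v w = (rval d e f * rval d e f) * ((2 * l - t) * (2 * l - t))"
    by algebra
  also have "(2 * l - t) * (2 * l - t) = rval 172 146 94"
    using l unfolding t_def[symmetric] t2[symmetric] by algebra
  finally have "rval u v w * rval u v w = (rval d e f * rval d e f) * rval 172 146 94" .
  \<comment> \<open>Taking norms leaves an equation between rationals: a square equals 976 times a
    square.\<close>
  then have "rnorm u v w * rnorm u v w = (rnorm d e f * rnorm d e f) * rnorm 172 146 94"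
    unfolding rval_mult rval_inject by (metis rnorm_mult)
  also have "rnorm 172 146 94 = 976"
    by (simp add: rnorm_def)
  finally have n: "(rnorm u v w)^2 = 976 * (rnorm d e f)^2"
    by (simp add: power2_eq_square)
  have "rnorm d e f = 0"
  proof (rule ccontr)
    assume "rnorm d e f \<noteq> 0"
    then have "(rnorm u v w / rnorm d e f)^2 = 976"
      using n by (simp add: power_divide)
    then show False
      using not_rational_square_976 by blast
  qed
  then have def: "d = 0 \<and> e = 0 \<and> f = 0"
    by (rule rnorm_eq_0)
  then have "rval a b c = 0"
    using eq by (simp add: rval_def)
  then show ?thesis
    using def ay_alpha_independent unfolding rval_def by blast
qed

text \<open>Since \<open>t = l + 1 / l\<close>, the value of \<open>p\<close> at \<open>l\<close> is
  \<open>l^3\<close> times a cubic in \<open>t\<close>, whence its palindromic coefficients. A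
  polynomial of degree at most 5 takes a value \<open>x + y l\<close> with \<open>x\<close> and
  \<open>y\<close> in the cubic field; if it vanishes, six linear equations annihilate its six
  coefficients.\<close>

lemma degree_six:
  fixes l :: real
  assumes l: "l^2 - rval 11 8 5 * l + 1 = 0"
  shows "has_degree_over_rat l 6"
proof -
  define t where "t = rval 11 8 5"
  have t2: "t^2 = rval 176 146 94"
    unfolding t_def power2_eq_square rval_mult by (simp add: rval_def)
  have t3: "t^3 = rval 2948 2472 1600"
    unfolding power3_eq_cube power2_eq_square[symmetric] t2 unfolding t_def rval_mult by (simp add: rval_def)
  have l2: "l^2 = t * l - 1"
    using l by (simp add: t_def algebra_simps)
  \<comment> \<open>The characteristic polynomial of multiplication by \<open>t\<close> on the cubic
    field.\<close>
  have cubic: "t^3 - 20 * t^2 + 56 * t - 44 = 0"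
    unfolding t2 t3 by (simp add: t_def rval_def)
  define p :: "rat Polynomial.poly" where "p = [:1, -20, 59, -84, 59, -20, 1:]"
  have "Polynomial.poly (map_poly of_rat p) l = 0"
  proof -
    have "Polynomial.poly (map_poly of_rat p) l = l^6 - 20 * l^5 + 59 * l^4 - 84 * l^3 + 59 * l^2 - 20 * l + 1"
      by (simp add: p_def map_poly_pCons of_rat_minus algebra_simps eval_nat_numeral)
    also have "\<dots> = 0"
      using l2 cubic by algebra
    finally show ?thesis .
  qed
  moreover have "6 \<le> degree q" if q: "q \<noteq> 0" "Polynomial.poly (map_poly of_rat q) l = 0" for q :: "rat Polynomial.poly"
  proof (rule ccontr)
    assume "\<not> 6 \<le> degree q"
    then have deg: "degree q \<le> 5"
      by simp
    define c where "c = Polynomial.coeff q"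
    have "Polynomial.poly (map_poly of_rat q) l = (\<Sum>i\<le>5. of_rat (c i) * l^i)"
    proof -
      have "degree (map_poly of_rat q :: real Polynomial.poly) = degree q"
        by (intro degree_map_poly) auto
      then have "Polynomial.poly (map_poly of_rat q) l = (\<Sum>i\<le>degree q. of_rat (c i) * l^i)"
        by (simp add: poly_altdef coeff_map_poly c_def)
      also have "\<dots> = (\<Sum>i\<le>5. of_rat (c i) * l^i)"
        using deg by (intro sum.mono_neutral_left) (auto simp: c_def coeff_eq_0)
      finally show ?thesis .
    qed
    also have "\<dots> = of_rat (c 0) + of_rat (c 1) * l + of_rat (c 2) * l^2 + of_rat (c 3) * l^3
        + of_rat (c 4) * l^4 + of_rat (c 5) * l^5"
      by (simp add: eval_nat_numeral)
    \<comment> \<open>Powers of \<open>l\<close> are reduced by \<open>l^2 = t l - 1\<close>; the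
      fourth power of \<open>t\<close> that comes from \<open>l^5\<close> is removed by the
      cubic.\<close>
    also have "\<dots> = (of_rat (c 0) - of_rat (c 2) - of_rat (c 3) * t - of_rat (c 4) * (t^2 - 1)
          - of_rat (c 5) * (t^3 - 2 * t))
        + (of_rat (c 1) + of_rat (c 2) * t + of_rat (c 3) * (t^2 - 1) + of_rat (c 4) * (t^3 - 2 * t)
          + of_rat (c 5) * (20 * t^3 - 59 * t^2 + 44 * t + 1)) * l"
      using l2 cubic by algebra
    also have "\<dots> = rval (c 0 - c 2 - 11 * c 3 - 175 * c 4 - 2926 * c 5)
          (- 8 * c 3 - 146 * c 4 - 2456 * c 5) (- 5 * c 3 - 94 * c 4 - 1590 * c 5)
        + rval (c 1 + 11 * c 2 + 175 * c 3 + 2926 * c 4 + 49061 * c 5)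
          (8 * c 2 + 146 * c 3 + 2456 * c 4 + 41178 * c 5)
          (5 * c 2 + 94 * c 3 + 1590 * c 4 + 26674 * c 5) * l"
      unfolding t2 t3
      by (simp add: t_def rval_def of_rat_add of_rat_diff of_rat_mult of_rat_minus algebra_simps)
    finally have "rval (c 0 - c 2 - 11 * c 3 - 175 * c 4 - 2926 * c 5)
          (- 8 * c 3 - 146 * c 4 - 2456 * c 5) (- 5 * c 3 - 94 * c 4 - 1590 * c 5)
        + rval (c 1 + 11 * c 2 + 175 * c 3 + 2926 * c 4 + 49061 * c 5)
          (8 * c 2 + 146 * c 3 + 2456 * c 4 + 41178 * c 5)
          (5 * c 2 + 94 * c 3 + 1590 * c 4 + 26674 * c 5) * l = 0"
      using q(2) by simp
    from quadratic_over_cubic[OF l this]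
    have "c 0 = 0 \<and> c 1 = 0 \<and> c 2 = 0 \<and> c 3 = 0 \<and> c 4 = 0 \<and> c 5 = 0"
      by (elim conjE, intro conjI) linarith+
    then have "c i = 0" if "i \<le> 5" for i
      using that by (auto simp: le_Suc_eq numeral_eq_Suc)
    then have "Polynomial.coeff q i = 0" for i
      using deg by (cases "i \<le> 5") (auto simp: c_def coeff_eq_0)
    then show False
      using q(1) by (simp add: poly_eq_iff)
  qed
  moreover have "lead_coeff p = 1" and deg: "degree p = 6"
    by (simp_all add: p_def)
  ultimately have "is_minimal_polynomial p l"
    unfolding is_minimal_polynomial_def deg by blast
  with deg show ?thesis
    unfolding has_degree_over_rat_def by blast
qed

section \<open>The Arnoux-Yoccoz surface as a polygon gluing\<close>

definition ay_edge :: "nat \<Rightarrow> edge" where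
  "ay_edge i = (int i,
     if i \<in> {1, 3} then ((3, 2, 1), (2, 2, 0))
     else if i \<in> {2, 5} then ((0, 1, 0), (-1, 2, 1))
     else if i \<in> {4, 6} then ((1, 0, 1), (2, -2, 0))
     else if i = 7 then ((1, 0, -1), (2, -2, 0))
     else if i = 8 then ((1, -1, 0), (0, 0, 2))
     else ((1, 1, 2), (0, 4, -2)))"

fun ay_poly :: "ay_piece \<Rightarrow> edge list" where
  "ay_poly Big = big_poly"
| "ay_poly Medium = medium_poly"
| "ay_poly Small = small_poly"

text \<open>
  The side labelled \<open>i\<close> is the bottom segment \<open>i\<close> of \<open>lower i\<close> and the top segment \<open>i\<close> of \<open>upper i\<close>;
  the labels 7, 8, 9 stand for the right and left sides of the three parallelograms.
\<close>

definition lower :: "nat \<Rightarrow> ay_piece" where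
  "lower i = (if i \<in> {1, 9} then Small else if i \<in> {4, 8} then Medium else Big)"

definition upper :: "nat \<Rightarrow> ay_piece" where
  "upper i = (if i \<in> {3, 9} then Small else if i \<in> {6, 8} then Medium else Big)"

definition lower_start :: "nat \<Rightarrow> real^2" where
  "lower_start i = (if i \<le> 6 then ay_offset i (ay_bottom (lower i)) else ay_w (lower i))"

definition upper_start :: "nat \<Rightarrow> real^2" where
  "upper_start i = (if i \<le> 6 then ay_tau (upper i) + ay_offset i (ay_top (upper i)) else 0)"

lemma ay_g_simps: "ay_g (Suc 0) = ay_g 3" "ay_g 5 = ay_g 2" "ay_g 6 = ay_g 4"
  by (simp_all add: ay_g_def Let_def)

lemma vec_ay_edge:
  "edge_vec (ay_edge (Suc 0)) = ay_g 3" "edge_vec (ay_edge 2) = ay_g 2" "edge_vec (ay_edge 3) = ay_g 3"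
  "edge_vec (ay_edge 4) = ay_g 4" "edge_vec (ay_edge 5) = ay_g 2" "edge_vec (ay_edge 6) = ay_g 4"
  "edge_vec (ay_edge 7) = ay_tau Big" "edge_vec (ay_edge 8) = ay_tau Medium"
  "edge_vec (ay_edge 9) = ay_tau Small"
  by (simp_all add: edge_vec_def ay_edge_def ay_g_def Let_def val.simps vec_eq_iff forall_2)

lemma ay_poly_edges:
  "big_poly = [ay_edge 3, ay_edge 2, ay_edge 6, ay_edge 5, ay_edge 7, edge_opp (ay_edge 1),
     edge_opp (ay_edge 5), edge_opp (ay_edge 4), edge_opp (ay_edge 2), edge_opp (ay_edge 7)]"
  "medium_poly = [ay_edge 4, ay_edge 8, edge_opp (ay_edge 6), edge_opp (ay_edge 8)]"
  "small_poly = [ay_edge 1, ay_edge 9, edge_opp (ay_edge 3), edge_opp (ay_edge 9)]"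
  by (simp_all add: big_poly_def medium_poly_def small_poly_def ay_edge_def edge_opp_def)

text \<open>A positive half-edge starts where its bottom segment or right side starts. A reversed
  one starts at the far end of the top segment or left side, which accounts for the added
  \<open>edge_vec\<close>.\<close>

lemma ay_sides:
  "sides 0 big_poly = {(ay_edge 3, lower_start 3), (ay_edge 2, lower_start 2), (ay_edge 6, lower_start 6),
     (ay_edge 5, lower_start 5), (ay_edge 7, lower_start 7),
     (edge_opp (ay_edge 1), upper_start 1 + edge_vec (ay_edge 1)),
     (edge_opp (ay_edge 5), upper_start 5 + edge_vec (ay_edge 5)),
     (edge_opp (ay_edge 4), upper_start 4 + edge_vec (ay_edge 4)),
     (edge_opp (ay_edge 2), upper_start 2 + edge_vec (ay_edge 2)),
     (edge_opp (ay_edge 7), upper_start 7 + edge_vec (ay_edge 7))}"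
  "sides 0 medium_poly = {(ay_edge 4, lower_start 4), (ay_edge 8, lower_start 8),
     (edge_opp (ay_edge 6), upper_start 6 + edge_vec (ay_edge 6)),
     (edge_opp (ay_edge 8), upper_start 8 + edge_vec (ay_edge 8))}"
  "sides 0 small_poly = {(ay_edge 1, lower_start 1), (ay_edge 9, lower_start 9),
     (edge_opp (ay_edge 3), upper_start 3 + edge_vec (ay_edge 3)),
     (edge_opp (ay_edge 9), upper_start 9 + edge_vec (ay_edge 9))}"
  unfolding ay_poly_edges
  by (simp_all add: vec_ay_edge vec_opp lower_start_def upper_start_def lower_def upper_def ay_offset_def
      ay_g_simps add.assoc del: ay_tau.simps) (simp_all add: ac_simps del: ay_tau.simps)

lemma bex_labels: "(\<exists>i\<in>{1..9::nat}. Q i) \<longleftrightarrow>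
    Q (Suc 0) \<or> Q 2 \<or> Q 3 \<or> Q 4 \<or> Q 5 \<or> Q 6 \<or> Q 7 \<or> Q 8 \<or> Q 9"
proof -
  have "{1..9::nat} = {Suc 0, 2, 3, 4, 5, 6, 7, 8, 9}"
    by auto
  then show ?thesis
    by (simp only: bex_simps) simp
qed

lemma label_cases_6: "i \<in> {1..6::nat} \<longleftrightarrow> i = Suc 0 \<or> i = 2 \<or> i = 3 \<or> i = 4 \<or> i = 5 \<or> i = 6"
  by auto

lemma vec_ay_edge_segment: "i \<in> {1..6} \<Longrightarrow> edge_vec (ay_edge i) = ay_g i"
  unfolding label_cases_6 by (elim disjE) (simp_all add: vec_ay_edge ay_g_simps)

abbreviation "ay_polys \<equiv> {big_poly, medium_poly, small_poly}"

lemma ay_poly_in: "ay_poly P \<in> ay_polys"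
  by (cases P) auto

lemma ay_poly_inject: "ay_poly P = ay_poly Q \<longleftrightarrow> P = Q"
  by (cases P; cases Q) (simp_all add: big_poly_def medium_poly_def small_poly_def)

lemma mem_sides_ay_poly:
  "(e, a) \<in> sides 0 (ay_poly P) \<longleftrightarrow> (\<exists>i\<in>{1..9}.
     e = ay_edge i \<and> P = lower i \<and> a = lower_start i \<or>
     e = edge_opp (ay_edge i) \<and> P = upper i \<and> a = upper_start i + edge_vec (ay_edge i))"
  unfolding bex_labels by (cases P) (auto simp: ay_sides lower_def upper_def)

text \<open>Each identification occurs in both directions, once for each half-edge of the pair;
  starting from the reversed half-edge the parameter is \<open>1 - s\<close>.\<close>

lemma glue_ay_polys:
  "glue ay_polys x y \<longleftrightarrow> (\<exists>i\<in>{1..9}. \<exists>s. 0 \<le> s \<and> s \<le> 1 \<and>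
     (x = (ay_poly (lower i), lower_start i + s *\<^sub>R edge_vec (ay_edge i)) \<and>
      y = (ay_poly (upper i), upper_start i + s *\<^sub>R edge_vec (ay_edge i)) \<or>
      y = (ay_poly (lower i), lower_start i + s *\<^sub>R edge_vec (ay_edge i)) \<and>
      x = (ay_poly (upper i), upper_start i + s *\<^sub>R edge_vec (ay_edge i))))"
  (is "_ = ?R x y")
proof
  assume "glue ay_polys x y"
  then show "?R x y"
  proof cases
    case (1 xs ys e a b s)
    obtain P Q where PQ: "xs = ay_poly P" "ys = ay_poly Q"
      using 1(3,4) by (metis ay_poly.simps empty_iff insert_iff)
    have ne: "ay_edge i \<noteq> edge_opp (ay_edge j)" if "i \<in> {1..9}" for i j
      using that by (auto simp: ay_edge_def edge_opp_def)
    have inj: "ay_edge i = ay_edge j \<longleftrightarrow> i = j" for i j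
      by (auto simp: ay_edge_def)
    have oinj: "edge_opp e = edge_opp d \<longleftrightarrow> e = d" for e d
      using opp_opp by metis
    obtain i where i: "i \<in> {1..9}" "e = ay_edge i \<and> P = lower i \<and> a = lower_start i \<or>
        e = edge_opp (ay_edge i) \<and> P = upper i \<and> a = upper_start i + edge_vec (ay_edge i)"
      using 1(5) unfolding PQ mem_sides_ay_poly by blast
    obtain j where j: "j \<in> {1..9}" "edge_opp e = ay_edge j \<and> Q = lower j \<and> b = lower_start j \<or>
        edge_opp e = edge_opp (ay_edge j) \<and> Q = upper j \<and> b = upper_start j + edge_vec (ay_edge j)"
      using 1(6) unfolding PQ mem_sides_ay_poly by blast
    from i(2) show "?R x y"
    proof
      assume e: "e = ay_edge i \<and> P = lower i \<and> a = lower_start i"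
      then have "Q = upper i \<and> b = upper_start i + edge_vec (ay_edge i)"
        using j ne inj oinj by metis
      then show ?thesis
        using 1 e i(1) PQ by (intro bexI[of _ i] exI[of _ s]) (auto simp: vec_opp algebra_simps)
    next
      assume e: "e = edge_opp (ay_edge i) \<and> P = upper i \<and> a = upper_start i + edge_vec (ay_edge i)"
      then have "Q = lower i \<and> b = lower_start i"
        using j ne inj oinj opp_opp by metis
      then show ?thesis
        using 1 e i(1) PQ by (intro bexI[of _ i] exI[of _ "1 - s"]) (auto simp: vec_opp opp_opp algebra_simps)
    qed
  qed
next
  assume "?R x y"
  then obtain i s where i: "i \<in> {1..9}" and s: "0 \<le> s" "s \<le> 1" and
    xy: "x = (ay_poly (lower i), lower_start i + s *\<^sub>R edge_vec (ay_edge i)) \<and>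
      y = (ay_poly (upper i), upper_start i + s *\<^sub>R edge_vec (ay_edge i)) \<or>
      y = (ay_poly (lower i), lower_start i + s *\<^sub>R edge_vec (ay_edge i)) \<and>
      x = (ay_poly (upper i), upper_start i + s *\<^sub>R edge_vec (ay_edge i))"
    by blast
  have lo: "(ay_edge i, lower_start i) \<in> sides 0 (ay_poly (lower i))"
    and up: "(edge_opp (ay_edge i), upper_start i + edge_vec (ay_edge i)) \<in> sides 0 (ay_poly (upper i))"
    unfolding mem_sides_ay_poly using i by blast+
  have "glue ay_polys (ay_poly (lower i), lower_start i + s *\<^sub>R edge_vec (ay_edge i))
      (ay_poly (upper i), (upper_start i + edge_vec (ay_edge i)) + (1 - s) *\<^sub>R edge_vec (edge_opp (ay_edge i)))"
    by (rule glue.intros[OF ay_poly_in ay_poly_in lo up s])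
  moreover have "glue ay_polys
      (ay_poly (upper i), (upper_start i + edge_vec (ay_edge i)) + (1 - s) *\<^sub>R edge_vec (edge_opp (ay_edge i)))
      (ay_poly (lower i), lower_start i + (1 - (1 - s)) *\<^sub>R edge_vec (edge_opp (edge_opp (ay_edge i))))"
    by (rule glue.intros[OF ay_poly_in ay_poly_in up]) (use lo s in \<open>auto simp: opp_opp\<close>)
  ultimately show "glue ay_polys x y"
    using xy by (auto simp: vec_opp opp_opp algebra_simps)
qed

text \<open>Regarding left sides as upper and right sides as lower brings the two rules of
  \<open>ay_glue\<close> to one form.\<close>

lemma ay_glue_iff:
  "ay_glue x y \<longleftrightarrow> (\<exists>i\<in>{1..9}. \<exists>s. 0 \<le> s \<and> s \<le> 1 \<and>
     x = (upper i, upper_start i + s *\<^sub>R edge_vec (ay_edge i)) \<and>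
     y = (lower i, lower_start i + s *\<^sub>R edge_vec (ay_edge i)))"
  (is "_ = ?R x y")
proof
  assume "ay_glue x y"
  then show "?R x y"
  proof cases
    case (side s P)
    define i :: nat where "i = (case P of Big \<Rightarrow> 7 | Medium \<Rightarrow> 8 | Small \<Rightarrow> 9)"
    show ?thesis
      using side by (intro bexI[of _ i] exI[of _ s])
        (cases P; simp add: i_def lower_def upper_def lower_start_def upper_start_def vec_ay_edge del: ay_tau.simps)+
  next
    case (segment i P Q s)
    have "i \<in> {1..6} \<and> P = upper i \<and> Q = lower i"
      using segment(3,4) by (cases P; cases Q) (auto simp: upper_def lower_def)
    then have "i \<in> {1..6}" "P = upper i" "Q = lower i"
      by blast+
    moreover from this have "edge_vec (ay_edge i) = ay_g i"
      by (simp only: vec_ay_edge_segment)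
    ultimately show ?thesis
      using segment by (intro bexI[of _ i] exI[of _ s]) (auto simp: lower_start_def upper_start_def)
  qed
next
  assume "?R x y"
  then obtain i s where i: "i \<in> {1..9}" and s: "0 \<le> s" "s \<le> 1" and
    xy: "x = (upper i, upper_start i + s *\<^sub>R edge_vec (ay_edge i))"
     "y = (lower i, lower_start i + s *\<^sub>R edge_vec (ay_edge i))"
    by blast
  show "ay_glue x y"
  proof (cases "i \<le> 6")
    case True
    then have i6: "i \<in> {1..6}"
      using i by simp
    then have "i \<in> set (ay_top (upper i))" "i \<in> set (ay_bottom (lower i))"
      unfolding label_cases_6 by (elim disjE; simp add: upper_def lower_def)+
    with vec_ay_edge_segment[OF i6] show ?thesis
      using True s unfolding xy lower_start_def upper_start_def by (auto intro: ay_glue.segment)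
  next
    case False
    then have "i = 7 \<or> i = 8 \<or> i = 9"
      using i by auto
    then have "edge_vec (ay_edge i) = ay_tau (lower i)" "upper i = lower i"
      using vec_ay_edge by (auto simp: upper_def lower_def)
    then show ?thesis
      using False s ay_glue.side[of s "lower i"] unfolding xy lower_start_def upper_start_def by simp
  qed
qed

abbreviation ay_set :: "ay_piece \<Rightarrow> (real^2) set" where
  "ay_set P \<equiv> convex hull {0, ay_w P, ay_w P + ay_tau P, ay_tau P}"

lemma ay_surface_glued: "ay_surface = glued ay_set UNIV ay_glue"
  unfolding ay_surface_def glued_def ay_rel_def glue_rel_def ay_pieces_def ..

lemma ay_alpha_pos: "0 < ay_alpha" and ay_alpha_less_1: "ay_alpha < 1"
  using ay_alpha_bounds by simp_all

text \<open>Because the vectors are parallel, the subdivision points of the big parallelogram lie on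
  its sides and do not enlarge the hull.\<close>

lemma ay_g_parallel:
  defines "d \<equiv> vector [1, 1 - ay_alpha^2] :: real^2"
  shows "ay_g 3 = (3 + 2 * ay_alpha + ay_alpha^2) *\<^sub>R d" "ay_g 2 = ay_alpha *\<^sub>R d" "ay_g 4 = (1 + ay_alpha^2) *\<^sub>R d"
proof -
  have "(3 + 2 * ay_alpha + ay_alpha^2) * (1 - ay_alpha^2) = 2 + 2 * ay_alpha"
    "ay_alpha * (1 - ay_alpha^2) = -1 + 2 * ay_alpha + ay_alpha^2"
    "(1 + ay_alpha^2) * (1 - ay_alpha^2) = 2 - 2 * ay_alpha"
    using ay_alpha_root by algebra+
  then show "ay_g 3 = (3 + 2 * ay_alpha + ay_alpha^2) *\<^sub>R d" "ay_g 2 = ay_alpha *\<^sub>R d" "ay_g 4 = (1 + ay_alpha^2) *\<^sub>R d"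
    by (simp_all add: d_def ay_g_def Let_def vec_eq_iff forall_2)
qed

lemma subdivision_in_parallelogram:
  fixes d t :: "real^2"
  assumes "0 \<le> y" "y \<le> W"
  shows "y *\<^sub>R d \<in> convex hull {0, W *\<^sub>R d, W *\<^sub>R d + t, t}" "t + y *\<^sub>R d \<in> convex hull {0, W *\<^sub>R d, W *\<^sub>R d + t, t}"
proof -
  let ?H = "convex hull {0, W *\<^sub>R d, W *\<^sub>R d + t, t}"
  obtain u where u: "0 \<le> u" "u \<le> 1" "y = u * W"
    using assms by (cases "W = 0") (auto intro: that[of "y / W"] that[of 0])
  have in_H: "0 \<in> ?H" "W *\<^sub>R d \<in> ?H" "W *\<^sub>R d + t \<in> ?H" "t \<in> ?H"
    by (auto intro: hull_inc)
  have "(1 - u) *\<^sub>R 0 + u *\<^sub>R (W *\<^sub>R d) \<in> ?H" "(1 - u) *\<^sub>R t + u *\<^sub>R (W *\<^sub>R d + t) \<in> ?H"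
    by (rule convexD[OF convex_convex_hull in_H(1,2)] convexD[OF convex_convex_hull in_H(4,3)];
        use u in simp)+
  then show "y *\<^sub>R d \<in> ?H" "t + y *\<^sub>R d \<in> ?H"
    using u by (simp_all add: algebra_simps)
qed

text \<open>The medium and the small polygon have just the four corners as vertices; the big one has
  six more, all on its bottom and top sides.\<close>

lemma poly_ay_poly: "poly (ay_poly P) = ay_set P"
proof (cases P)
  case Medium
  have "snd ` sides 0 medium_poly = {0, ay_w Medium, ay_w Medium + ay_tau Medium, ay_tau Medium}"
    by (simp add: ay_sides vec_ay_edge lower_start_def upper_start_def lower_def upper_def ay_offset_def
      ay_g_simps del: ay_tau.simps) (auto simp: add.commute)
  then show ?thesis
    using Medium by (simp add: poly_def)
next
  case Small
  have "snd ` sides 0 small_poly = {0, ay_w Small, ay_w Small + ay_tau Small, ay_tau Small}"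
    by (simp add: ay_sides vec_ay_edge lower_start_def upper_start_def lower_def upper_def ay_offset_def
      ay_g_simps del: ay_tau.simps) (auto simp: add.commute)
  then show ?thesis
    using Small by (simp add: poly_def)
next
  case Big
  let ?t = "ay_tau Big" and ?w = "ay_w Big" and ?a = ay_alpha
  define d where "d = (vector [1, 1 - ay_alpha^2] :: real^2)"
  define x where "x = 3 + 2 * ay_alpha + ay_alpha^2"
  define y where "y = 1 + ay_alpha^2"
  have g: "ay_g 3 = x *\<^sub>R d" "ay_g 2 = ?a *\<^sub>R d" "ay_g 4 = y *\<^sub>R d"
    unfolding x_def y_def d_def by (rule ay_g_parallel)+
  have pos: "x > 0" "y > 0" "?a > 0"
    using ay_alpha_pos by (auto simp: x_def y_def intro!: add_pos_nonneg)
  define W where "W = x + y + 2 * ?a"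
  have w: "?w = W *\<^sub>R d"
    by (simp add: ay_g_simps g W_def algebra_simps flip: scaleR_add_left)
  have verts: "snd ` sides 0 big_poly = {0, x *\<^sub>R d, (x + ?a) *\<^sub>R d, (x + ?a + y) *\<^sub>R d, ?w, ?w + ?t,
      ?t + (?a *\<^sub>R d + y *\<^sub>R d + ?a *\<^sub>R d), ?t + (?a + y) *\<^sub>R d, ?t + ?a *\<^sub>R d, ?t}"
    by (simp add: ay_sides vec_ay_edge lower_start_def upper_start_def lower_def upper_def ay_offset_def
      ay_g_simps g scaleR_add_left del: ay_tau.simps) (simp add: ac_simps del: ay_tau.simps)
  have "?a *\<^sub>R d + y *\<^sub>R d + ?a *\<^sub>R d = (?a + y + ?a) *\<^sub>R d"
    by (simp only: scaleR_add_left)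
  moreover have "x *\<^sub>R d \<in> ay_set Big" "(x + ?a) *\<^sub>R d \<in> ay_set Big" "(x + ?a + y) *\<^sub>R d \<in> ay_set Big"
    "?t + (?a + y + ?a) *\<^sub>R d \<in> ay_set Big" "?t + (?a + y) *\<^sub>R d \<in> ay_set Big" "?t + ?a *\<^sub>R d \<in> ay_set Big"
    unfolding w using pos by (intro subdivision_in_parallelogram; simp add: W_def)+
  moreover have "0 \<in> ay_set Big" "?w \<in> ay_set Big" "?w + ?t \<in> ay_set Big" "?t \<in> ay_set Big"
    by (rule hull_inc; simp only: insert_iff simp_thms)+
  ultimately have "snd ` sides 0 big_poly \<subseteq> ay_set Big"
    unfolding verts by (simp only: insert_subset empty_subsetI simp_thms)
  then have "poly big_poly \<subseteq> ay_set Big"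
    unfolding poly_def by (rule hull_minimal) simp
  moreover have "ay_set Big \<subseteq> poly big_poly"
    unfolding poly_def verts by (intro hull_mono) (auto simp del: ay_tau.simps ay_w.simps)
  ultimately show ?thesis
    using Big by simp
qed

lemma total_ay_poly: "total (ay_poly P) = 0"
  by (cases P) (simp_all add: ay_poly_edges vec_ay_edge vec_opp ay_g_simps del: ay_tau.simps)

lemma closed_up_ay_polys: "closed_up ay_polys"
  using total_ay_poly[of Big] total_ay_poly[of Medium] total_ay_poly[of Small]
  by (simp add: closed_up_def)

text \<open>The pieces correspond one to one, so this refinement only renames them; the gluing of
  half-edges in both directions and the directed \<open>ay_glue\<close> generate the same
  equivalence.\<close>

lemma ay_surface_polygons: "\<exists>f. affine_iso (surf ay_polys) ay_surface f (mat 1)"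
proof -
  define p where "p xs = (THE P. ay_poly P = xs)" for xs
  have p: "p (ay_poly P) = P" for P
    unfolding p_def by (rule the_equality) (auto simp: ay_poly_inject)
  have ex: "\<exists>P. xs = ay_poly P" if "xs \<in> ay_polys" for xs
    using that by (metis ay_poly.simps empty_iff insert_iff)
  interpret refinement ay_set UNIV ay_glue poly ay_polys "glue ay_polys" "mat 1" p "\<lambda>_. 0"
  proof
    show "ay_set P = (\<Union>j \<in> {j \<in> ay_polys. p j = P}. (\<lambda>v. mat 1 *v v + 0) ` poly j)" for P
    proof -
      have "j \<in> ay_polys \<and> p j = P \<longleftrightarrow> j = ay_poly P" for j
        using ex p ay_poly_in by metis
      then have "{j \<in> ay_polys. p j = P} = {ay_poly P}"
        by blast
      then show ?thesis
        by (simp add: poly_ay_poly)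
    qed
    show "equivclp ay_glue (p j, mat 1 *v v + 0) (p k, mat 1 *v w + 0)"
      if glue: "glue ay_polys (j, v) (k, w)" for j v k w
    proof -
      obtain i s where i: "i \<in> {1..9}" and s: "0 \<le> s" "s \<le> 1" and
        *: "(j, v) = (ay_poly (lower i), lower_start i + s *\<^sub>R edge_vec (ay_edge i)) \<and>
            (k, w) = (ay_poly (upper i), upper_start i + s *\<^sub>R edge_vec (ay_edge i)) \<or>
            (k, w) = (ay_poly (lower i), lower_start i + s *\<^sub>R edge_vec (ay_edge i)) \<and>
            (j, v) = (ay_poly (upper i), upper_start i + s *\<^sub>R edge_vec (ay_edge i))"
        using glue unfolding glue_ay_polys by blast
      have "ay_glue (upper i, upper_start i + s *\<^sub>R edge_vec (ay_edge i))
          (lower i, lower_start i + s *\<^sub>R edge_vec (ay_edge i))"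
        unfolding ay_glue_iff using i s by blast
      then have "ay_glue (p j, v) (p k, w) \<or> ay_glue (p k, w) (p j, v)"
        using * p by auto
      then show ?thesis
        by (auto intro: r_into_equivclp equivclp_sym)
    qed
    show "\<exists>j v k w. j \<in> ay_polys \<and> v \<in> poly j \<and> k \<in> ay_polys \<and> w \<in> poly k \<and>
        x = (p j, mat 1 *v v + 0) \<and> y = (p k, mat 1 *v w + 0) \<and> equivclp (glue ay_polys) (j, v) (k, w)"
      if "ay_glue x y" for x y
    proof -
      obtain i s where i: "i \<in> {1..9}" and s: "0 \<le> s" "s \<le> 1" and
        xy: "x = (upper i, upper_start i + s *\<^sub>R edge_vec (ay_edge i))"
         "y = (lower i, lower_start i + s *\<^sub>R edge_vec (ay_edge i))"
        using \<open>ay_glue x y\<close> unfolding ay_glue_iff by blast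
      have g: "glue ay_polys (ay_poly (upper i), snd x) (ay_poly (lower i), snd y)"
        unfolding glue_ay_polys using i s xy by (intro bexI[of _ i] exI[of _ s]) simp_all
      from g have "snd x \<in> poly (ay_poly (upper i)) \<and> snd y \<in> poly (ay_poly (lower i))"
      proof cases
        case (1 e a b s)
        then show ?thesis
          using side_in_poly[OF _ total_ay_poly] opposite_side_in_poly[OF _ total_ay_poly] by simp
      qed
      then show ?thesis
        using g xy p ay_poly_in r_into_equivclp
        by (intro exI[of _ "ay_poly (upper i)"] exI[of _ "snd x"] exI[of _ "ay_poly (lower i)"] exI[of _ "snd y"])
          auto
    qed
    show "equivclp (glue ay_polys) (j, v) (k, w)" if "j \<in> ay_polys" "v \<in> poly j" "k \<in> ay_polys" "w \<in> poly k"
        "p j = p k" "mat 1 *v v + 0 = mat 1 *v w + 0" for j v k w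
    proof -
      have "j = k"
        using ex[OF that(1)] ex[OF that(3)] that(5) p by metis
      moreover have "v = w"
        using that(6) by simp
      ultimately show ?thesis
        by simp
    qed
  qed (simp_all add: compact_poly invertible_def exI[of _ "mat 1"])
  show ?thesis
    using affine_iso_F unfolding ay_surface_glued by blast
qed

section \<open>Pseudo-Anosov diffeomorphisms of the Arnoux-Yoccoz surface\<close>

text \<open>The derivative is read off at a point where the form does not vanish; the centre of the
  medium parallelogram is such a point.\<close>

lemma ay_nonzero_point: "\<exists>p. p \<in> topspace (space_of ay_surface) - zeroes ay_surface"
proof -
  define w where "w = ay_g 4"
  define t where "t = ay_tau Medium"
  define c where "c = cross w t"
  have c: "c > 0"
  proof -
    have "cpos (ccross ((1, 0, 1), (2, -2, 0)) ((1, -1, 0), (0, 0, 2)))"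
      by code_simp
    from cpos_sound[OF this] have "cross (edge_vec (ay_edge 4)) (edge_vec (ay_edge 8)) > 0"
      by (simp only: val_ccross) (simp add: edge_vec_def ay_edge_def)
    then show ?thesis
      by (simp add: c_def w_def t_def vec_ay_edge del: ay_tau.simps)
  qed
  \<comment> \<open>The open parallelogram, described by the area coordinates
    \<open>cross v t / c\<close> along \<open>w\<close> and \<open>cross w v / c\<close> along
    \<open>t\<close>.\<close>
  define W where "W = {v. 0 < cross w v \<and> cross w v < c \<and> 0 < cross v t \<and> cross v t < c}"
  have "open W"
    unfolding W_def cross_def by (intro open_Collect_conj open_Collect_less continuous_intros)
  moreover have "W \<subseteq> ay_set Medium"
  proof
    fix v assume v: "v \<in> W"
    define x where "x = cross v t / c"
    define y where "y = cross w v / c"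
    have xy: "0 \<le> x" "x \<le> 1" "0 \<le> y" "y \<le> 1"
      using v c by (auto simp: W_def x_def y_def)
    have "c *\<^sub>R v = cross v t *\<^sub>R w + cross w v *\<^sub>R t"
    proof -
      have "(- cross w v) *\<^sub>R t + cross w t *\<^sub>R v + (- cross v t) *\<^sub>R w = 0"
        using cross_cyclic[of v w t] by (simp only: cross_swap[of v w] cross_swap[of t v])
      then show ?thesis
        by (simp add: c_def algebra_simps)
    qed
    then have "(1 / c) *\<^sub>R (c *\<^sub>R v) = (1 / c) *\<^sub>R (cross v t *\<^sub>R w + cross w v *\<^sub>R t)"
      by simp
    then have "v = x *\<^sub>R w + y *\<^sub>R t"
      using c by (simp add: x_def y_def scaleR_add_right)
    also have "\<dots> = (1 - y) *\<^sub>R (x *\<^sub>R w) + y *\<^sub>R (t + x *\<^sub>R w)"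
      by (simp add: algebra_simps)
    also have "\<dots> \<in> ay_set Medium"
    proof (rule convexD[OF convex_convex_hull])
      show "x *\<^sub>R w \<in> ay_set Medium" "t + x *\<^sub>R w \<in> ay_set Medium"
        using subdivision_in_parallelogram[where y = x and W = 1 and d = w and t = t] xy
        by (simp_all add: w_def t_def del: ay_tau.simps)
    qed (use xy in auto)
    finally show "v \<in> ay_set Medium" .
  qed
  moreover have "(1 / 2) *\<^sub>R (w + t) \<in> W"
    using c by (simp add: W_def cross_simps flip: c_def)
  moreover have "\<not> ay_glue (Medium, v) z \<and> \<not> ay_glue z (Medium, v)" if "v \<in> W" for v z
  proof -
    \<comment> \<open>On each of the four side lines one of the areas \<open>cross v t\<close> and
      \<open>cross w v\<close> is 0 or \<open>c\<close>.\<close>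
    have "v \<noteq> t + s *\<^sub>R w" "v \<noteq> s *\<^sub>R t" "v \<noteq> s *\<^sub>R w" "v \<noteq> w + s *\<^sub>R t" for s
      using that by (auto simp: W_def cross_simps c_def)
    then show ?thesis
      unfolding ay_glue_iff bex_labels
      by (auto simp: upper_def lower_def upper_start_def lower_start_def vec_ay_edge ay_offset_def
          ay_g_simps w_def t_def simp del: ay_tau.simps)
  qed
  ultimately show ?thesis
    using singular_free_point[of Medium UNIV W ay_set _ ay_glue] unfolding ay_surface_glued by blast
qed

text \<open>Gives the definite description in \<open>affine_derivative\<close> its value.\<close>

lemma ay_derivative_unique:
  assumes "affine_with_derivative ay_surface f A" "affine_with_derivative ay_surface f B"
  shows "A = B"
proof -
  obtain p where p: "p \<in> topspace (space_of ay_surface) - zeroes ay_surface"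
    using ay_nonzero_point by blast
  show ?thesis
    by (rule affine_derivative_unique[OF _ p assms])
      (simp only: ay_surface_glued primitive_difference_locally_constant)
qed

lemma ay_affine_derivative:
  assumes "affine_with_derivative ay_surface f A"
  shows "affine_diffeo ay_surface f" "affine_derivative ay_surface f = A"
  using assms ay_derivative_unique unfolding affine_diffeo_def affine_derivative_def by blast+

text \<open>The entry \<open>(1, 1, 1)\<close> is 1 + \<alpha> + \<alpha>^2 = 1 / \<alpha>, so the
  first matrix is the prescribed derivative of \<Phi>. The self-maps are found on the triangulated
  surface and conjugated to \<open>ay_surface\<close> by a map with derivative \<open>mat 1\<close>,
  which leaves their derivatives unchanged.\<close>

lemma ay_self_maps:
  obtains f g where
    "affine_iso ay_surface ay_surface f (mat_of (((0, 1, 0), (0, 0, 0)), ((0, 0, 0), (1, 1, 1))))"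
    "det (mat_of (((0, 1, 0), (0, 0, 0)), ((0, 0, 0), (1, 1, 1)))) = 1"
    "affine_iso ay_surface ay_surface g (mat_of (((-41, -35, -23), (53, 45, 29)), ((-40, -34, -22), (52, 43, 28))))"
    "det (mat_of (((-41, -35, -23), (53, 45, 29)), ((-40, -34, -22), (52, 43, 28)))) = 1"
proof -
  obtain ts where ts: "triangulation = Some ts"
    using certificate by (cases triangulation) auto
  obtain us where us: "steps ear [(8, 10), (-2, 11), (9, 12), (-4, 13), (-5, 14), (-1, 15), (15, 16), (5, 17), (6, 18)]
      [big_poly, medium_poly, small_poly] = Some us"
    "steps flip [15, 1, 3, 15, 10, 7] us = Some ts"
    using ts by (auto simp: triangulation_def bind_eq_Some_conv)
  have 1: "iso ay_polys (set us) \<and> closed_up (set us)"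
    using steps_sound[OF us(1)] closed_up_ay_polys ear_sound by auto
  then have 2: "iso (set us) (set ts) \<and> closed_up (set ts)"
    using steps_sound[OF us(2)] flip_sound by auto
  have "iso (set ts) ay_polys"
    using 1 2 iso_trans iso_sym by blast
  then obtain h where h: "affine_iso (surf (set ts)) (surf ay_polys) h (mat 1)"
    by (auto simp: iso_def)
  obtain k where k: "affine_iso (surf ay_polys) ay_surface k (mat 1)"
    using ay_surface_polygons by blast
  define c where "c = k \<circ> h"
  have c: "affine_iso (surf (set ts)) ay_surface c (mat 1)"
    using affine_iso_compose[OF h k] by (simp add: c_def)
  obtain d where d: "affine_iso ay_surface (surf (set ts)) d (mat 1)"
    by (rule affine_iso_inverse[OF c, of "mat 1"]) (simp, blast)
  have self: "\<exists>f. affine_iso ay_surface ay_surface f (mat_of M)" "det (mat_of M) = 1"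
    if ok: "self_map_ok ts ns tab tab' M" for ns tab tab' M
  proof -
    obtain f where f: "affine_iso (surf (set ts)) (surf (set ts)) f (mat_of M)"
      using self_map_sound(1)[OF ok] 2 by blast
    show "\<exists>f. affine_iso ay_surface ay_surface f (mat_of M)"
      using affine_iso_compose[OF affine_iso_compose[OF d f] c] by auto
    show "det (mat_of M) = 1"
      using self_map_sound(2)[OF ok] 2 by blast
  qed
  have cert: "\<exists>ns tab tab'. self_map_ok ts ns tab tab' (((0, 1, 0), (0, 0, 0)), ((0, 0, 0), (1, 1, 1)))"
    "\<exists>ns tab tab'. self_map_ok ts ns tab tab' (((-41, -35, -23), (53, 45, 29)), ((-40, -34, -22), (52, 43, 28)))"
    using certificate unfolding ts option.case by blast+
  show thesis
    using that self cert by metis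
qed

lemma eigenvalue_iff:
  fixes A :: "real^2^2"
  assumes "A$1$2 \<noteq> 0" "det A = 1"
  shows "(\<exists>v. eigenvector_of A v c) \<longleftrightarrow> c^2 - trace A * c + 1 = 0"
proof
  have d: "A$1$1 * A$2$2 - A$1$2 * A$2$1 = 1"
    using assms(2) by (simp add: det_2)
  assume "\<exists>v. eigenvector_of A v c"
  then obtain v :: "real^2" where v: "v \<noteq> 0" "A$1$1 * v$1 + A$1$2 * v$2 = c * v$1" "A$2$1 * v$1 + A$2$2 * v$2 = c * v$2"
    by (auto simp: eigenvector_of_def vec_eq_iff forall_2 matrix_vector_mult_def sum_2)
  have "(c^2 - trace A * c + 1) * v$1 = 0" "(c^2 - trace A * c + 1) * v$2 = 0"
    using v(2,3) d unfolding trace_def sum_2 by algebra+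
  then show "c^2 - trace A * c + 1 = 0"
    using v(1) by (auto simp: vec_eq_iff forall_2)
next
  have d: "A$1$1 * A$2$2 - A$1$2 * A$2$1 = 1"
    using assms(2) by (simp add: det_2)
  assume c: "c^2 - trace A * c + 1 = 0"
  have "A$2$1 * A$1$2 + A$2$2 * (c - A$1$1) = c * (c - A$1$1)"
    using c d unfolding trace_def sum_2 by algebra
  \<comment> \<open>This vector is annihilated by the first row of \<open>A\<close> minus
    \<open>c\<close> times the identity, and it is nonzero because \<open>A$1$2\<close> is.\<close>
  then have "eigenvector_of A (vector [A$1$2, c - A$1$1]) c"
    using assms(1) by (auto simp: eigenvector_of_def vec_eq_iff forall_2 matrix_vector_mult_def sum_2 algebra_simps)
  then show "\<exists>v. eigenvector_of A v c"
    by blast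
qed

section \<open>The two pseudo-Anosov diffeomorphisms, their directions and the expansion
  factor\<close>

theorem theorem1p1:
  shows "(\<exists>L L'. hyperbolic_direction ay_surface L \<and> hyperbolic_direction ay_surface L' \<and>
            L \<inter> L' = {0}) \<and>
         (\<exists>\<Phi>. arnoux_yoccoz_diffeo \<Phi> \<and> pseudo_anosov ay_surface \<Phi>) \<and>
         (\<exists>\<Phi>'. pseudo_anosov ay_surface \<Phi>' \<and>
            (\<forall>\<Phi>. arnoux_yoccoz_diffeo \<Phi> \<longrightarrow>
               (\<exists>x \<in> topspace (space_of ay_surface). \<Phi> (\<Phi>' x) \<noteq> \<Phi>' (\<Phi> x))) \<and>
            has_degree_over_rat (expansion_factor ay_surface \<Phi>') 6)"
proof -
  define D where "D = mat_of (((0, 1, 0), (0, 0, 0)), ((0, 0, 0), (1, 1, 1)))"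
  define B where "B = mat_of (((-41, -35, -23), (53, 45, 29)), ((-40, -34, -22), (52, 43, 28)))"
  obtain f g where f: "affine_iso ay_surface ay_surface f D" "det D = 1"
    and g: "affine_iso ay_surface ay_surface g B" "det B = 1"
    using ay_self_maps unfolding D_def B_def by metis
  let ?a = ay_alpha
  have a: "0 < ?a" "?a < 1"
    by (rule ay_alpha_pos ay_alpha_less_1)+
  have inv_a: "1 + ?a + ?a^2 = 1 / ?a"
    using ay_alpha_root a by (simp add: field_simps power2_eq_square power3_eq_cube)
  have D: "D = vector [vector [?a, 0], vector [0, 1 / ?a]]"
    by (simp add: D_def val.simps inv_a)
  \<comment> \<open>The entry \<open>B$1$2\<close> supplies eigenvectors and prevents
    \<open>B\<close> from commuting with \<open>D\<close>; the entry \<open>B$2$1\<close> keeps the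
    horizontal axis from being an eigendirection of \<open>B\<close>.\<close>
  have B12: "B$1$2 > 0" and B21: "B$2$1 < 0"
    using a zero_le_power2[of ?a] by (simp_all add: B_def val.simps, linarith+)
  have trB: "trace B = rval 11 8 5"
    by (simp add: B_def val.simps trace_def sum_2 rval_def)
  have trB2: "trace B > 2"
    using a unfolding trB by (simp add: rval_def add_pos_pos less_add_same_cancel1)
  have fD: "affine_with_derivative ay_surface f D" and gB: "affine_with_derivative ay_surface g B"
    using affine_with_derivative_affine_iso[OF f] affine_with_derivative_affine_iso[OF g] .
  note df = ay_affine_derivative[OF fD] and dg = ay_affine_derivative[OF gB]
  have "trace D > 2"
  proof -
    have "trace D = ?a + (1 + ?a + ?a^2)"
      by (simp add: D trace_def sum_2 inv_a)
    then show ?thesis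
      using ay_alpha_bounds(1) ay_alpha_square_bounds(1) by simp
  qed
  then have pf: "pseudo_anosov ay_surface f" and pg: "pseudo_anosov ay_surface g"
    using df dg trB2 by (simp_all add: pseudo_anosov_def)
  have ayf: "arnoux_yoccoz_diffeo f"
    using df D by (simp add: arnoux_yoccoz_diffeo_def)

  define s where "s = sqrt ((trace B)^2 - 4)"
  \<comment> \<open>The larger root of the characteristic polynomial of \<open>B\<close>; the other
    root \<open>trace B - l\<close> is \<open>1 / l\<close>, so both are positive.\<close>
  define l where "l = (trace B + s) / 2"
  have s2: "s^2 = (trace B)^2 - 4" and s: "s > 0"
    using trB2 power_strict_mono[of 2 "trace B" 2] by (auto simp: s_def)
  have l: "l^2 - trace B * l + 1 = 0"
    using s2 by (simp add: l_def power2_eq_square field_simps)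
  have ev: "(\<exists>v. eigenvector_of B v c) \<longleftrightarrow> c = l \<or> c = trace B - l" for c
  proof -
    have "c^2 - trace B * c + 1 = (c - l) * (c - (trace B - l))"
      using l by algebra
    then show ?thesis
      using eigenvalue_iff[of B c] B12 g(2) by simp
  qed
  have pos: "l > 0" "trace B - l < l" "trace B - l > 0"
  proof -
    have "2 * l = trace B + s"
      by (simp add: l_def)
    then show "l > 0" "trace B - l < l"
      using trB2 s by linarith+
    have "l * (trace B - l) = 1"
      using l by algebra
    then show "trace B - l > 0"
      using \<open>l > 0\<close> by (metis zero_less_mult_pos zero_less_one)
  qed
  have "{\<bar>c\<bar> | c. \<exists>v. eigenvector_of B v c} = {l, trace B - l}"
    unfolding ev using pos by (auto intro: exI[of _ l] exI[of _ "trace B - l"])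
  then have "expansion_factor ay_surface g = l"
    unfolding expansion_factor_def dg using pos by simp
  then have deg: "has_degree_over_rat (expansion_factor ay_surface g) 6"
    using degree_six l trB by simp

  \<comment> \<open>The matrix prescribes only the derivative of \<Phi>, so the claim is made for
    every such \<Phi>; derivatives of the two composites are all that is compared.\<close>
  have nc: "\<exists>x \<in> topspace (space_of ay_surface). \<Phi> (g x) \<noteq> g (\<Phi> x)" if ay: "arnoux_yoccoz_diffeo \<Phi>" for \<Phi>
  proof (rule ccontr)
    assume "\<not> ?thesis"
    then have comm: "(\<Phi> \<circ> g) x = (g \<circ> \<Phi>) x" if "x \<in> topspace (space_of ay_surface)" for x
      using that by simp
    obtain A where A: "affine_with_derivative ay_surface \<Phi> A"
      using ay by (auto simp: arnoux_yoccoz_diffeo_def affine_diffeo_def)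
    then have "A = D"
      using ay_affine_derivative(2)[OF A] ay D by (simp add: arnoux_yoccoz_diffeo_def)
    then have \<Phi>: "affine_with_derivative ay_surface \<Phi> D"
      using A by simp
    have "affine_with_derivative ay_surface (g \<circ> \<Phi>) (D ** B)"
      by (rule affine_with_derivative_cong[OF affine_with_derivative_compose_iso[OF \<Phi> g] comm])
    then have "D ** B = B ** D"
      using ay_derivative_unique affine_iso_compose_with_derivative[OF \<Phi> g] by blast
    \<comment> \<open>The upper right entries are \<alpha> and 1 / \<alpha> times
      \<open>B$1$2\<close>, so equality would force \<alpha>^2 = 1.\<close>
    then have "(D ** B)$1$2 = (B ** D)$1$2"
      by simp
    then have "?a * B$1$2 = B$1$2 * (1 / ?a)"
      by (simp add: D matrix_matrix_mult_def sum_2)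
    then have "B$1$2 * (?a * ?a) = B$1$2 * 1"
      using a by (simp add: field_simps)
    then have "?a * ?a = 1"
      using B12 by (metis less_irrefl mult_left_cancel)
    then show False
      using a mult_strict_mono[of ?a 1 ?a 1] by simp
  qed

  obtain v where v: "eigenvector_of B v l"
    using ev by blast
  \<comment> \<open>The horizontal axis is the contracted direction of \<open>D\<close>.\<close>
  have e1: "eigenvector_of D (axis 1 1) ?a"
    by (simp add: eigenvector_of_def D vec_eq_iff forall_2 matrix_vector_mult_def sum_2 axis_def)
  have "hyperbolic_direction ay_surface (span {axis 1 1})" "hyperbolic_direction ay_surface (span {v})"
    unfolding hyperbolic_direction_def using pf pg e1 v df(2) dg(2) by metis+
  moreover have "span {axis 1 1} \<inter> span {v} = {0}"
  proof -
    \<comment> \<open>A horizontal eigenvector of \<open>B\<close> would require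
      \<open>B$2$1 = 0\<close>.\<close>
    have v2: "v$2 \<noteq> 0"
    proof
      assume "v$2 = 0"
      then have "B$2$1 * v$1 = 0"
        using v by (auto simp: eigenvector_of_def vec_eq_iff forall_2 matrix_vector_mult_def sum_2)
      then have "v = 0"
        using B21 \<open>v$2 = 0\<close> by (simp add: vec_eq_iff forall_2)
      then show False
        using v by (simp add: eigenvector_of_def)
    qed
    have "x = 0" if x: "x \<in> span {axis 1 (1::real)}" "x \<in> span {v}" for x :: "real^2"
    proof -
      obtain b where b: "x = b *\<^sub>R axis 1 1"
        using x(1) by (auto simp: span_singleton)
      obtain c where c: "x = c *\<^sub>R v"
        using x(2) by (auto simp: span_singleton)
      have "c * v$2 = (b *\<^sub>R axis 1 1 :: real^2) $ 2"
        unfolding b[symmetric] c by simp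
      then have "c * v$2 = 0"
        by (simp add: axis_def)
      then show ?thesis
        using v2 c by simp
    qed
    then show ?thesis
      by (auto simp: span_zero)
  qed
  ultimately show ?thesis
    using ayf pf pg nc deg by blast
qed

end
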